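(* Let $n\geq 3$, let $k$ be an algebraically closed field, and let $Q$ be the $n$-Kronecker quiver, i.e. the quiver with two vertices $1$ and $2$ and $n$ arrows from $2$ to $1$. Then for each $m\geq 1$, the set $\mu^m=\{1,2,4,6,\ldots,2m,2m+1\}$ (consisting of $1$, all even numbers $2,4,\ldots,2m$, and $2m+1$) is a Gabriel-Roiter measure for $Q$ which does not admit a direct predecessor. Thus $\mathrm{ndp}(Q)=\infty$, i.e. there are infinitely many Gabriel-Roiter measures for $Q$ admitting no direct predecessor.
   Context: Modules are finite-dimensional representations of $Q$ over $k$; $|M|$ denotes the length of $M$ (equal to its total $k$-dimension). $\subset$ denotes proper inclusion. Total order on the set $\mathcal{P}(\mathbb{N}_1)$ of subsets of $\mathbb{N}_1=\{1,2,\ldots\}$: for $I\neq J$, write $I<J$ if the smallest element of $(I\setminus J)\cup(J\setminus I)$ belongs to $J$. For a module $M$, the Gabriel-Roiter (GR) measure $\mu(M)$ is the maximum, with respect to this order, of the sets $\{|M_1|,|M_2|,\ldots,|M_t|\}$, where $M_1\subset M_2\subset\cdots\subset M_t$ runs over chains of indecomposable submodules of $M$. A subset $I\subseteq\mathbb{N}_1$ is called a GR measure (for $Q$) if $I=\mu(M)$ for some indecomposable module $M$. For GR measures $I,I'$, $I'$ is a direct successor of $I$ (and $I$ is a direct predecessor of $I'$) if $I<I'$ and there is no GR measure $I''$ with $I<I''<I'$. $\mathrm{ndp}(Q)$ denotes the number of GR measures for $Q$ admitting no direct predecessor. *)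

theory Defs
  imports
    Graph_Theory.Digraph
    "HOL-Library.Function_Algebras"
    "HOL-Library.Extended_Nat"
    "HOL-Computational_Algebra.Polynomial"
begin

section \<open>The ambient vector space\<close>

text \<open>All vector spaces are realised inside the infinite-dimensional space \<open>nat \<Rightarrow> 'k\<close>,
  which contains a copy of every finite-dimensional \<open>'k\<close>-vector space. Hence every
  finite-dimensional representation of a quiver is isomorphic to one considered here.\<close>

type_synonym 'k vect = "nat \<Rightarrow> 'k"

definition kscale :: "'k::field \<Rightarrow> 'k vect \<Rightarrow> 'k vect" where
  "kscale c x = (\<lambda>i. c * x i)"

interpretation kvs: vector_space "kscale :: 'k::field \<Rightarrow> 'k vect \<Rightarrow> 'k vect"
  by unfold_locales (auto simp: kscale_def algebra_simps fun_eq_iff)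

definition linear_on :: "'k::field vect set \<Rightarrow> ('k vect \<Rightarrow> 'k vect) \<Rightarrow> bool" where
  "linear_on U f \<longleftrightarrow>
     (\<forall>x\<in>U. \<forall>y\<in>U. f (x + y) = f x + f y) \<and> (\<forall>c. \<forall>x\<in>U. f (kscale c x) = kscale c (f x))"


section \<open>Representations of quivers\<close>

text \<open>A representation is given by the spaces \<open>V v\<close> at the vertices and the maps \<open>f a\<close> along
  the arrows. Outside the vertices \<open>V\<close> is normalised to the zero space, so that equality
  and (proper) inclusion of submodules are equality and the order \<open>\<le>\<close>, \<open><\<close> on families of sets.
  The values of \<open>f a\<close> outside \<open>V (tail Q a)\<close> are irrelevant.\<close>

definition representation ::
  "('v, 'a) pre_digraph \<Rightarrow> ('v \<Rightarrow> 'k::field vect set) \<Rightarrow> ('a \<Rightarrow> 'k vect \<Rightarrow> 'k vect) \<Rightarrow> bool" where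
  "representation Q V f \<longleftrightarrow>
     (\<forall>v\<in>verts Q. \<exists>B. finite B \<and> V v = kvs.span B) \<and>
     (\<forall>v. v \<notin> verts Q \<longrightarrow> V v = {0}) \<and>
     (\<forall>a\<in>arcs Q. linear_on (V (tail Q a)) (f a) \<and> f a ` V (tail Q a) \<subseteq> V (head Q a))"

text \<open>A submodule \<open>W\<close> of \<open>(V, f)\<close> carries the maps \<open>f\<close> restricted to \<open>W\<close>.\<close>

definition submodule ::
  "('v, 'a) pre_digraph \<Rightarrow> ('v \<Rightarrow> 'k::field vect set) \<Rightarrow> ('a \<Rightarrow> 'k vect \<Rightarrow> 'k vect) \<Rightarrow>
   ('v \<Rightarrow> 'k vect set) \<Rightarrow> bool" where
  "submodule Q V f W \<longleftrightarrow> representation Q W f \<and> W \<le> V"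

definition zero_module :: "'v \<Rightarrow> 'k::field vect set" where
  "zero_module = (\<lambda>_. {0})"

definition module_length ::
  "('v, 'a) pre_digraph \<Rightarrow> ('v \<Rightarrow> 'k::field vect set) \<Rightarrow> nat" where
  "module_length Q V = (\<Sum>v\<in>verts Q. kvs.dim (V v))"

definition direct_sum ::
  "('v, 'a) pre_digraph \<Rightarrow> ('v \<Rightarrow> 'k::field vect set) \<Rightarrow>
   ('v \<Rightarrow> 'k vect set) \<Rightarrow> ('v \<Rightarrow> 'k vect set) \<Rightarrow> bool" where
  "direct_sum Q V W W' \<longleftrightarrow>
     (\<forall>v\<in>verts Q. V v = {x + y | x y. x \<in> W v \<and> y \<in> W' v} \<and> W v \<inter> W' v = {0})"

definition indecomposable ::
  "('v, 'a) pre_digraph \<Rightarrow> ('v \<Rightarrow> 'k::field vect set) \<Rightarrow> ('a \<Rightarrow> 'k vect \<Rightarrow> 'k vect) \<Rightarrow> bool" where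
  "indecomposable Q V f \<longleftrightarrow> representation Q V f \<and> V \<noteq> zero_module \<and>
     (\<forall>W W'. submodule Q V f W \<and> submodule Q V f W' \<and> direct_sum Q V W W' \<longrightarrow>
        W = zero_module \<or> W' = zero_module)"


section \<open>Gabriel-Roiter measures\<close>

definition gr_less :: "nat set \<Rightarrow> nat set \<Rightarrow> bool" where
  "gr_less I J \<longleftrightarrow> I \<noteq> J \<and> (LEAST i. i \<in> (I - J) \<union> (J - I)) \<in> J"

definition indecomposable_chain ::
  "('v, 'a) pre_digraph \<Rightarrow> ('v \<Rightarrow> 'k::field vect set) \<Rightarrow> ('a \<Rightarrow> 'k vect \<Rightarrow> 'k vect) \<Rightarrow>
   ('v \<Rightarrow> 'k vect set) list \<Rightarrow> bool" where
  "indecomposable_chain Q V f Ws \<longleftrightarrow>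
     sorted_wrt (<) Ws \<and> (\<forall>W\<in>set Ws. submodule Q V f W \<and> indecomposable Q W f)"

definition chain_length_sets ::
  "('v, 'a) pre_digraph \<Rightarrow> ('v \<Rightarrow> 'k::field vect set) \<Rightarrow> ('a \<Rightarrow> 'k vect \<Rightarrow> 'k vect) \<Rightarrow>
   nat set set" where
  "chain_length_sets Q V f =
     {module_length Q ` set Ws | Ws. indecomposable_chain Q V f Ws}"

text \<open>The empty chain is admitted; it contributes the smallest set \<open>{}\<close>, so it only matters
  for the zero module, whose measure is \<open>{}\<close>.\<close>

definition gr_measure ::
  "('v, 'a) pre_digraph \<Rightarrow> ('v \<Rightarrow> 'k::field vect set) \<Rightarrow> ('a \<Rightarrow> 'k vect \<Rightarrow> 'k vect) \<Rightarrow> nat set" where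
  "gr_measure Q V f =
     (THE I. I \<in> chain_length_sets Q V f \<and>
             (\<forall>J\<in>chain_length_sets Q V f. J = I \<or> gr_less J I))"

text \<open>The field does not occur in the type of a set of natural numbers, so it is passed
  as a type argument.\<close>

definition gr_measures :: "('v, 'a) pre_digraph \<Rightarrow> 'k::field itself \<Rightarrow> nat set set" where
  "gr_measures Q K =
     {gr_measure Q V f | (V :: 'v \<Rightarrow> 'k vect set) f. indecomposable Q V f}"

definition direct_predecessor ::
  "('v, 'a) pre_digraph \<Rightarrow> 'k::field itself \<Rightarrow> nat set \<Rightarrow> nat set \<Rightarrow> bool" where
  "direct_predecessor Q K I I' \<longleftrightarrow>
     I \<in> gr_measures Q K \<and> I' \<in> gr_measures Q K \<and> gr_less I I' \<and>
     \<not> (\<exists>I''\<in>gr_measures Q K. gr_less I I'' \<and> gr_less I'' I')"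

definition no_direct_predecessor ::
  "('v, 'a) pre_digraph \<Rightarrow> 'k::field itself \<Rightarrow> nat set set" where
  "no_direct_predecessor Q K =
     {I' \<in> gr_measures Q K. \<not> (\<exists>I. direct_predecessor Q K I I')}"

definition ndp :: "('v, 'a) pre_digraph \<Rightarrow> 'k::field itself \<Rightarrow> enat" where
  "ndp Q K = (if finite (no_direct_predecessor Q K)
              then enat (card (no_direct_predecessor Q K)) else \<infinity>)"


section \<open>The Kronecker quivers\<close>

definition kronecker_quiver :: "nat \<Rightarrow> (nat, nat) pre_digraph" where
  "kronecker_quiver n = \<lparr>verts = {1, 2}, arcs = {..<n}, tail = (\<lambda>_. 2), head = (\<lambda>_. 1)\<rparr>"

end

theory Submission
  imports Defs
begin

text \<open>Let \<open>M\<close> be an indecomposable module whose measure lies below \<open>\<mu>\<^sup>m\<close>. The aim is to embed \<open>M\<close> in a module \<open>N\<close>,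
  without splitting off, such that the quotient \<open>N / M\<close> is so sparse (every nonzero element of its top generates at
  least two dimensions of its socle) that a chain of indecomposable submodules of \<open>N\<close> whose lengths increase
  by at most two cannot leave \<open>M\<close>. Since the chains witnessing a measure above \<open>\<mu>\<^sup>m\<close> start
  with lengths \<open>1, 2, 4, \<dots>, 2 j, 2 j + 1\<close>, all measures of submodules of \<open>N\<close> stay below \<open>\<mu>\<^sup>m\<close>. If \<open>\<mu>(M)\<close> were
  a direct predecessor, they would even be at most \<open>\<mu>(M)\<close>, and Gabriel's main property would make \<open>M\<close> a
  direct summand of \<open>N\<close>. Counting parameters, such a nonsplit \<open>N\<close> exists unless the top of \<open>M\<close> is very large
  compared with its socle. In that case an eigenvector argument finds a submodule of dimension vector \<open>(1, 2)\<close>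
  in \<open>M\<close>, so that \<open>\<mu>(M)\<close> starts with \<open>1, 2, 3\<close> and is not below \<open>\<mu>\<^sup>m\<close>.\<close>

section \<open>Linear algebra for maps that are linear only on a finite-dimensional subspace\<close>

section \<open>Finite-dimensional subspaces\<close>

text \<open>The two halves of the argument meet at one threshold. Let M have dimension vector (m1,
  m2). The quotient has dimension vector (q + 1, 2 q), so the Euler form of quotient and M is (q +
  1) m1 + 2 q m2 - 2 q n m1, and a nonsplit extension exists once this is negative. For large q that
  happens exactly when m1 + 2 m2 < 2 n m1; a quotient of bounded size would leave a gap, so q
  depends on M. Otherwise m2 is at least (n - 1/2) m1, which is just enough for the eigenvector
  argument: the common kernel of all arrows but one has dimension at least m1 / 2, and two further
  arrows then form a pencil whose source is no smaller than its target.

  Three arrows are what makes the quotient possible: with two arrows and a top no smaller than the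
  socle, the eigenvector argument would find a top vector whose images are proportional.

  The simple module of dimension vector (0, 1) stays outside both halves. Its measure is so small
  that \<open>odd_measure (m + 1)\<close> lies between it and \<open>odd_measure m\<close>.\<close>

interpretation kvp: vector_space_pair "kscale :: 'k::field \<Rightarrow> 'k vect \<Rightarrow> 'k vect" "kscale :: 'k \<Rightarrow> 'k vect \<Rightarrow> 'k vect"
  by unfold_locales

lemma kscale_apply: "kscale c x i = c * x i"
  by (simp add: kscale_def)

definition findim :: "'k::field vect set \<Rightarrow> bool" where
  "findim V \<longleftrightarrow> (\<exists>B. finite B \<and> V = kvs.span B)"

lemma findim_subspace: "findim V \<Longrightarrow> kvs.subspace V"
  by (auto simp: findim_def)

lemma findim_0: "findim V \<Longrightarrow> 0 \<in> V"
  by (simp add: findim_subspace kvs.subspace_0)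

lemma findim_basis_extend:
  assumes "findim V" "kvs.independent A" "A \<subseteq> V"
  obtains B where "A \<subseteq> B" "finite B" "kvs.independent B" "kvs.span B = V" "card B = kvs.dim V"
proof -
  obtain T where T: "finite T" "V = kvs.span T" using assms by (auto simp: findim_def)
  obtain B where B: "A \<subseteq> B" "B \<subseteq> V" "kvs.independent B" "V \<subseteq> kvs.span B"
    using kvs.maximal_independent_subset_extend[OF assms(3,2)] by blast
  have "finite B" using kvs.independent_span_bound[OF T(1) B(3)] B(2) T(2) by blast
  moreover have "kvs.span B = V"
    using B findim_subspace[OF assms(1)] kvs.span_subspace by blast
  moreover have "card B = kvs.dim V"
    using kvs.basis_card_eq_dim[OF B(2,4,3)] .
  ultimately show ?thesis using that B by blast
qed

lemma findim_basis:
  assumes "findim V"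
  obtains B where "finite B" "kvs.independent B" "kvs.span B = V" "card B = kvs.dim V"
  using findim_basis_extend[OF assms kvs.independent_empty] by blast

lemma findim_sub:
  assumes "findim V" "kvs.subspace S" "S \<subseteq> V"
  shows "findim S" and "kvs.dim S \<le> kvs.dim V"
proof -
  obtain A where A: "A \<subseteq> S" "kvs.independent A" "S \<subseteq> kvs.span A" "card A = kvs.dim S"
    using kvs.basis_exists by blast
  obtain B where B: "A \<subseteq> B" "finite B" "kvs.independent B" "kvs.span B = V" "card B = kvs.dim V"
    using findim_basis_extend[OF assms(1) A(2)] A(1) assms(3) by blast
  have "finite A" using B finite_subset by blast
  moreover have "S = kvs.span A" using A assms(2) kvs.span_subspace by blast
  ultimately show "findim S" by (auto simp: findim_def)
  show "kvs.dim S \<le> kvs.dim V" using card_mono[OF B(2,1)] A B by simp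
qed

lemma findim_dim_eq:
  assumes "findim V" "kvs.subspace S" "S \<subseteq> V" "kvs.dim V \<le> kvs.dim S"
  shows "S = V"
proof -
  obtain A where A: "finite A" "kvs.independent A" "kvs.span A = S" "card A = kvs.dim S"
    using findim_basis[OF findim_sub(1)[OF assms(1-3)]] .
  obtain B where B: "A \<subseteq> B" "finite B" "kvs.independent B" "kvs.span B = V" "card B = kvs.dim V"
    using findim_basis_extend[OF assms(1) A(2)] A(3) assms(3) kvs.span_superset by blast
  have "A = B" using card_seteq[OF B(2,1)] A B assms(4) by simp
  then show ?thesis using A B by simp
qed

lemma findim_span: "finite B \<Longrightarrow> findim (kvs.span B)"
  by (auto simp: findim_def)

lemma findim_zero [simp]: "findim {0}"
  using findim_span[of "{}"] by simp

lemma dim_zero_iff: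
  assumes "findim V" shows "kvs.dim V = 0 \<longleftrightarrow> V = {0}"
proof -
  obtain B where "finite B" "kvs.independent B" "kvs.span B = V" "card B = kvs.dim V"
    using findim_basis[OF assms] .
  then show ?thesis by (metis card_eq_0_iff kvs.dim_eq_card kvs.independent_empty kvs.span_empty)
qed

lemma dim_zero [simp]: "kvs.dim {0 :: 'k::field vect} = 0"
  by (simp add: dim_zero_iff)

lemma subspace_span_card:
  assumes "findim V" "kvs.independent A" "A \<subseteq> V"
  shows "finite A" "card A \<le> kvs.dim V"
proof -
  obtain B where B: "A \<subseteq> B" "finite B" "kvs.independent B" "kvs.span B = V" "card B = kvs.dim V"
    using findim_basis_extend[OF assms] .
  show "finite A" using B(1,2) finite_subset by blast
  show "card A \<le> kvs.dim V" using card_mono[OF B(2,1)] B(5) by simp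
qed

lemma dim_le_1_span:
  assumes "findim V" "kvs.dim V \<le> 1"
  obtains w where "w \<in> V" "V \<subseteq> kvs.span {w}"
proof -
  obtain B where B: "finite B" "kvs.independent B" "kvs.span B = V" "card B = kvs.dim V"
    using findim_basis[OF assms(1)] .
  show ?thesis
  proof (cases "B = {}")
    case True
    then show ?thesis using B that[of 0] by auto
  next
    case False
    then have "card B = 1" using B assms(2) by (metis card_0_eq le_antisym less_one not_le)
    then obtain w where "B = {w}" using card_1_singletonE by blast
    then show ?thesis using that[of w] B kvs.span_superset by blast
  qed
qed

lemma linear_onD:
  assumes "linear_on U f"
  shows "x \<in> U \<Longrightarrow> y \<in> U \<Longrightarrow> f (x + y) = f x + f y"
    and "x \<in> U \<Longrightarrow> f (kscale c x) = kscale c (f x)"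
  using assms by (auto simp: linear_on_def)

lemma linear_on_0:
  assumes "linear_on U f" "0 \<in> U" shows "f 0 = 0"
  using linear_onD(2)[OF assms, of 0] by simp

lemma linear_on_diff:
  assumes "linear_on U f" "kvs.subspace U" "x \<in> U" "y \<in> U"
  shows "f (x - y) = f x - f y"
proof -
  have "f (x - y) = f (x + kscale (-1) y)" by simp
  also have "\<dots> = f x + kscale (-1) (f y)"
    using assms linear_onD kvs.subspace_scale by metis
  finally show ?thesis by simp
qed

lemma linear_on_sum:
  assumes "linear_on U f" "kvs.subspace U" "\<And>i. i \<in> I \<Longrightarrow> x i \<in> U"
  shows "f (\<Sum>i\<in>I. x i) = (\<Sum>i\<in>I. f (x i))"
  using assms(3)
proof (induction I rule: infinite_finite_induct)
  case (insert i I)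
  then have "x i \<in> U" "sum x I \<in> U" using kvs.subspace_sum[OF assms(2)] by blast+
  then show ?case
    using insert linear_onD(1)[OF assms(1)] by (metis insertI2 sum.insert)
qed (use linear_on_0[OF assms(1) kvs.subspace_0[OF assms(2)]] in auto)

lemma linear_on_subset: "linear_on U f \<Longrightarrow> W \<subseteq> U \<Longrightarrow> linear_on W f"
  unfolding linear_on_def by blast

lemma linear_on_comp: "linear_on U f \<Longrightarrow> f ` U \<subseteq> W \<Longrightarrow> linear_on W g \<Longrightarrow> linear_on U (\<lambda>x. g (f x))"
  by (auto simp: linear_on_def image_subset_iff)

text \<open>Structure maps are linear only on their domain. Extending along a basis gives a globally
  linear map that agrees there, to which the general theory of linear maps applies.\<close>

lemma linear_on_extend:
  assumes "findim V" "linear_on V f"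
  obtains g where "Vector_Spaces.linear kscale kscale g" "\<And>x. x \<in> V \<Longrightarrow> g x = f x"
proof -
  obtain B where B: "finite B" "kvs.independent B" "kvs.span B = V"
    using findim_basis[OF assms(1)] .
  obtain g where g: "Vector_Spaces.linear kscale kscale g" "\<forall>x\<in>B. g x = f x"
    using kvp.linear_independent_extend[OF B(2)] by blast
  have "x \<in> V \<and> g x = f x" if "x \<in> kvs.span B" for x
    using that
  proof (induction rule: kvs.span_induct_alt)
    case base
    then show ?case
      using linear_on_0[OF assms(2)] findim_0[OF assms(1)] kvp.linear_0[OF g(1)] by metis
  next
    case (step c x y)
    have x: "x \<in> V" using B step kvs.span_superset by blast
    then have cx: "kscale c x \<in> V" using assms(1) findim_subspace kvs.subspace_scale by blast
    have "g (kscale c x + y) = kscale c (g x) + g y"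
      using kvp.linear_add[OF g(1)] kvp.linear_scale[OF g(1)] by simp
    then show ?case
      using step g(2) x cx linear_onD[OF assms(2)] assms(1) findim_subspace kvs.subspace_add by metis
  qed
  then show ?thesis using that[OF g(1)] B(3) by blast
qed

lemma findim_image:
  assumes "findim V" "linear_on V f"
  shows "findim (f ` V)"
proof -
  obtain g where g: "Vector_Spaces.linear kscale kscale g" "\<And>x. x \<in> V \<Longrightarrow> g x = f x"
    using linear_on_extend[OF assms] by blast
  obtain B where B: "finite B" "V = kvs.span B" using assms by (auto simp: findim_def)
  have "f ` V = g ` V" using g(2) by force
  also have "\<dots> = kvs.span (g ` B)" using kvp.linear_span_image[OF g(1)] B(2) by simp
  finally show ?thesis using findim_span[OF finite_imageI[OF B(1)]] by simp
qed

lemma subspace_kernel_on: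
  assumes "linear_on V f" "kvs.subspace V"
  shows "kvs.subspace {x \<in> V. f x = 0}"
  using linear_on_0[OF assms(1) kvs.subspace_0[OF assms(2)]] linear_onD[OF assms(1)] assms
  by (intro kvs.subspaceI) (auto simp: kvs.subspace_0 kvs.subspace_add kvs.subspace_scale)

lemma subspace_preimage_on:
  assumes "linear_on V f" "kvs.subspace V" "kvs.subspace S"
  shows "kvs.subspace {x \<in> V. f x \<in> S}"
  using linear_on_0[OF assms(1) kvs.subspace_0[OF assms(2)]] linear_onD[OF assms(1)] assms
  by (intro kvs.subspaceI) (auto simp: kvs.subspace_0 kvs.subspace_add kvs.subspace_scale)

text \<open>The coefficients of \<open>x\<close> with respect to \<open>B\<close> are supported both
  in \<open>A\<close> and outside \<open>A\<close>, so all of them vanish.\<close>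

lemma independent_disjoint_span:
  assumes "kvs.independent B" "A \<subseteq> B" "x \<in> kvs.span A" "x \<in> kvs.span (B - A)"
  shows "x = 0"
proof -
  have "kvs.representation B x = kvs.representation A x"
    using kvs.representation_extend[OF assms(1,3,2)] .
  moreover have "kvs.representation B x = kvs.representation (B - A) x"
    using kvs.representation_extend[OF assms(1,4)] by blast
  ultimately have "kvs.representation A x b = 0" for b
    by (metis DiffD2 kvs.representation_ne_zero)
  moreover have "kvs.independent A" using assms kvs.independent_mono by blast
  ultimately show ?thesis
    using kvs.sum_nonzero_representation_eq[OF _ assms(3)] by simp
qed

text \<open>Extend a basis \<open>A\<close> of the kernel to a basis \<open>B\<close>. The span of
  \<open>B - A\<close> meets the kernel in 0, so the images of \<open>B - A\<close> form a basis of
  the image.\<close>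

lemma rank_nullity:
  assumes "findim V" "linear_on V f"
  shows "kvs.dim V = kvs.dim {x \<in> V. f x = 0} + kvs.dim (f ` V)"
proof -
  let ?K = "{x \<in> V. f x = 0}"
  have sV: "kvs.subspace V" using assms findim_subspace by blast
  obtain g where g: "Vector_Spaces.linear kscale kscale g" "\<And>x. x \<in> V \<Longrightarrow> g x = f x"
    using linear_on_extend[OF assms] by blast
  have K: "findim ?K" using findim_sub(1)[OF assms(1) subspace_kernel_on[OF assms(2) sV]] by blast
  obtain A where A: "finite A" "kvs.independent A" "kvs.span A = ?K" "card A = kvs.dim ?K"
    using findim_basis[OF K] .
  have AV: "A \<subseteq> V" using A(3) kvs.span_superset by blast
  obtain B where B: "A \<subseteq> B" "finite B" "kvs.independent B" "kvs.span B = V" "card B = kvs.dim V"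
    using findim_basis_extend[OF assms(1) A(2) AV] .
  have sub: "kvs.span (B - A) \<subseteq> V" using B(4) kvs.span_mono[of "B - A" B] by blast
  have inj: "inj_on g (kvs.span (B - A))"
  proof (rule inj_onI)
    fix x y assume xy: "x \<in> kvs.span (B - A)" "y \<in> kvs.span (B - A)" "g x = g y"
    have d: "x - y \<in> kvs.span (B - A)" using xy kvs.span_diff by blast
    have "g (x - y) = 0" using xy(3) kvp.linear_diff[OF g(1)] by simp
    then have "x - y \<in> kvs.span A" using A(3) d sub g(2) by auto
    then show "x = y" using independent_disjoint_span[OF B(3,1) _ d] by simp
  qed
  have ind: "kvs.independent (g ` (B - A))"
    using kvp.linear_independent_injective_image[OF g(1) _ inj] B(3) kvs.independent_mono by blast
  have "f ` V = g ` V" using g(2) by force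
  also have "\<dots> = kvs.span (g ` B)" using kvp.linear_span_image[OF g(1)] B(4) by simp
  also have "\<dots> = kvs.span (g ` (B - A))"
  proof -
    have "g ` B \<subseteq> insert 0 (g ` (B - A))"
      using A(3) g(2) kvs.span_superset[of A] by force
    then have "kvs.span (g ` B) \<subseteq> kvs.span (insert 0 (g ` (B - A)))" by (rule kvs.span_mono)
    moreover have "kvs.span (g ` (B - A)) \<subseteq> kvs.span (g ` B)" by (intro kvs.span_mono) blast
    ultimately show ?thesis by simp
  qed
  finally have "kvs.dim (f ` V) = card (g ` (B - A))"
    using kvs.dim_span_eq_card_independent[OF ind] by simp
  also have "\<dots> = card (B - A)"
    by (rule card_image) (use inj kvs.span_superset inj_on_subset in blast)
  also have "\<dots> = card B - card A" using B A by (simp add: card_Diff_subset)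
  finally show ?thesis using A(4) B(5) card_mono[OF B(2,1)] by simp
qed

lemma inj_on_kernel:
  assumes "linear_on V f" "kvs.subspace V"
  shows "inj_on f V \<longleftrightarrow> (\<forall>x\<in>V. f x = 0 \<longrightarrow> x = 0)"
proof
  assume "inj_on f V"
  then show "\<forall>x\<in>V. f x = 0 \<longrightarrow> x = 0"
    using assms by (metis inj_onD kvs.subspace_0 linear_on_0)
next
  assume *: "\<forall>x\<in>V. f x = 0 \<longrightarrow> x = 0"
  show "inj_on f V"
  proof (rule inj_onI)
    fix x y assume "x \<in> V" "y \<in> V" "f x = f y"
    then show "x = y"
      using * linear_on_diff[OF assms] kvs.subspace_diff[OF assms(2)]
      by (metis eq_iff_diff_eq_0)
  qed
qed

lemma dim_image_inj:
  assumes "findim V" "linear_on V f" "inj_on f V"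
  shows "kvs.dim (f ` V) = kvs.dim V"
proof -
  have "{x \<in> V. f x = 0} = {0}"
    using assms inj_on_kernel[OF assms(2) findim_subspace[OF assms(1)]] findim_0[OF assms(1)]
      linear_on_0[OF assms(2)] by auto
  then show ?thesis using rank_nullity[OF assms(1,2)] by simp
qed

lemma complement_exists:
  assumes "findim V" "kvs.subspace S" "S \<subseteq> V"
  obtains T where "kvs.subspace T" "T \<subseteq> V" "S \<inter> T = {0}" "V = {x + y | x y. x \<in> S \<and> y \<in> T}"
    "kvs.dim V = kvs.dim S + kvs.dim T"
proof -
  obtain A where A: "finite A" "kvs.independent A" "kvs.span A = S" "card A = kvs.dim S"
    using findim_basis[OF findim_sub(1)[OF assms(1-3)]] .
  have AV: "A \<subseteq> V" using A(3) assms(3) kvs.span_superset by blast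
  obtain B where B: "A \<subseteq> B" "finite B" "kvs.independent B" "kvs.span B = V" "card B = kvs.dim V"
    using findim_basis_extend[OF assms(1) A(2) AV] .
  let ?T = "kvs.span (B - A)"
  have "kvs.dim ?T = card (B - A)"
    using kvs.dim_span_eq_card_independent B(3) kvs.independent_mono by blast
  then have "kvs.dim V = kvs.dim S + kvs.dim ?T"
    using A B card_mono[OF B(2,1)] by (simp add: card_Diff_subset)
  moreover have "?T \<subseteq> V" using B(4) kvs.span_mono[of "B - A" B] by blast
  moreover have "V = {x + y | x y. x \<in> S \<and> y \<in> ?T}"
    using kvs.span_Un[of A "B - A"] A(3) B(1,4) by (simp add: Un_absorb1)
  moreover have "S \<inter> ?T = {0}"
    using independent_disjoint_span[OF B(3,1)] A(3) kvs.span_zero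
      kvs.subspace_0[OF assms(2)] by blast
  ultimately show ?thesis using that[of ?T] by blast
qed

text \<open>The component in \<open>T\<close> is picked by choice; since it is unique, every
  linearity law reduces to exhibiting a valid component.\<close>

lemma direct_projection:
  assumes "kvs.subspace S" "kvs.subspace T" "S \<inter> T = {0}" "U = {x + y | x y. x \<in> S \<and> y \<in> T}"
  obtains p where "linear_on U p" "\<And>x. x \<in> U \<Longrightarrow> p x \<in> T" "\<And>x. x \<in> U \<Longrightarrow> x - p x \<in> S"
    "\<And>x. x \<in> T \<Longrightarrow> p x = x" "\<And>x. x \<in> S \<Longrightarrow> p x = 0"
proof -
  let ?p = "\<lambda>x. SOME y. y \<in> T \<and> x - y \<in> S"
  have ex: "\<exists>y. y \<in> T \<and> x - y \<in> S" if x: "x \<in> U" for x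
  proof -
    obtain a b where "x = a + b" "a \<in> S" "b \<in> T" using x assms(4) by blast
    then have "b \<in> T \<and> x - b \<in> S" by simp
    then show ?thesis by blast
  qed
  have 1: "?p x \<in> T \<and> x - ?p x \<in> S" if "x \<in> U" for x using someI_ex[OF ex[OF that]] .
  have UI: "x \<in> U" if "y \<in> T" "x - y \<in> S" for x y
  proof -
    have "x = (x - y) + y" by simp
    then show ?thesis using assms(4) that by blast
  qed
  have uniq: "?p x = y" if y: "y \<in> T" "x - y \<in> S" for x y
  proof -
    note xU = UI[OF y]
    have "(x - y) - (x - ?p x) \<in> S" using 1[OF xU] y kvs.subspace_diff[OF assms(1)] by blast
    moreover have "(x - y) - (x - ?p x) = ?p x - y" by simp
    moreover have "?p x - y \<in> T" using 1[OF xU] y kvs.subspace_diff[OF assms(2)] by blast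
    ultimately have "?p x - y = 0" using assms(3) by (metis IntI singletonD)
    then show ?thesis by simp
  qed
  have "linear_on U ?p" unfolding linear_on_def
  proof (intro conjI ballI allI)
    fix x y assume xy: "x \<in> U" "y \<in> U"
    have e: "x + y - (?p x + ?p y) = (x - ?p x) + (y - ?p y)" by simp
    show "?p (x + y) = ?p x + ?p y"
    proof (rule uniq)
      show "?p x + ?p y \<in> T" using 1 xy kvs.subspace_add[OF assms(2)] by blast
      show "x + y - (?p x + ?p y) \<in> S" unfolding e using 1 xy kvs.subspace_add[OF assms(1)] by blast
    qed
  next
    fix c x assume x: "x \<in> U"
    have e: "kscale c x - kscale c (?p x) = kscale c (x - ?p x)"
      by (simp add: kvs.scale_right_diff_distrib)
    show "?p (kscale c x) = kscale c (?p x)"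
    proof (rule uniq)
      show "kscale c (?p x) \<in> T" using 1[OF x] kvs.subspace_scale[OF assms(2)] by blast
      show "kscale c x - kscale c (?p x) \<in> S"
        unfolding e using 1[OF x] kvs.subspace_scale[OF assms(1)] by blast
    qed
  qed
  moreover have "?p x = x" if "x \<in> T" for x
    using that kvs.subspace_0[OF assms(1)] by (intro uniq) auto
  moreover have "?p x = 0" if "x \<in> S" for x
    using that kvs.subspace_0[OF assms(2)] by (intro uniq) auto
  ultimately show ?thesis using that[of ?p] 1 by blast
qed

lemma dim_direct_sum:
  assumes "findim U" "kvs.subspace S" "kvs.subspace T" "S \<inter> T = {0}"
    "U = {x + y | x y. x \<in> S \<and> y \<in> T}"
  shows "kvs.dim U = kvs.dim S + kvs.dim T"
proof -
  obtain p where p: "linear_on U p" "\<And>x. x \<in> U \<Longrightarrow> p x \<in> T" "\<And>x. x \<in> U \<Longrightarrow> x - p x \<in> S"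
    "\<And>x. x \<in> T \<Longrightarrow> p x = x" "\<And>x. x \<in> S \<Longrightarrow> p x = 0"
    using direct_projection[OF assms(2-5)] by blast
  have TU: "T \<subseteq> U" unfolding assms(5) using kvs.subspace_0[OF assms(2)] by force
  have SU: "S \<subseteq> U" unfolding assms(5)
  proof
    fix x assume "x \<in> S"
    then have "x = x + 0 \<and> x \<in> S \<and> 0 \<in> T" using kvs.subspace_0[OF assms(3)] by simp
    then show "x \<in> {x + y |x y. x \<in> S \<and> y \<in> T}" by blast
  qed
  have "{x \<in> U. p x = 0} = S"
    using p(3,5) SU by force
  moreover have "p ` U = T" using p(2,4) TU by force
  ultimately show ?thesis using rank_nullity[OF assms(1) p(1)] by simp
qed

text \<open>The codimension of a preimage is at most that of \<open>S\<close>: following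
  \<open>f\<close> by the projection onto a complement of \<open>S\<close> gives a map whose kernel
  is the preimage.\<close>

lemma dim_preimage_ge:
  assumes "findim V" "linear_on V f" "findim U" "f ` V \<subseteq> U" "kvs.subspace S" "S \<subseteq> U"
  shows "kvs.dim V + kvs.dim S \<le> kvs.dim {x \<in> V. f x \<in> S} + kvs.dim U"
proof -
  obtain T where T: "kvs.subspace T" "T \<subseteq> U" "S \<inter> T = {0}"
      "U = {x + y | x y. x \<in> S \<and> y \<in> T}" "kvs.dim U = kvs.dim S + kvs.dim T"
    using complement_exists[OF assms(3,5,6)] .
  obtain p where p: "linear_on U p" "\<And>x. x \<in> U \<Longrightarrow> p x \<in> T" "\<And>x. x \<in> U \<Longrightarrow> x - p x \<in> S"
    "\<And>x. x \<in> S \<Longrightarrow> p x = 0"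
    using direct_projection[OF assms(5) T(1,3,4)] by metis
  have lp: "linear_on V (\<lambda>x. p (f x))" using linear_on_comp[OF assms(2,4) p(1)] .
  have "{x \<in> V. p (f x) = 0} = {x \<in> V. f x \<in> S}"
    using p(3,4) assms(4) by force
  moreover have "kvs.dim ((\<lambda>x. p (f x)) ` V) \<le> kvs.dim T"
    using findim_sub(2)[OF findim_sub(1)[OF assms(3) T(1,2)]
        findim_subspace[OF findim_image[OF assms(1) lp]]] p(2) assms(4) by blast
  ultimately show ?thesis using rank_nullity[OF assms(1) lp] T(5) by simp
qed

section \<open>The lexicographic total order behind the measures\<close>

section \<open>The order on sets of natural numbers\<close>

text \<open>The witness \<open>d\<close> is the least element of the symmetric difference; below it
  the two sets agree.\<close>

lemma gr_less_iff: "gr_less I J \<longleftrightarrow> (\<exists>d. d \<in> J \<and> d \<notin> I \<and> (\<forall>i<d. i \<in> I \<longleftrightarrow> i \<in> J))"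
proof
  assume *: "gr_less I J"
  let ?P = "\<lambda>i. i \<in> (I - J) \<union> (J - I)"
  have "\<exists>i. ?P i" using * by (auto simp: gr_less_def)
  then have "?P (LEAST i. ?P i)" by (rule LeastI_ex)
  moreover have "\<not> ?P i" if "i < (LEAST i. ?P i)" for i using not_less_Least[OF that] .
  moreover have "(LEAST i. ?P i) \<in> J" using * by (simp add: gr_less_def)
  ultimately show "\<exists>d. d \<in> J \<and> d \<notin> I \<and> (\<forall>i<d. i \<in> I \<longleftrightarrow> i \<in> J)" by blast
next
  assume "\<exists>d. d \<in> J \<and> d \<notin> I \<and> (\<forall>i<d. i \<in> I \<longleftrightarrow> i \<in> J)"
  then obtain d where d: "d \<in> J" "d \<notin> I" "\<forall>i<d. i \<in> I \<longleftrightarrow> i \<in> J" by blast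
  have "(LEAST i. i \<in> (I - J) \<union> (J - I)) = d"
    using d by (intro Least_equality) (auto simp: not_less[symmetric])
  then show "gr_less I J" using d by (auto simp: gr_less_def)
qed

definition gr_le :: "nat set \<Rightarrow> nat set \<Rightarrow> bool" where
  "gr_le I J \<longleftrightarrow> I = J \<or> gr_less I J"

lemma gr_less_irrefl [simp]: "\<not> gr_less I I"
  by (simp add: gr_less_def)

lemma gr_less_trans: 
  assumes "gr_less I J" "gr_less J K" shows "gr_less I K"
proof -
  obtain d where d: "d \<in> J" "d \<notin> I" "\<forall>i<d. i \<in> I \<longleftrightarrow> i \<in> J" using assms(1) by (auto simp: gr_less_iff)
  obtain e where e: "e \<in> K" "e \<notin> J" "\<forall>i<e. i \<in> J \<longleftrightarrow> i \<in> K" using assms(2) by (auto simp: gr_less_iff)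
  have "d < e \<or> e < d" using d e by (metis linorder_neqE_nat)
  then show ?thesis
  proof
    assume "d < e"
    then show ?thesis using d e unfolding gr_less_iff by (intro exI[of _ d]) auto
  next
    assume "e < d"
    then show ?thesis using d e unfolding gr_less_iff by (intro exI[of _ e]) auto
  qed
qed

lemma gr_less_total: "I \<noteq> J \<Longrightarrow> gr_less I J \<or> gr_less J I"
proof -
  assume "I \<noteq> J"
  then have "\<exists>i. i \<in> (I - J) \<union> (J - I)" by blast
  then have "(LEAST i. i \<in> (I - J) \<union> (J - I)) \<in> (I - J) \<union> (J - I)" by (rule LeastI_ex)
  then show ?thesis using \<open>I \<noteq> J\<close> by (auto simp: gr_less_def Un_commute)
qed

lemma gr_le_refl [simp]: "gr_le I I" by (simp add: gr_le_def)

lemma gr_le_trans: "gr_le I J \<Longrightarrow> gr_le J K \<Longrightarrow> gr_le I K"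
  by (auto simp: gr_le_def intro: gr_less_trans)

lemma gr_le_iff_not_less: "gr_le I J \<longleftrightarrow> \<not> gr_less J I"
  by (metis gr_le_def gr_less_irrefl gr_less_total gr_less_trans)

lemma gr_le_antisym: "gr_le I J \<Longrightarrow> gr_le J I \<Longrightarrow> I = J"
  using gr_less_total by (auto simp: gr_le_iff_not_less)

lemma gr_less_insert: "I \<subseteq> {..<L} \<Longrightarrow> gr_less I (insert L I)"
  unfolding gr_less_iff by (intro exI[of _ L]) auto

lemma gr_less_insert_mono:
  assumes "I \<subseteq> {..<L}" "J \<subseteq> {..<L}" "gr_less I J"
  shows "gr_less (insert L I) (insert L J)"
proof -
  obtain d where d: "d \<in> J" "d \<notin> I" "\<forall>i<d. i \<in> I \<longleftrightarrow> i \<in> J" using assms(3) by (auto simp: gr_less_iff)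
  then have "d < L" using assms by auto
  then show ?thesis using d unfolding gr_less_iff by (intro exI[of _ d]) auto
qed

text \<open>If \<open>A\<close> were larger than \<open>B\<close>, the deciding element would lie
  below \<open>L\<close>, and inserting \<open>L\<close> into \<open>B\<close> could not change the
  comparison. This turns a bound by the measure of a module into a bound by the measure of its
  Gabriel-Roiter submodule, for modules of smaller length.\<close>

lemma gr_le_insertD:
  assumes "A \<subseteq> {..<L}" "B \<subseteq> {..<L}" "gr_le A (insert L B)"
  shows "gr_le A B"
proof (rule ccontr)
  assume "\<not> gr_le A B"
  then have "gr_less B A" by (simp add: gr_le_iff_not_less)
  then obtain d where d: "d \<in> A" "d \<notin> B" "\<forall>i<d. i \<in> B \<longleftrightarrow> i \<in> A" by (auto simp: gr_less_iff)
  then have "d < L" using assms by auto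
  then have "gr_less (insert L B) A" using d unfolding gr_less_iff by (intro exI[of _ d]) auto
  then show False using assms(3) by (simp add: gr_le_iff_not_less)
qed

lemma gr_max_exists:
  assumes "finite S" "S \<noteq> {}"
  shows "\<exists>I\<in>S. \<forall>J\<in>S. gr_le J I"
  using assms
proof (induction rule: finite_ne_induct)
  case (singleton x)
  then show ?case by simp
next
  case (insert x F)
  then obtain I where I: "I \<in> F" "\<forall>J\<in>F. gr_le J I" by blast
  show ?case
  proof (cases "gr_le x I")
    case True
    then show ?thesis using I by blast
  next
    case False
    then have "gr_le I x" by (metis gr_le_iff_not_less gr_le_def)
    then show ?thesis using I gr_le_trans gr_le_refl by blast
  qed
qed


section \<open>The submodule order, strict monotonicity of length, direct sums\<close>

section \<open>Submodules and lengths\<close>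

lemma representation_iff:
  "representation Q V f \<longleftrightarrow> (\<forall>v. findim (V v)) \<and> (\<forall>v. v \<notin> verts Q \<longrightarrow> V v = {0}) \<and>
     (\<forall>a\<in>arcs Q. linear_on (V (tail Q a)) (f a) \<and> f a ` V (tail Q a) \<subseteq> V (head Q a))"
  unfolding representation_def findim_def[symmetric] by (metis findim_zero)

lemma
  assumes "representation Q V f"
  shows rep_findim: "findim (V v)" and rep_subspace: "kvs.subspace (V v)" and rep_0: "0 \<in> V v"
    and rep_outside: "v \<notin> verts Q \<Longrightarrow> V v = {0}"
    and rep_linear: "a \<in> arcs Q \<Longrightarrow> linear_on (V (tail Q a)) (f a)"
    and rep_arrow: "a \<in> arcs Q \<Longrightarrow> x \<in> V (tail Q a) \<Longrightarrow> f a x \<in> V (head Q a)"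
  using assms unfolding representation_iff by (auto simp: findim_subspace findim_0 image_subset_iff)

lemma submodule_rep: "submodule Q V f W \<Longrightarrow> representation Q W f"
  and submodule_le: "submodule Q V f W \<Longrightarrow> W \<le> V"
  by (auto simp: submodule_def)

lemma submoduleI:
  assumes "representation Q V f" "\<And>v. kvs.subspace (W v)" "\<And>v. W v \<subseteq> V v"
    "\<And>a x. a \<in> arcs Q \<Longrightarrow> x \<in> W (tail Q a) \<Longrightarrow> f a x \<in> W (head Q a)"
  shows "submodule Q V f W"
  unfolding submodule_def representation_iff
proof (intro conjI allI ballI impI)
  show "findim (W v)" for v using findim_sub(1)[OF rep_findim[OF assms(1)] assms(2,3)] .
  show "W v = {0}" if "v \<notin> verts Q" for v
    using rep_outside[OF assms(1) that] assms(3)[of v] kvs.subspace_0[OF assms(2)[of v]] by blast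
  show "linear_on (W (tail Q a)) (f a)" if "a \<in> arcs Q" for a
    using linear_on_subset[OF rep_linear[OF assms(1) that] assms(3)] .
  show "f a ` W (tail Q a) \<subseteq> W (head Q a)" if "a \<in> arcs Q" for a
    using assms(4)[OF that] by blast
  show "W \<le> V" using assms(3) by (simp add: le_fun_def)
qed

lemma submodule_refl: "representation Q V f \<Longrightarrow> submodule Q V f V"
  by (simp add: submodule_def)

lemma submodule_trans: "submodule Q V f W \<Longrightarrow> submodule Q W f U \<Longrightarrow> submodule Q V f U"
  by (auto simp: submodule_def)

lemma submodule_between: "submodule Q V f U \<Longrightarrow> U \<le> W \<Longrightarrow> submodule Q W f U"
  by (simp add: submodule_def)

lemma zero_module_iff: "V = zero_module \<longleftrightarrow> (\<forall>v. V v = {0})"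
  by (auto simp: zero_module_def)

lemma zero_module_le: "representation Q V f \<Longrightarrow> V \<le> zero_module \<Longrightarrow> V = zero_module"
  unfolding zero_module_iff
proof
  fix v assume "representation Q V f" "V \<le> zero_module"
  then show "V v = {0}" using rep_0[of Q V f v] by (auto simp: zero_module_def le_fun_def)
qed

lemma zero_module_submodule:
  assumes "representation Q V f" shows "submodule Q V f zero_module"
proof (rule submoduleI[OF assms])
  show "f a x \<in> zero_module (head Q a)" if "a \<in> arcs Q" "x \<in> zero_module (tail Q a)" for a x
    using that linear_on_0[OF rep_linear[OF assms that(1)] rep_0[OF assms]] by (simp add: zero_module_def)
qed (auto simp: zero_module_def rep_0[OF assms])

lemma length_mono:
  assumes "finite (verts Q)" "representation Q V f" "representation Q W g" "W \<le> V"
  shows "module_length Q W \<le> module_length Q V"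
  unfolding module_length_def
  using findim_sub(2)[OF rep_findim[OF assms(2)] rep_subspace[OF assms(3)]] assms(4)
  by (intro sum_mono) (auto simp: le_fun_def)

lemma length_strict_mono:
  assumes "finite (verts Q)" "representation Q V f" "representation Q W g" "W < V"
  shows "module_length Q W < module_length Q V"
proof (rule ccontr)
  assume *: "\<not> module_length Q W < module_length Q V"
  have le: "W v \<subseteq> V v" for v using assms(4) by (auto simp: less_fun_def le_fun_def)
  have d: "kvs.dim (W v) \<le> kvs.dim (V v)" for v
    using findim_sub(2)[OF rep_findim[OF assms(2)] rep_subspace[OF assms(3)] le] .
  have "kvs.dim (V v) = kvs.dim (W v)" if "v \<in> verts Q" for v
  proof (rule ccontr)
    assume "kvs.dim (V v) \<noteq> kvs.dim (W v)"
    then have "kvs.dim (W v) < kvs.dim (V v)" using d[of v] by simp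
    then have "module_length Q W < module_length Q V"
      unfolding module_length_def using that d assms(1) by (intro sum_strict_mono_ex1) auto
    then show False using * by simp
  qed
  then have "W v = V v" for v
    using findim_dim_eq[OF rep_findim[OF assms(2)] rep_subspace[OF assms(3)] le]
      rep_outside[OF assms(2)] rep_outside[OF assms(3)] by (cases "v \<in> verts Q") auto
  then have "W = V" by (rule ext)
  then show False using assms(4) by simp
qed

lemma length_zero [simp]: "module_length Q (zero_module :: 'v \<Rightarrow> 'k::field vect set) = 0"
  by (simp add: module_length_def zero_module_def)

lemma length_pos:
  assumes "finite (verts Q)" "representation Q V f" "V \<noteq> zero_module"
  shows "0 < module_length Q V"
proof -
  have "zero_module < V"
    using assms(3) submodule_le[OF zero_module_submodule[OF assms(2)]] by simp
  then show ?thesis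
    using length_strict_mono[OF assms(1,2) submodule_rep[OF zero_module_submodule[OF assms(2)]]] by simp
qed

lemma indecomposable_rep: "indecomposable Q V f \<Longrightarrow> representation Q V f"
  and indecomposable_nonzero: "indecomposable Q V f \<Longrightarrow> V \<noteq> zero_module"
  by (auto simp: indecomposable_def)

lemma direct_sum_all:
  assumes "representation Q V f" "submodule Q V f A" "submodule Q V f B" "direct_sum Q V A B"
  shows "V v = {x + y | x y. x \<in> A v \<and> y \<in> B v}" "A v \<inter> B v = {0}"
proof -
  have o: "U v = {0}" if "v \<notin> verts Q" "representation Q U f" for U using rep_outside[OF that(2,1)] .
  have "V v = {x + y | x y. x \<in> A v \<and> y \<in> B v} \<and> A v \<inter> B v = {0}"
  proof (cases "v \<in> verts Q")
    case True
    then show ?thesis using assms(4) by (simp add: direct_sum_def)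
  next
    case False
    have "V v = {0}" "A v = {0}" "B v = {0}"
      using o[OF False] assms(1) submodule_rep[OF assms(2)] submodule_rep[OF assms(3)] by blast+
    then show ?thesis by simp
  qed
  then show "V v = {x + y | x y. x \<in> A v \<and> y \<in> B v}" "A v \<inter> B v = {0}" by blast+
qed

lemma direct_sum_proper:
  assumes "representation Q V f" "submodule Q V f A" "submodule Q V f B" "direct_sum Q V A B"
    "B \<noteq> zero_module"
  shows "A < V"
proof -
  have "A \<noteq> V"
  proof
    assume "A = V"
    have "B v \<subseteq> {0}" for v
      using direct_sum_all(2)[OF assms(1-4), of v] submodule_le[OF assms(3)] \<open>A = V\<close>
      by (auto simp: le_fun_def)
    then have "B = zero_module"
      using zero_module_le[OF submodule_rep[OF assms(3)]] by (simp add: le_fun_def zero_module_def)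
    then show False using assms(5) by simp
  qed
  then show ?thesis using submodule_le[OF assms(2)] by simp
qed

lemma direct_sum_commute: "direct_sum Q V A B \<Longrightarrow> direct_sum Q V B A"
  unfolding direct_sum_def
proof (intro ballI conjI)
  fix v assume *: "\<forall>v\<in>verts Q. V v = {x + y | x y. x \<in> A v \<and> y \<in> B v} \<and> A v \<inter> B v = {0}" "v \<in> verts Q"
  show "V v = {x + y | x y. x \<in> B v \<and> y \<in> A v}"
  proof -
    have "{x + y | x y. x \<in> A v \<and> y \<in> B v} = {x + y | x y. x \<in> B v \<and> y \<in> A v}"
      using add.commute by blast
    then show ?thesis using * by simp
  qed
  show "B v \<inter> A v = {0}" using * by blast
qed

lemma direct_sum_length:
  assumes "representation Q V f" "submodule Q V f A" "submodule Q V f B" "direct_sum Q V A B"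
  shows "module_length Q V = module_length Q A + module_length Q B"
    and "kvs.dim (V v) = kvs.dim (A v) + kvs.dim (B v)"
proof -
  show "kvs.dim (V v) = kvs.dim (A v) + kvs.dim (B v)" for v
    using dim_direct_sum[OF rep_findim[OF assms(1)] rep_subspace[OF submodule_rep[OF assms(2)]]
        rep_subspace[OF submodule_rep[OF assms(3)]] direct_sum_all(2)[OF assms] direct_sum_all(1)[OF assms]] .
  then show "module_length Q V = module_length Q A + module_length Q B"
    by (simp add: module_length_def sum.distrib)
qed

text \<open>Passing to a nonzero proper direct summand lowers the length, so the descent stops at an
  indecomposable one.\<close>

lemma indecomposable_submodule_exists:
  assumes "finite (verts Q)" "representation Q V f" "V \<noteq> zero_module"
  shows "\<exists>Z. submodule Q V f Z \<and> indecomposable Q Z f"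
  using assms(2,3)
proof (induction "module_length Q V" arbitrary: V rule: less_induct)
  case less
  show ?case
  proof (cases "indecomposable Q V f")
    case True
    then show ?thesis using submodule_refl[OF less(2)] by blast
  next
    case False
    then obtain A B where AB: "submodule Q V f A" "submodule Q V f B" "direct_sum Q V A B"
      "A \<noteq> zero_module" "B \<noteq> zero_module"
      using less(2,3) unfolding indecomposable_def by blast
    have "A < V" using direct_sum_proper[OF less(2) AB(1-3,5)] .
    then have "module_length Q A < module_length Q V"
      using length_strict_mono[OF assms(1) less(2) submodule_rep[OF AB(1)]] by blast
    then show ?thesis
      using less(1)[OF _ submodule_rep[OF AB(1)] AB(4)] submodule_trans[OF AB(1)] by blast
  qed
qed

section \<open>Images, kernels, retractions and projections of module homomorphisms\<close>

section \<open>Homomorphisms\<close>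

definition hom where
  "hom Q V f W g \<phi> \<longleftrightarrow> (\<forall>v. linear_on (V v) (\<phi> v) \<and> \<phi> v ` V v \<subseteq> W v) \<and>
     (\<forall>a\<in>arcs Q. \<forall>x\<in>V (tail Q a). \<phi> (head Q a) (f a x) = g a (\<phi> (tail Q a) x))"

definition injective where
  "injective V \<phi> \<longleftrightarrow> (\<forall>v. \<forall>x\<in>V v. \<phi> v x = 0 \<longrightarrow> x = 0)"

definition img where
  "img \<phi> V = (\<lambda>v. \<phi> v ` V v)"

lemma
  assumes "hom Q V f W g \<phi>"
  shows hom_linear: "linear_on (V v) (\<phi> v)" and hom_in: "x \<in> V v \<Longrightarrow> \<phi> v x \<in> W v"
    and hom_arrow: "a \<in> arcs Q \<Longrightarrow> x \<in> V (tail Q a) \<Longrightarrow> \<phi> (head Q a) (f a x) = g a (\<phi> (tail Q a) x)"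
  using assms by (auto simp: hom_def)

lemma homI:
  assumes "\<And>v. linear_on (V v) (\<phi> v)" "\<And>v x. x \<in> V v \<Longrightarrow> \<phi> v x \<in> W v"
    "\<And>a x. a \<in> arcs Q \<Longrightarrow> x \<in> V (tail Q a) \<Longrightarrow> \<phi> (head Q a) (f a x) = g a (\<phi> (tail Q a) x)"
  shows "hom Q V f W g \<phi>"
  using assms by (auto simp: hom_def)

lemma hom_0: "hom Q V f W g \<phi> \<Longrightarrow> representation Q V f \<Longrightarrow> \<phi> v 0 = 0"
  using linear_on_0[OF hom_linear rep_0] .

lemma hom_restrict: "hom Q V f W g \<phi> \<Longrightarrow> U \<le> V \<Longrightarrow> hom Q U f W g \<phi>"
  by (rule homI) (auto simp: le_fun_def subset_iff hom_in hom_arrow intro: linear_on_subset[OF hom_linear])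

lemma hom_codomain: "hom Q V f W g \<phi> \<Longrightarrow> (\<And>v x. x \<in> V v \<Longrightarrow> \<phi> v x \<in> U v) \<Longrightarrow> hom Q V f U g \<phi>"
  by (rule homI) (auto simp: hom_linear hom_arrow)

lemma hom_comp:
  assumes "hom Q V f W g \<phi>" "hom Q W g U h \<psi>"
  shows "hom Q V f U h (\<lambda>v x. \<psi> v (\<phi> v x))"
proof (rule homI)
  show "linear_on (V v) (\<lambda>x. \<psi> v (\<phi> v x))" for v
    using linear_on_comp[OF hom_linear[OF assms(1)] _ hom_linear[OF assms(2)]] hom_in[OF assms(1)] by blast
qed (use assms in \<open>auto simp: hom_in hom_arrow\<close>)

lemma injective_restrict: "injective V \<phi> \<Longrightarrow> U \<le> V \<Longrightarrow> injective U \<phi>"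
  by (auto simp: injective_def le_fun_def subset_iff)

lemma injective_inj_on:
  assumes "representation Q V f" "hom Q V f W g \<phi>" "injective V \<phi>"
  shows "inj_on (\<phi> v) (V v)"
  using assms(3) inj_on_kernel[OF hom_linear[OF assms(2)] rep_subspace[OF assms(1)]]
  by (simp add: injective_def)

lemma img_submodule:
  assumes "representation Q V f" "representation Q W g" "hom Q V f W g \<phi>"
  shows "submodule Q W g (img \<phi> V)"
proof (rule submoduleI[OF assms(2)])
  show "kvs.subspace (img \<phi> V v)" for v
    using findim_subspace[OF findim_image[OF rep_findim[OF assms(1)] hom_linear[OF assms(3)]]]
    by (simp add: img_def)
  show "img \<phi> V v \<subseteq> W v" for v using hom_in[OF assms(3)] by (auto simp: img_def)
  show "g a x \<in> img \<phi> V (head Q a)" if "a \<in> arcs Q" "x \<in> img \<phi> V (tail Q a)" for a x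
    using that hom_arrow[OF assms(3)] rep_arrow[OF assms(1)] by (force simp: img_def)
qed

lemma hom_img: "hom Q V f W g \<phi> \<Longrightarrow> hom Q V f (img \<phi> V) g \<phi>"
  by (rule hom_codomain) (auto simp: img_def)

lemma preimage_submodule:
  assumes "representation Q V f" "representation Q W g" "hom Q V f W g \<phi>" "submodule Q W g A"
  shows "submodule Q V f (\<lambda>v. {x \<in> V v. \<phi> v x \<in> A v})"
proof (rule submoduleI[OF assms(1)])
  show "kvs.subspace {x \<in> V v. \<phi> v x \<in> A v}" for v
    using subspace_preimage_on[OF hom_linear[OF assms(3)] rep_subspace[OF assms(1)]
        rep_subspace[OF submodule_rep[OF assms(4)]]] .
qed (use rep_arrow[OF assms(1)] hom_arrow[OF assms(3)] rep_arrow[OF submodule_rep[OF assms(4)]] in auto)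

lemma kernel_submodule:
  assumes "representation Q V f" "representation Q W g" "hom Q V f W g \<phi>"
  shows "submodule Q V f (\<lambda>v. {x \<in> V v. \<phi> v x = 0})"
  using preimage_submodule[OF assms zero_module_submodule[OF assms(2)]] by (simp add: zero_module_def)

lemma length_img:
  assumes "representation Q V f" "hom Q V f W g \<phi>" "injective V \<phi>"
  shows "module_length Q (img \<phi> V) = module_length Q V"
  using dim_image_inj[OF rep_findim[OF assms(1)] hom_linear[OF assms(2)] injective_inj_on[OF assms]]
  by (simp add: module_length_def img_def)

lemma length_img_less:
  assumes "finite (verts Q)" "representation Q V f" "representation Q W g" "hom Q V f W g \<phi>"
    "\<not> injective V \<phi>"
  shows "module_length Q (img \<phi> V) < module_length Q V"
proof -
  let ?K = "\<lambda>v. {x \<in> V v. \<phi> v x = 0}"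
  have "?K \<noteq> zero_module"
    using assms(5) unfolding injective_def zero_module_iff by blast
  then have "0 < module_length Q ?K"
    using length_pos[OF assms(1) submodule_rep[OF kernel_submodule[OF assms(2-4)]]] by blast
  moreover have "module_length Q V = module_length Q ?K + module_length Q (img \<phi> V)"
    using rank_nullity[OF rep_findim[OF assms(2)] hom_linear[OF assms(4)]]
    by (simp add: module_length_def img_def sum.distrib)
  ultimately show ?thesis by simp
qed

lemma img_le: "U \<le> V \<Longrightarrow> img \<phi> U \<le> img \<phi> V"
  by (auto simp: img_def le_fun_def)

lemma img_zero_module: "hom Q V f W g \<phi> \<Longrightarrow> representation Q V f \<Longrightarrow> img \<phi> zero_module = zero_module"
  by (simp add: img_def zero_module_def hom_0 del: zero_fun_apply)

text \<open>A decomposition of the image pulls back along the injective map to a decomposition of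
  \<open>V\<close>; one preimage is therefore zero, and so is its image.\<close>

lemma indecomposable_img:
  assumes "indecomposable Q V f" "representation Q W g" "hom Q V f W g \<phi>" "injective V \<phi>"
  shows "indecomposable Q (img \<phi> V) g"
  unfolding indecomposable_def
proof (intro conjI allI impI)
  note V = indecomposable_rep[OF assms(1)]
  note sub = img_submodule[OF V assms(2,3)]
  note inj = injective_inj_on[OF V assms(3,4)]
  show "representation Q (img \<phi> V) g" using submodule_rep[OF sub] .
  show "img \<phi> V \<noteq> zero_module"
  proof
    assume "img \<phi> V = zero_module"
    then have "\<phi> v ` V v = {0}" for v by (simp add: img_def zero_module_iff)
    then have "V v = {0}" for v
      using assms(4) rep_0[OF V, of v] unfolding injective_def by blast
    then show False using indecomposable_nonzero[OF assms(1)] by (simp add: zero_module_iff)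
  qed
  fix A B assume *: "submodule Q (img \<phi> V) g A \<and> submodule Q (img \<phi> V) g B \<and> direct_sum Q (img \<phi> V) A B"
  let ?P = "\<lambda>A v. {x \<in> V v. \<phi> v x \<in> A v}"
  note homi = hom_img[OF assms(3)]
  have pA: "submodule Q V f (?P A)" using preimage_submodule[OF V submodule_rep[OF sub] homi] * by blast
  have pB: "submodule Q V f (?P B)" using preimage_submodule[OF V submodule_rep[OF sub] homi] * by blast
  have ds: "direct_sum Q V (?P A) (?P B)"
    unfolding direct_sum_def
  proof (intro ballI conjI)
    fix v
    note d = direct_sum_all[OF submodule_rep[OF sub] conjunct1[OF *] conjunct1[OF conjunct2[OF *]]
        conjunct2[OF conjunct2[OF *]], of v]
    show "V v = {x + y |x y. x \<in> ?P A v \<and> y \<in> ?P B v}"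
    proof (intro subset_antisym subsetI)
      fix x assume x: "x \<in> V v"
      then have "\<phi> v x \<in> img \<phi> V v" by (simp add: img_def)
      then obtain a b where ab: "\<phi> v x = a + b" "a \<in> A v" "b \<in> B v" unfolding d(1) by blast
      have "a \<in> img \<phi> V v" using ab(2) submodule_le[OF conjunct1[OF *]] by (auto simp: le_fun_def)
      then obtain a' where a': "a' \<in> V v" "a = \<phi> v a'" by (auto simp: img_def)
      have y: "x - a' \<in> V v" using x a' kvs.subspace_diff[OF rep_subspace[OF V]] by blast
      have "\<phi> v (x - a') = b"
        using linear_on_diff[OF hom_linear[OF assms(3)] rep_subspace[OF V] x a'(1)] ab a' by simp
      then have "x = a' + (x - a') \<and> a' \<in> ?P A v \<and> x - a' \<in> ?P B v" using a' ab y by simp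
      then show "x \<in> {x + y |x y. x \<in> ?P A v \<and> y \<in> ?P B v}" by blast
    next
      fix x assume "x \<in> {x + y |x y. x \<in> ?P A v \<and> y \<in> ?P B v}"
      then show "x \<in> V v" using kvs.subspace_add[OF rep_subspace[OF V]] by blast
    qed
    show "?P A v \<inter> ?P B v = {0}"
    proof
      show "?P A v \<inter> ?P B v \<subseteq> {0}"
      proof
        fix x assume x: "x \<in> ?P A v \<inter> ?P B v"
        then have "\<phi> v x = 0" using d(2) by blast
        then show "x \<in> {0}" using x assms(4) unfolding injective_def by blast
      qed
      show "{0} \<subseteq> ?P A v \<inter> ?P B v"
        using rep_0[OF submodule_rep[OF pA], of v] rep_0[OF submodule_rep[OF pB], of v] by simp
    qed
  qed
  have im: "img \<phi> (?P A) = A" if "submodule Q (img \<phi> V) g A" for A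
  proof
    fix v
    have "A v \<subseteq> \<phi> v ` V v" using submodule_le[OF that] by (simp add: img_def le_fun_def)
    then show "img \<phi> (?P A) v = A v" unfolding img_def by blast
  qed
  have "?P A = zero_module \<or> ?P B = zero_module"
    using assms(1) pA pB ds unfolding indecomposable_def by blast
  then show "A = zero_module \<or> B = zero_module"
  proof
    assume "?P A = zero_module"
    then show ?thesis using im[of A] * img_zero_module[OF assms(3) V] by simp
  next
    assume "?P B = zero_module"
    then show ?thesis using im[of B] * img_zero_module[OF assms(3) V] by simp
  qed
qed

text \<open>The kernel of the retraction is a complement of \<open>X'\<close>, so it must
  vanish.\<close>

lemma retract_indecomposable:
  assumes "indecomposable Q X f" "submodule Q X f X'" "X' \<noteq> zero_module"
    "hom Q X f X' f \<rho>" "\<And>v x. x \<in> X' v \<Longrightarrow> \<rho> v x = x"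
  shows "X' = X"
proof -
  note X = indecomposable_rep[OF assms(1)]
  note X' = submodule_rep[OF assms(2)]
  let ?K = "\<lambda>v. {x \<in> X v. \<rho> v x = 0}"
  have K: "submodule Q X f ?K" using kernel_submodule[OF X X' assms(4)] .
  have le: "X' v \<subseteq> X v" for v using submodule_le[OF assms(2)] by (simp add: le_fun_def)
  have ex: "x = \<rho> v x + (x - \<rho> v x) \<and> \<rho> v x \<in> X' v \<and> x - \<rho> v x \<in> ?K v" if x: "x \<in> X v" for v x
  proof -
    have r: "\<rho> v x \<in> X' v" using hom_in[OF assms(4) x] .
    then have "\<rho> v x \<in> X v" using le by blast
    then have "\<rho> v (x - \<rho> v x) = \<rho> v x - \<rho> v (\<rho> v x)" "x - \<rho> v x \<in> X v"
      using linear_on_diff[OF hom_linear[OF assms(4)] rep_subspace[OF X] x]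
        kvs.subspace_diff[OF rep_subspace[OF X] x] by blast+
    then have "\<rho> v (x - \<rho> v x) = 0" "x - \<rho> v x \<in> X v" using assms(5)[OF r] by simp_all
    then show ?thesis using r by simp
  qed
  have "direct_sum Q X X' ?K"
    unfolding direct_sum_def
  proof (intro ballI conjI)
    fix v
    show "X v = {x + y |x y. x \<in> X' v \<and> y \<in> ?K v}"
    proof (intro subset_antisym subsetI)
      fix x assume "x \<in> X v"
      then show "x \<in> {x + y |x y. x \<in> X' v \<and> y \<in> ?K v}" using ex by blast
    next
      fix x assume "x \<in> {x + y |x y. x \<in> X' v \<and> y \<in> ?K v}"
      then show "x \<in> X v" using kvs.subspace_add[OF rep_subspace[OF X]] le by blast
    qed
    show "X' v \<inter> ?K v = {0}"
    proof
      show "X' v \<inter> ?K v \<subseteq> {0}"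
      proof
        fix x assume "x \<in> X' v \<inter> ?K v"
        then have "x \<in> X' v" "\<rho> v x = 0" by blast+
        then show "x \<in> {0}" using assms(5)[of x v] by simp
      qed
      show "{0} \<subseteq> X' v \<inter> ?K v"
        using rep_0[OF submodule_rep[OF K], of v] rep_0[OF X', of v] by simp
    qed
  qed
  then have "?K = zero_module" using assms(1-3) K unfolding indecomposable_def by blast
  then have K0: "?K v = {0}" for v by (simp add: zero_module_iff)
  have "X v \<subseteq> X' v" for v
  proof
    fix x assume "x \<in> X v"
    then have "x - \<rho> v x = 0" "\<rho> v x \<in> X' v" using ex K0[of v] by blast+
    then show "x \<in> X' v" by simp
  qed
  then show ?thesis using le by blast
qed

lemma direct_sum_projections:
  assumes "representation Q N g" "submodule Q N g A" "submodule Q N g B" "direct_sum Q N A B"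
  obtains p q where "hom Q N g A g p" "hom Q N g B g q" "\<And>v x. x \<in> N v \<Longrightarrow> x = p v x + q v x"
proof -
  note d = direct_sum_all[OF assms]
  note sA = rep_subspace[OF submodule_rep[OF assms(2)]] and sB = rep_subspace[OF submodule_rep[OF assms(3)]]
  have ex: "\<exists>r. linear_on (N v) r \<and> (\<forall>x\<in>N v. r x \<in> B v \<and> x - r x \<in> A v)" for v
  proof -
    obtain r where "linear_on (N v) r" "\<And>x. x \<in> N v \<Longrightarrow> r x \<in> B v" "\<And>x. x \<in> N v \<Longrightarrow> x - r x \<in> A v"
      by (rule direct_projection[OF sA[of v] sB[of v] d(2)[of v] d(1)[of v]]) blast
    then show ?thesis by blast
  qed
  define q where "q v = (SOME r. linear_on (N v) r \<and> (\<forall>x\<in>N v. r x \<in> B v \<and> x - r x \<in> A v))" for v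
  have "linear_on (N v) (q v) \<and> (\<forall>x\<in>N v. q v x \<in> B v \<and> x - q v x \<in> A v)" for v
    unfolding q_def using someI_ex[OF ex] .
  then have q: "linear_on (N v) (q v)" "x \<in> N v \<Longrightarrow> q v x \<in> B v \<and> x - q v x \<in> A v" for v x
    by blast+
  have uniq: "b = b'" if "a + b = a' + b'" "a \<in> A v" "a' \<in> A v" "b \<in> B v" "b' \<in> B v" for a b a' b' v
  proof -
    have "a - a' = b' - b" using that(1) by (simp add: algebra_simps)
    then have "b' - b \<in> A v \<inter> B v"
      using kvs.subspace_diff[OF sA[of v] that(2,3)] kvs.subspace_diff[OF sB[of v] that(5,4)] by simp
    then have "b' - b = 0" unfolding d(2) by blast
    then show ?thesis by simp
  qed
  have AN: "A v \<subseteq> N v" and BN: "B v \<subseteq> N v" for v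
    using submodule_le[OF assms(2)] submodule_le[OF assms(3)] by (auto simp: le_fun_def)
  have arr: "q (head Q a) (g a x) = g a (q (tail Q a) x)" if a: "a \<in> arcs Q" "x \<in> N (tail Q a)" for a x
  proof -
    let ?t = "tail Q a" and ?h = "head Q a"
    have gx: "g a x \<in> N ?h" using rep_arrow[OF assms(1) a] .
    have 1: "q ?t x \<in> B ?t" "x - q ?t x \<in> A ?t" using q(2)[OF a(2)] by blast+
    have "g a x = g a ((x - q ?t x) + q ?t x)" by simp
    also have "\<dots> = g a (x - q ?t x) + g a (q ?t x)"
      using linear_onD(1)[OF rep_linear[OF assms(1) a(1)]] 1 AN BN by blast
    finally have "(g a x - q ?h (g a x)) + q ?h (g a x) = g a (x - q ?t x) + g a (q ?t x)" by simp
    then show ?thesis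
      by (rule uniq[OF _ conjunct2[OF q(2)[OF gx]] rep_arrow[OF submodule_rep[OF assms(2)] a(1) 1(2)]
          conjunct1[OF q(2)[OF gx]] rep_arrow[OF submodule_rep[OF assms(3)] a(1) 1(1)]])
  qed
  have hq: "hom Q N g B g q" by (rule homI) (use q arr in blast)+
  have lp: "linear_on (N v) (\<lambda>x. x - q v x)" for v
    using linear_onD[OF q(1), of _ v] unfolding linear_on_def
    by (simp add: kvs.scale_right_diff_distrib)
  have hp: "hom Q N g A g (\<lambda>v x. x - q v x)"
  proof (rule homI)
    fix a x assume a: "a \<in> arcs Q" "x \<in> N (tail Q a)"
    have "g a (x - q (tail Q a) x) = g a x - g a (q (tail Q a) x)"
      using linear_on_diff[OF rep_linear[OF assms(1) a(1)] rep_subspace[OF assms(1)] a(2)] q(2)[OF a(2)] BN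
      by blast
    then show "g a x - q (head Q a) (g a x) = g a (x - q (tail Q a) x)" using arr[OF a] by simp
  qed (use lp q in blast)+
  show ?thesis using that[OF hp hq] by simp
qed

section \<open>Existence of the maximum and Gabriel-Roiter submodules\<close>

section \<open>Gabriel-Roiter measures\<close>

text \<open>Chains as finite totally ordered sets rather than sorted lists: adding a top member,
  truncating and mapping then become plain set operations.\<close>

definition indec_chain where
  "indec_chain Q V f \<W> \<longleftrightarrow> finite \<W> \<and> (\<forall>W\<in>\<W>. \<forall>W'\<in>\<W>. W \<le> W' \<or> W' \<le> W) \<and>
     (\<forall>W\<in>\<W>. submodule Q V f W \<and> indecomposable Q W f)"

lemma sorted_chain_list:
  fixes S :: "'b::order set"
  assumes "finite S" "\<forall>x\<in>S. \<forall>y\<in>S. x \<le> y \<or> y \<le> x"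
  shows "\<exists>xs. set xs = S \<and> sorted_wrt (<) xs"
  using assms
proof (induction rule: finite_psubset_induct)
  case (psubset S)
  show ?case
  proof (cases "S = {}")
    case False
    obtain m where m: "m \<in> S" "\<forall>x\<in>S. m \<le> x \<longrightarrow> m = x"
      using finite_has_maximal[OF psubset(1) False] by blast
    obtain xs where xs: "set xs = S - {m}" "sorted_wrt (<) xs"
      using psubset(2)[of "S - {m}"] m(1) psubset(3) by blast
    have "x < m" if "x \<in> set xs" for x
      using m psubset(3) that xs(1) by (metis DiffE insertI1 order_le_less)
    then have "sorted_wrt (<) (xs @ [m])" using xs(2) by (simp add: sorted_wrt_append)
    moreover have "set (xs @ [m]) = S" using xs(1) m(1) by auto
    ultimately show ?thesis by blast
  qed (auto intro: exI[of _ "[]"])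
qed

lemma sorted_wrt_less_chain:
  fixes xs :: "'b::order list"
  assumes "sorted_wrt (<) xs" "x \<in> set xs" "y \<in> set xs"
  shows "x \<le> y \<or> y \<le> x"
  using assms by (induction xs) auto

lemma chain_length_sets_iff:
  "J \<in> chain_length_sets Q V f \<longleftrightarrow> (\<exists>\<W>. indec_chain Q V f \<W> \<and> J = module_length Q ` \<W>)"
proof
  assume "J \<in> chain_length_sets Q V f"
  then obtain Ws where Ws: "J = module_length Q ` set Ws" "sorted_wrt (<) Ws"
      "\<forall>W\<in>set Ws. submodule Q V f W \<and> indecomposable Q W f"
    unfolding chain_length_sets_def indecomposable_chain_def by blast
  have "indec_chain Q V f (set Ws)"
    unfolding indec_chain_def using Ws(3) sorted_wrt_less_chain[OF Ws(2)] by blast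
  then show "\<exists>\<W>. indec_chain Q V f \<W> \<and> J = module_length Q ` \<W>" using Ws(1) by blast
next
  assume "\<exists>\<W>. indec_chain Q V f \<W> \<and> J = module_length Q ` \<W>"
  then obtain \<W> where W: "indec_chain Q V f \<W>" "J = module_length Q ` \<W>" by blast
  obtain Ws where "set Ws = \<W>" "sorted_wrt (<) Ws"
    using sorted_chain_list[of \<W>] W(1) unfolding indec_chain_def by blast
  then show "J \<in> chain_length_sets Q V f"
    unfolding chain_length_sets_def indecomposable_chain_def using W unfolding indec_chain_def by blast
qed

lemma chain_length_setsI: "indec_chain Q V f \<W> \<Longrightarrow> module_length Q ` \<W> \<in> chain_length_sets Q V f"
  unfolding chain_length_sets_iff by blast

lemma chain_length_sets_bound:
  assumes "finite (verts Q)" "representation Q V f" "J \<in> chain_length_sets Q V f"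
  shows "J \<subseteq> {..module_length Q V}"
proof -
  obtain \<W> where W: "indec_chain Q V f \<W>" "J = module_length Q ` \<W>"
    using assms(3) unfolding chain_length_sets_iff by blast
  then show ?thesis
    unfolding indec_chain_def
    using length_mono[OF assms(1,2)] submodule_rep submodule_le by fastforce
qed

text \<open>Makes the description in \<open>gr_measure\<close> meaningful: the candidate sets are
  subsets of an interval bounded by the length, hence finitely many, and the order is total.\<close>

lemma gr_measure_max:
  assumes "finite (verts Q)" "representation Q V f"
  shows "gr_measure Q V f \<in> chain_length_sets Q V f"
    and "J \<in> chain_length_sets Q V f \<Longrightarrow> gr_le J (gr_measure Q V f)"
proof -
  have "finite (chain_length_sets Q V f)"
    using finite_subset[of _ "Pow {..module_length Q V}"] chain_length_sets_bound[OF assms] by blast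
  moreover have "{} \<in> chain_length_sets Q V f"
    using chain_length_setsI[of Q V f "{}"] by (simp add: indec_chain_def)
  ultimately obtain I where I: "I \<in> chain_length_sets Q V f" "\<forall>J\<in>chain_length_sets Q V f. gr_le J I"
    using gr_max_exists by blast
  have "gr_measure Q V f = I"
    unfolding gr_measure_def gr_le_def[symmetric]
  proof (rule the_equality)
    show "I \<in> chain_length_sets Q V f \<and> (\<forall>J\<in>chain_length_sets Q V f. gr_le J I)" using I by blast
  next
    fix I' assume "I' \<in> chain_length_sets Q V f \<and> (\<forall>J\<in>chain_length_sets Q V f. gr_le J I')"
    then show "I' = I" using I gr_le_antisym by blast
  qed
  then show "gr_measure Q V f \<in> chain_length_sets Q V f"
    and "J \<in> chain_length_sets Q V f \<Longrightarrow> gr_le J (gr_measure Q V f)" using I by auto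
qed

lemma gr_measure_bound:
  assumes "finite (verts Q)" "representation Q V f"
  shows "gr_measure Q V f \<subseteq> {..module_length Q V}"
  using chain_length_sets_bound[OF assms gr_measure_max(1)[OF assms]] .

lemma chain_length_sets_mono:
  assumes "submodule Q V f W"
  shows "chain_length_sets Q W f \<subseteq> chain_length_sets Q V f"
proof
  fix J assume "J \<in> chain_length_sets Q W f"
  then obtain \<W> where W: "indec_chain Q W f \<W>" "J = module_length Q ` \<W>"
    unfolding chain_length_sets_iff by blast
  then have "indec_chain Q V f \<W>"
    unfolding indec_chain_def using submodule_trans[OF assms] by blast
  then show "J \<in> chain_length_sets Q V f" using W(2) chain_length_setsI by blast
qed

lemma chain_length_sets_insert:
  assumes "indecomposable Q V f" "submodule Q V f W" "J \<in> chain_length_sets Q W f"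
  shows "insert (module_length Q V) J \<in> chain_length_sets Q V f"
proof -
  obtain \<W> where W: "indec_chain Q W f \<W>" "J = module_length Q ` \<W>"
    using assms(3) unfolding chain_length_sets_iff by blast
  have "indec_chain Q V f (insert V \<W>)"
    using W(1) assms(1) submodule_trans[OF assms(2)] submodule_refl[OF indecomposable_rep[OF assms(1)]]
      submodule_le
    unfolding indec_chain_def by (metis finite_insert insert_iff order_refl)
  then show ?thesis using chain_length_setsI[of Q V f "insert V \<W>"] W(2) by simp
qed

lemma chain_length_sets_img:
  assumes "representation Q V f" "representation Q W g" "hom Q V f W g \<phi>" "injective V \<phi>"
    "J \<in> chain_length_sets Q V f"
  shows "J \<in> chain_length_sets Q (img \<phi> V) g"
proof -
  obtain \<W> where W: "indec_chain Q V f \<W>" "J = module_length Q ` \<W>"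
    using assms(5) unfolding chain_length_sets_iff by blast
  have U: "submodule Q (img \<phi> V) g (img \<phi> U) \<and> indecomposable Q (img \<phi> U) g \<and>
      module_length Q (img \<phi> U) = module_length Q U" if "U \<in> \<W>" for U
  proof -
    have s: "submodule Q V f U" "indecomposable Q U f" using W(1) that unfolding indec_chain_def by blast+
    note h = hom_restrict[OF assms(3) submodule_le[OF s(1)]]
    note i = injective_restrict[OF assms(4) submodule_le[OF s(1)]]
    show ?thesis
      using submodule_between[OF img_submodule[OF submodule_rep[OF s(1)] assms(2) h]
          img_le[OF submodule_le[OF s(1)]]]
        indecomposable_img[OF s(2) assms(2) h i] length_img[OF submodule_rep[OF s(1)] h i] by blast
  qed
  have "indec_chain Q (img \<phi> V) g (img \<phi> ` \<W>)"
    unfolding indec_chain_def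
  proof (intro conjI ballI)
    show "finite (img \<phi> ` \<W>)" using W(1) unfolding indec_chain_def by blast
    fix A assume A: "A \<in> img \<phi> ` \<W>"
    then show "submodule Q (img \<phi> V) g A" "indecomposable Q A g" using U by blast+
    fix B assume "B \<in> img \<phi> ` \<W>"
    then obtain A' B' where AB: "A' \<in> \<W>" "B' \<in> \<W>" "A = img \<phi> A'" "B = img \<phi> B'" using A by blast
    then have "A' \<le> B' \<or> B' \<le> A'" using W(1) unfolding indec_chain_def by blast
    then show "A \<le> B \<or> B \<le> A" using AB img_le by blast
  qed
  moreover have "module_length Q ` img \<phi> ` \<W> = J"
    unfolding W(2) image_image using U by (intro image_cong) auto
  ultimately show ?thesis using chain_length_setsI by metis
qed

text \<open>A chain realising the measure ends in \<open>V\<close> itself. Either nothing lies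
  below, or its largest member below \<open>V\<close> is a Gabriel-Roiter submodule
  \<open>X\<close>, whose measure the rest of the chain must realise. Inductions over the main
  property descend along \<open>X\<close>.\<close>

lemma gr_measure_indecomposable:
  assumes "finite (verts Q)" "indecomposable Q V f"
  obtains "gr_measure Q V f = {module_length Q V}"
      "\<And>X. submodule Q V f X \<Longrightarrow> indecomposable Q X f \<Longrightarrow> X = V"
    | X where "submodule Q V f X" "indecomposable Q X f" "X < V"
      "gr_measure Q V f = insert (module_length Q V) (gr_measure Q X f)"
proof -
  let ?l = "module_length Q"
  note V = indecomposable_rep[OF assms(2)]
  have less: "?l X < ?l V" if "submodule Q V f X" "X < V" for X
    using length_strict_mono[OF assms(1) V submodule_rep[OF that(1)] that(2)] .
  obtain \<W> where W: "indec_chain Q V f \<W>" "gr_measure Q V f = ?l ` \<W>"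
    using gr_measure_max(1)[OF assms(1) V] unfolding chain_length_sets_iff by blast
  have sub: "submodule Q V f X" "indecomposable Q X f" if "X \<in> \<W>" for X
    using W(1) that unfolding indec_chain_def by blast+
  let ?W = "\<W> - {V}"
  have small: "?l X < ?l V" if "X \<in> ?W" for X
    using less[OF sub(1)] submodule_le[OF sub(1)] that by (simp add: order.not_eq_order_implies_strict)
  \<comment> \<open>Appending \<open>V\<close> on top of a chain that misses it adds a larger
    number, which gives a larger set.\<close>
  have VW: "V \<in> \<W>"
  proof (rule ccontr)
    assume n: "V \<notin> \<W>"
    have "insert (?l V) (?l ` \<W>) \<in> chain_length_sets Q V f"
      using chain_length_sets_insert[OF assms(2) submodule_refl[OF V] chain_length_setsI[OF W(1)]] .
    then have "gr_le (insert (?l V) (?l ` \<W>)) (?l ` \<W>)"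
      using gr_measure_max(2)[OF assms(1) V] W(2) by metis
    moreover have "gr_less (?l ` \<W>) (insert (?l V) (?l ` \<W>))"
      using small n by (intro gr_less_insert) auto
    ultimately show False by (simp add: gr_le_iff_not_less)
  qed
  have \<mu>: "gr_measure Q V f = insert (?l V) (?l ` ?W)" using VW W(2) by blast
  show ?thesis
  proof (cases "?W = {}")
    case True
    show ?thesis
    proof (rule that(1))
      show eq: "gr_measure Q V f = {?l V}" using \<mu> unfolding True by simp
      fix X assume X: "submodule Q V f X" "indecomposable Q X f"
      show "X = V"
      proof (rule ccontr)
        assume "X \<noteq> V"
        then have lt: "?l X < ?l V" using less[OF X(1)] submodule_le[OF X(1)] by simp
        have "indec_chain Q X f {X}"
          using X(2) submodule_refl[OF submodule_rep[OF X(1)]] unfolding indec_chain_def by simp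
        from chain_length_sets_insert[OF assms(2) X(1) chain_length_setsI[OF this]]
        have "gr_le {?l V, ?l X} {?l V}" using gr_measure_max(2)[OF assms(1) V] eq by simp
        moreover have "gr_less {?l V} {?l V, ?l X}"
          using lt unfolding gr_less_iff by (intro exI[of _ "?l X"]) auto
        ultimately show False by (simp add: gr_le_iff_not_less)
      qed
    qed
  next
    case False
    have "finite ?W" using W(1) unfolding indec_chain_def by blast
    then obtain X where X: "X \<in> ?W" "\<forall>Y\<in>?W. X \<le> Y \<longrightarrow> X = Y"
      using finite_has_maximal[OF _ False] by blast
    then have top: "Y \<le> X" if "Y \<in> ?W" for Y
      using W(1) that unfolding indec_chain_def by (metis DiffE order_refl)
    have XW: "X \<in> \<W>" and XV: "X < V"
      using X(1) submodule_le[OF sub(1)] by (auto simp: order.not_eq_order_implies_strict)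
    have "indec_chain Q X f ?W"
      using W(1) top submodule_between unfolding indec_chain_def by blast
    from chain_length_setsI[OF this]
    have le1: "gr_le (?l ` ?W) (gr_measure Q X f)"
      using gr_measure_max(2)[OF assms(1) indecomposable_rep[OF sub(2)[OF XW]]] by blast
    have le2: "gr_le (insert (?l V) (gr_measure Q X f)) (insert (?l V) (?l ` ?W))"
      using gr_measure_max(2)[OF assms(1) V chain_length_sets_insert[OF assms(2) sub(1)[OF XW]
          gr_measure_max(1)[OF assms(1) indecomposable_rep[OF sub(2)[OF XW]]]]] \<mu> by simp
    \<comment> \<open>Otherwise the part of the chain below \<open>V\<close> could be exchanged for
      an optimal chain in \<open>X\<close>; all its lengths are below that of \<open>V\<close>, so
      the gain survives adding \<open>V\<close>.\<close>
    have "?l ` ?W = gr_measure Q X f"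
    proof (rule ccontr)
      assume "?l ` ?W \<noteq> gr_measure Q X f"
      then have "gr_less (?l ` ?W) (gr_measure Q X f)" using le1 by (simp add: gr_le_def)
      moreover have "?l ` ?W \<subseteq> {..<?l V}" using small by auto
      moreover have "gr_measure Q X f \<subseteq> {..<?l V}"
        using gr_measure_bound[OF assms(1) indecomposable_rep[OF sub(2)[OF XW]]] less[OF sub(1)[OF XW] XV]
        by (auto simp: subset_iff)
      ultimately have "gr_less (insert (?l V) (?l ` ?W)) (insert (?l V) (gr_measure Q X f))"
        using gr_less_insert_mono by blast
      then show False using le2 by (simp add: gr_le_iff_not_less)
    qed
    then show ?thesis using that(2)[OF sub[OF XW] XV] \<mu> by simp
  qed
qed


section \<open>Embeddings into modules of no larger measure split\<close>

section \<open>Gabriel's main property\<close>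

text \<open>\<open>N\<close> may be decomposable. Quantifying over all indecomposable submodules,
  not only over summands, makes the condition pass to submodules at once.\<close>

definition dominated where
  "dominated Q X f N g \<longleftrightarrow> (\<forall>Z. submodule Q N g Z \<longrightarrow> indecomposable Q Z g \<longrightarrow>
     gr_le (gr_measure Q Z g) (gr_measure Q X f))"

lemma dominated_submodule: "dominated Q X f N g \<Longrightarrow> submodule Q N g A \<Longrightarrow> dominated Q X f A g"
  unfolding dominated_def using submodule_trans by blast

text \<open>An embedding of \<open>X\<close> into a direct sum of \<open>A\<close> and
  \<open>B\<close> is encoded by its two components, that is by a pair of maps without common
  kernel, so that no external sum has to be built. The same \<open>g\<close> serves both sides
  because \<open>A\<close> and \<open>B\<close> arise inside one module.\<close>

definition splits_into_injective where
  "splits_into_injective Q X f \<longleftrightarrow> (\<forall>A B g \<phi> \<psi>. representation Q A g \<longrightarrow> representation Q B g \<longrightarrow>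
     hom Q X f A g \<phi> \<longrightarrow> hom Q X f B g \<psi> \<longrightarrow> (\<forall>v. \<forall>x\<in>X v. \<phi> v x = 0 \<longrightarrow> \<psi> v x = 0 \<longrightarrow> x = 0) \<longrightarrow>
     dominated Q X f A g \<longrightarrow> dominated Q X f B g \<longrightarrow> injective X \<phi> \<or> injective X \<psi>)"

text \<open>Induction on the length of \<open>N\<close>: a decomposable \<open>N\<close> has a
  summand on which the component of \<open>j\<close> is still injective, and a retraction from that
  summand suffices. The splitting property of \<open>X\<close> is a hypothesis, because its own
  proof uses this lemma for a shorter module.\<close>

lemma retraction_of_embedding:
  assumes "finite (verts Q)" "indecomposable Q X f" "splits_into_injective Q X f"
    "representation Q N g" "hom Q X f N g j" "injective X j" "dominated Q X f N g"
  shows "\<exists>r. hom Q N g X f r \<and> (\<forall>v. \<forall>x\<in>X v. r v (j v x) = x)"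
  using assms(4-7)
proof (induction "module_length Q N" arbitrary: N j rule: less_induct)
  case less
  note X = indecomposable_rep[OF assms(2)]
  note \<mu>X = gr_measure_bound[OF assms(1) X]
  note inj = injective_inj_on[OF X less(3,4)]
  show ?case
  proof (cases "indecomposable Q N g")
    case True
    \<comment> \<open>An indecomposable \<open>N\<close> properly containing a copy of
      \<open>X\<close> would have a measure at least that of \<open>X\<close> enlarged by the length
      of \<open>N\<close>, against the domination.\<close>
    have img: "img j X = N"
    proof (rule ccontr)
      assume n: "img j X \<noteq> N"
      note s = img_submodule[OF X less(2,3)]
      have "module_length Q X < module_length Q N"
        using length_strict_mono[OF assms(1) less(2) submodule_rep[OF s]] submodule_le[OF s] n
          length_img[OF X less(3,4)] by simp
      then have sub: "gr_measure Q X f \<subseteq> {..<module_length Q N}" using \<mu>X by (auto simp: subset_iff)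
      have "insert (module_length Q N) (gr_measure Q X f) \<in> chain_length_sets Q N g"
        using chain_length_sets_insert[OF True s chain_length_sets_img[OF X less(2-4)
              gr_measure_max(1)[OF assms(1) X]]] .
      then have "gr_le (insert (module_length Q N) (gr_measure Q X f)) (gr_measure Q N g)"
        using gr_measure_max(2)[OF assms(1) less(2)] by blast
      moreover have "gr_le (gr_measure Q N g) (gr_measure Q X f)"
        using less(5) True submodule_refl[OF less(2)] unfolding dominated_def by blast
      ultimately have "gr_le (insert (module_length Q N) (gr_measure Q X f)) (gr_measure Q X f)"
        by (rule gr_le_trans)
      then show False using gr_less_insert[OF sub] by (simp add: gr_le_iff_not_less)
    qed
    define r where "r v = inv_into (X v) (j v)" for v
    have Nv: "\<exists>x\<in>X v. y = j v x" if "y \<in> N v" for v y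
      using that unfolding img[symmetric] img_def by blast
    have rj: "r v (j v x) = x" if "x \<in> X v" for v x
      unfolding r_def using inv_into_f_f[OF inj that] .
    have "hom Q N g X f r"
    proof (rule homI)
      show "linear_on (N v) (r v)" for v
        unfolding linear_on_def
      proof (intro conjI ballI allI)
        fix y z assume "y \<in> N v" "z \<in> N v"
        then obtain x x' where *: "x \<in> X v" "y = j v x" "x' \<in> X v" "z = j v x'" using Nv by blast
        have "y + z = j v (x + x')" using linear_onD(1)[OF hom_linear[OF less(3)] *(1,3)] * by simp
        moreover have "x + x' \<in> X v" using * kvs.subspace_add[OF rep_subspace[OF X]] by blast
        ultimately show "r v (y + z) = r v y + r v z" using rj * by simp
      next
        fix c y assume "y \<in> N v"
        then obtain x where *: "x \<in> X v" "y = j v x" using Nv by blast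
        have "kscale c y = j v (kscale c x)" using linear_onD(2)[OF hom_linear[OF less(3)] *(1)] * by simp
        moreover have "kscale c x \<in> X v" using * kvs.subspace_scale[OF rep_subspace[OF X]] by blast
        ultimately show "r v (kscale c y) = kscale c (r v y)" using rj * by simp
      qed
      show "r v y \<in> X v" if y: "y \<in> N v" for v y
      proof -
        obtain x where "x \<in> X v" "y = j v x" using Nv[OF y] by blast
        then show ?thesis using rj by simp
      qed
      fix a y assume a: "a \<in> arcs Q" "y \<in> N (tail Q a)"
      obtain x where *: "x \<in> X (tail Q a)" "y = j (tail Q a) x" using Nv[OF a(2)] by blast
      have "g a y = j (head Q a) (f a x)" using hom_arrow[OF less(3) a(1) *(1)] * by simp
      then show "r (head Q a) (g a y) = f a (r (tail Q a) y)"
        using rj * rep_arrow[OF X a(1) *(1)] by simp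
    qed
    then show ?thesis using rj by blast
  next
    case False
    have "N \<noteq> zero_module"
    proof
      assume "N = zero_module"
      then have "X v = {0}" for v
        using less(4) hom_in[OF less(3)] rep_0[OF X, of v] unfolding injective_def zero_module_iff by blast
      then show False using indecomposable_nonzero[OF assms(2)] by (simp add: zero_module_iff)
    qed
    then obtain A B where AB: "submodule Q N g A" "submodule Q N g B" "direct_sum Q N A B"
        "A \<noteq> zero_module" "B \<noteq> zero_module"
      using False less(2) unfolding indecomposable_def by blast
    obtain p q where pq: "hom Q N g A g p" "hom Q N g B g q" "\<And>v x. x \<in> N v \<Longrightarrow> x = p v x + q v x"
      by (rule direct_sum_projections[OF less(2) AB(1-3)]) blast
    have step: ?thesis if A: "submodule Q N g A" "A < N" and p: "hom Q N g A g p"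
      and inj: "injective X (\<lambda>v x. p v (j v x))" for A p
    proof -
      have l: "module_length Q A < module_length Q N"
        using length_strict_mono[OF assms(1) less(2) submodule_rep[OF A(1)] A(2)] .
      obtain r where r: "hom Q A g X f r" "\<forall>v. \<forall>x\<in>X v. r v (p v (j v x)) = x"
        using less(1)[OF l submodule_rep[OF A(1)] hom_comp[OF less(3) p] inj
            dominated_submodule[OF less(5) A(1)]] by blast
      then show ?thesis using hom_comp[OF p r(1)] by blast
    qed
    have "\<forall>v. \<forall>x\<in>X v. p v (j v x) = 0 \<longrightarrow> q v (j v x) = 0 \<longrightarrow> x = 0"
    proof (intro allI ballI impI)
      fix v x assume x: "x \<in> X v" "p v (j v x) = 0" "q v (j v x) = 0"
      have "j v x = 0" using pq(3)[OF hom_in[OF less(3) x(1)]] x by simp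
      then show "x = 0" using less(4) x(1) unfolding injective_def by blast
    qed
    then have "injective X (\<lambda>v x. p v (j v x)) \<or> injective X (\<lambda>v x. q v (j v x))"
      using assms(3) submodule_rep[OF AB(1)] submodule_rep[OF AB(2)] hom_comp[OF less(3) pq(1)]
        hom_comp[OF less(3) pq(2)] dominated_submodule[OF less(5) AB(1)]
        dominated_submodule[OF less(5) AB(2)]
      unfolding splits_into_injective_def by blast
    then show ?thesis
      using step[OF AB(1) direct_sum_proper[OF less(2) AB(1-3,5)] pq(1)]
        step[OF AB(2) direct_sum_proper[OF less(2) AB(2,1) direct_sum_commute[OF AB(3)] AB(4)] pq(2)]
      by blast
  qed
qed

text \<open>Suppose neither map is injective. The Gabriel-Roiter submodule \<open>X'\<close> has the
  property by induction, so one of the maps is injective on \<open>X'\<close>, and the image of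
  \<open>X\<close> under it retracts onto the copy of \<open>X'\<close>. Composing gives a
  retraction of \<open>X\<close> onto the proper submodule \<open>X'\<close>, which
  indecomposability forbids.\<close>

lemma indecomposable_splits_into_injective:
  assumes "finite (verts Q)" "indecomposable Q X f"
  shows "splits_into_injective Q X f"
  using assms(2)
proof (induction "module_length Q X" arbitrary: X rule: less_induct)
  case less
  note X = indecomposable_rep[OF less(2)]
  show ?case
    unfolding splits_into_injective_def
  proof (intro allI impI)
    fix A B g \<phi> \<psi>
    assume A: "representation Q A g" and B: "representation Q B g"
      and \<phi>: "hom Q X f A g \<phi>" and \<psi>: "hom Q X f B g \<psi>"
      and joint: "\<forall>v. \<forall>x\<in>X v. \<phi> v x = 0 \<longrightarrow> \<psi> v x = 0 \<longrightarrow> x = 0"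
      and dom: "dominated Q X f A g" "dominated Q X f B g"
    show "injective X \<phi> \<or> injective X \<psi>"
    proof (rule ccontr)
      assume n: "\<not> (injective X \<phi> \<or> injective X \<psi>)"
      let ?l = "module_length Q"
      show False
      proof (rule gr_measure_indecomposable[OF assms(1) less(2)])
        assume simple: "\<And>Y. submodule Q X f Y \<Longrightarrow> indecomposable Q Y f \<Longrightarrow> Y = X"
        \<comment> \<open>Here \<open>X\<close> has no other indecomposable submodule. A nonzero
          kernel contains an indecomposable one, hence all of \<open>X\<close>; so a map that is not
          injective is zero, and two zero maps have a common kernel.\<close>
        have all: "\<chi> v x = 0" if C: "representation Q C g" "hom Q X f C g \<chi>" "\<not> injective X \<chi>" and x: "x \<in> X v"
          for C \<chi> v x
        proof -
          let ?K = "\<lambda>v. {x \<in> X v. \<chi> v x = 0}"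
          have K: "submodule Q X f ?K" using kernel_submodule[OF X C(1,2)] .
          have "?K \<noteq> zero_module" using C(3) unfolding injective_def zero_module_iff by blast
          then obtain Z where "submodule Q ?K f Z" "indecomposable Q Z f"
            using indecomposable_submodule_exists[OF assms(1) submodule_rep[OF K]] by blast
          then have "X \<le> ?K" using simple[of Z] submodule_trans[OF K] submodule_le by blast
          then show ?thesis using x by (auto simp: le_fun_def)
        qed
        have "X v = {0}" for v
          using all[OF A \<phi>, of _ v] all[OF B \<psi>, of _ v] n joint rep_0[OF X, of v] by blast
        then show False using indecomposable_nonzero[OF less(2)] by (simp add: zero_module_iff)
      next
        fix X' assume X': "submodule Q X f X'" "indecomposable Q X' f" "X' < X"
          "gr_measure Q X f = insert (?l X) (gr_measure Q X' f)"
        note X'r = submodule_rep[OF X'(1)]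
        have lt: "?l X' < ?l X" using length_strict_mono[OF assms(1) X X'r X'(3)] .
        note G = less(1)[OF lt X'(2)]
        have \<mu>X': "gr_measure Q X' f \<subseteq> {..<?l X}"
          using gr_measure_bound[OF assms(1) X'r] lt by (auto simp: subset_iff)
        text \<open>The images are shorter than \<open>X\<close>, so their indecomposable submodules are
          even bounded by the measure of \<open>X'\<close>.\<close>
        have dom': "dominated Q X' f (img \<chi> X) g"
          if C: "representation Q C g" "hom Q X f C g \<chi>" "\<not> injective X \<chi>" "dominated Q X f C g" for C \<chi>
          unfolding dominated_def
        proof (intro allI impI)
          fix Z assume Z: "submodule Q (img \<chi> X) g Z" "indecomposable Q Z g"
          note s = img_submodule[OF X C(1,2)]
          have "?l Z < ?l X"
            using length_img_less[OF assms(1) X C(1-3)]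
              length_mono[OF assms(1) submodule_rep[OF s] submodule_rep[OF Z(1)] submodule_le[OF Z(1)]] by simp
          then have "gr_measure Q Z g \<subseteq> {..<?l X}"
            using gr_measure_bound[OF assms(1) submodule_rep[OF Z(1)]] by (auto simp: subset_iff)
          moreover have "gr_le (gr_measure Q Z g) (gr_measure Q X f)"
            using C(4) submodule_trans[OF s Z(1)] Z(2) unfolding dominated_def by blast
          ultimately show "gr_le (gr_measure Q Z g) (gr_measure Q X' f)"
            using gr_le_insertD[OF _ \<mu>X'] X'(4) by simp
        qed
        have absurd: False if C: "representation Q C g" "hom Q X f C g \<chi>" "\<not> injective X \<chi>" "dominated Q X f C g"
          and inj: "injective X' \<chi>" for C \<chi>
        proof -
          note s = submodule_rep[OF img_submodule[OF X C(1,2)]]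
          note h = hom_img[OF C(2)]
          obtain r where r: "hom Q (img \<chi> X) g X' f r" "\<forall>v. \<forall>x\<in>X' v. r v (\<chi> v x) = x"
            using retraction_of_embedding[OF assms(1) X'(2) G s hom_restrict[OF h submodule_le[OF X'(1)]]
                inj dom'[OF C]] by blast
          have "X' = X"
            using retract_indecomposable[OF less(2) X'(1) indecomposable_nonzero[OF X'(2)] hom_comp[OF h r(1)]]
              r(2) by blast
          then show False using X'(3) by simp
        qed
        have "\<forall>v. \<forall>x\<in>X' v. \<phi> v x = 0 \<longrightarrow> \<psi> v x = 0 \<longrightarrow> x = 0"
          using joint submodule_le[OF X'(1)] by (auto simp: le_fun_def)
        then have "injective X' \<phi> \<or> injective X' \<psi>"
          using G submodule_rep[OF img_submodule[OF X A \<phi>]] submodule_rep[OF img_submodule[OF X B \<psi>]]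
            hom_restrict[OF hom_img[OF \<phi>] submodule_le[OF X'(1)]]
            hom_restrict[OF hom_img[OF \<psi>] submodule_le[OF X'(1)]] dom'[OF A \<phi>] dom'[OF B \<psi>] dom n
          unfolding splits_into_injective_def by blast
        then show False using absurd[OF A \<phi>] absurd[OF B \<psi>] dom n by blast
      qed
    qed
  qed
qed

lemma main_property:
  assumes "finite (verts Q)" "indecomposable Q X f"
    "representation Q N g" "hom Q X f N g j" "injective X j" "dominated Q X f N g"
  obtains r where "hom Q N g X f r" "\<And>v x. x \<in> X v \<Longrightarrow> r v (j v x) = x"
  using retraction_of_embedding[OF assms(1,2) indecomposable_splits_into_injective[OF assms(1,2)] assms(3-6)]
  by blast

section \<open>Socle and top of indecomposable Kronecker modules\<close>

section \<open>Modules over Kronecker quivers\<close>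

definition kmod :: "'k::field vect set \<Rightarrow> 'k vect set \<Rightarrow> nat \<Rightarrow> 'k vect set" where
  "kmod A B = (\<lambda>v. if v = 1 then A else if v = 2 then B else {0})"

lemma kmod_simps [simp]: "kmod A B 1 = A" "kmod A B (Suc 0) = A" "kmod A B 2 = B"
  "v \<noteq> 1 \<Longrightarrow> v \<noteq> 2 \<Longrightarrow> kmod A B v = {0}"
  by (auto simp: kmod_def)

lemma kronecker_simps [simp]: "verts (kronecker_quiver n) = {1, 2}" "arcs (kronecker_quiver n) = {..<n}"
  "tail (kronecker_quiver n) a = 2" "head (kronecker_quiver n) a = 1"
  by (auto simp: kronecker_quiver_def)

lemma kronecker_length: "module_length (kronecker_quiver n) V = kvs.dim (V 1) + kvs.dim (V 2)"
  by (simp add: module_length_def)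

lemma kronecker_repI:
  assumes "findim A" "findim B" "\<And>a. a < n \<Longrightarrow> linear_on B (f a)" "\<And>a x. a < n \<Longrightarrow> x \<in> B \<Longrightarrow> f a x \<in> A"
  shows "representation (kronecker_quiver n) (kmod A B) f"
  unfolding representation_iff
proof (intro conjI allI impI ballI)
  show "findim (kmod A B v)" for v using assms(1,2) by (simp add: kmod_def)
  show "kmod A B v = {0}" if "v \<notin> verts (kronecker_quiver n)" for v using that by simp
  fix a assume "a \<in> arcs (kronecker_quiver n)"
  then have a: "a < n" by simp
  show "linear_on (kmod A B (tail (kronecker_quiver n) a)) (f a)" using assms(3)[OF a] by simp
  show "f a ` kmod A B (tail (kronecker_quiver n) a) \<subseteq> kmod A B (head (kronecker_quiver n) a)"
    using assms(4)[OF a] by auto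
qed

lemma kronecker_repD:
  assumes "representation (kronecker_quiver n) V f"
  shows "findim (V v)" "kvs.subspace (V v)" "a < n \<Longrightarrow> linear_on (V 2) (f a)"
    "a < n \<Longrightarrow> x \<in> V 2 \<Longrightarrow> f a x \<in> V 1" "v \<noteq> 1 \<Longrightarrow> v \<noteq> 2 \<Longrightarrow> V v = {0}"
  using rep_findim[OF assms, of v] rep_subspace[OF assms, of v] rep_linear[OF assms, of a]
    rep_arrow[OF assms, of a x] rep_outside[OF assms, of v] by simp_all

lemma kmod_le: "W 1 \<subseteq> V 1 \<Longrightarrow> W 2 \<subseteq> V 2 \<Longrightarrow> representation (kronecker_quiver n) W f \<Longrightarrow>
    representation (kronecker_quiver n) V g \<Longrightarrow> W \<le> V"
  unfolding le_fun_def using kronecker_repD(5) by (metis subset_refl)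

lemma kmod_eqI: "W 1 = V 1 \<Longrightarrow> W 2 = V 2 \<Longrightarrow> representation (kronecker_quiver n) W f \<Longrightarrow>
    representation (kronecker_quiver n) V g \<Longrightarrow> W = V"
  by (rule antisym) (auto intro: kmod_le)

lemma summands_subset:
  fixes A B :: "'k::field vect set"
  assumes "0 \<in> A" "0 \<in> B"
  shows "A \<subseteq> {x + y | x y. x \<in> A \<and> y \<in> B}" "B \<subseteq> {x + y | x y. x \<in> A \<and> y \<in> B}"
proof -
  show "A \<subseteq> {x + y | x y. x \<in> A \<and> y \<in> B}"
  proof
    fix x assume "x \<in> A"
    then have "x = x + 0 \<and> x \<in> A \<and> 0 \<in> B" using assms by simp
    then show "x \<in> {x + y | x y. x \<in> A \<and> y \<in> B}" by blast
  qed
  show "B \<subseteq> {x + y | x y. x \<in> A \<and> y \<in> B}"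
  proof
    fix x assume "x \<in> B"
    then have "x = 0 + x \<and> 0 \<in> A \<and> x \<in> B" using assms by simp
    then show "x \<in> {x + y | x y. x \<in> A \<and> y \<in> B}" by blast
  qed
qed

text \<open>The form in which indecomposability is used below: decompositions of the two vertex
  spaces that the arrows respect.\<close>

lemma kronecker_split:
  assumes "indecomposable (kronecker_quiver n) X f"
    and 1: "kvs.subspace A1" "kvs.subspace B1" "A1 \<inter> B1 = {0}" "X 1 = {x + y | x y. x \<in> A1 \<and> y \<in> B1}"
    and 2: "kvs.subspace A2" "kvs.subspace B2" "A2 \<inter> B2 = {0}" "X 2 = {x + y | x y. x \<in> A2 \<and> y \<in> B2}"
    and f: "\<And>a x. a < n \<Longrightarrow> x \<in> A2 \<Longrightarrow> f a x \<in> A1" "\<And>a x. a < n \<Longrightarrow> x \<in> B2 \<Longrightarrow> f a x \<in> B1"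
  shows "A1 = {0} \<and> A2 = {0} \<or> B1 = {0} \<and> B2 = {0}"
proof -
  let ?Q = "kronecker_quiver n"
  note X = indecomposable_rep[OF assms(1)]
  have s: "A1 \<subseteq> X 1" "B1 \<subseteq> X 1" "A2 \<subseteq> X 2" "B2 \<subseteq> X 2"
    unfolding 1(4) 2(4)
    using summands_subset[OF kvs.subspace_0[OF 1(1)] kvs.subspace_0[OF 1(2)]]
      summands_subset[OF kvs.subspace_0[OF 2(1)] kvs.subspace_0[OF 2(2)]] by blast+
  have m: "submodule ?Q X f (kmod C D)"
    if "kvs.subspace C" "kvs.subspace D" "C \<subseteq> X 1" "D \<subseteq> X 2" "\<And>a x. a < n \<Longrightarrow> x \<in> D \<Longrightarrow> f a x \<in> C" for C D
  proof (rule submoduleI[OF X])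
    show "kvs.subspace (kmod C D v)" for v using that by (simp add: kmod_def)
    show "kmod C D v \<subseteq> X v" for v using that rep_0[OF X, of v] by (auto simp: kmod_def)
  qed (use that in auto)
  have "direct_sum ?Q X (kmod A1 A2) (kmod B1 B2)"
    unfolding direct_sum_def using 1(3,4) 2(3,4) by simp
  then have "kmod A1 A2 = zero_module \<or> kmod B1 B2 = zero_module"
    using assms(1) m[OF 1(1) 2(1) s(1,3) f(1)] m[OF 1(2) 2(2) s(2,4) f(2)]
    unfolding indecomposable_def by blast
  then show ?thesis unfolding zero_module_iff by (metis kmod_simps(1,3))
qed

lemma trivial_sum: "S = {x + y | x y. x \<in> S \<and> y \<in> {0 :: 'k::field vect}}"
  "S = {x + y | x y. x \<in> {0 :: 'k::field vect} \<and> y \<in> S}"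
  by simp_all

text \<open>A complement in \<open>X 1\<close> of the span of all arrow images would split off as a
  semisimple summand with zero top.\<close>

lemma kronecker_generated:
  fixes X :: "nat \<Rightarrow> 'k::field vect set"
  assumes "indecomposable (kronecker_quiver n) X f" "X 2 \<noteq> {0}"
  shows "X 1 = kvs.span (\<Union>a<n. f a ` X 2)"
proof -
  note X = kronecker_repD[OF indecomposable_rep[OF assms(1)]]
  let ?G = "kvs.span (\<Union>a<n. f a ` X 2)"
  have G: "?G \<subseteq> X 1" by (rule kvs.span_minimal) (use X in auto)
  obtain H where H: "kvs.subspace H" "?G \<inter> H = {0}" "X 1 = {x + y | x y. x \<in> ?G \<and> y \<in> H}"
    by (rule complement_exists[OF X(1)[of 1] kvs.subspace_span G]) blast
  have "?G = {0} \<and> X 2 = {0} \<or> H = {0} \<and> {0} = {0 :: 'k vect}"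
  proof (rule kronecker_split[OF assms(1) kvs.subspace_span H X(2) kvs.subspace_single_0])
    show "X 2 \<inter> {0} = {0}" using kvs.subspace_0[OF X(2)[of 2]] by blast
    show "X 2 = {x + y |x y. x \<in> X 2 \<and> y \<in> {0}}" by (rule trivial_sum)
    show "f a x \<in> ?G" if "a < n" "x \<in> X 2" for a x using that by (intro kvs.span_base) blast
    show "f a x \<in> H" if "a < n" "x \<in> {0}" for a x
      using that linear_on_0[OF X(3) kvs.subspace_0[OF X(2)]] kvs.subspace_0[OF H(1)] by simp
  qed
  then show ?thesis using assms(2) H(3) by simp
qed

text \<open>A vector killed by all arrows spans a direct summand of dimension vector (0, 1), for
  which \<open>X 1\<close> leaves no room.\<close>

lemma kronecker_no_kernel:
  fixes X :: "nat \<Rightarrow> 'k::field vect set"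
  assumes "indecomposable (kronecker_quiver n) X f" "X 1 \<noteq> {0}" "y \<in> X 2" "\<And>a. a < n \<Longrightarrow> f a y = 0"
  shows "y = 0"
proof -
  note X = kronecker_repD[OF indecomposable_rep[OF assms(1)]]
  let ?L = "kvs.span {y}"
  have L: "?L \<subseteq> X 2" by (rule kvs.span_minimal) (use X assms(3) in auto)
  obtain H where H: "kvs.subspace H" "?L \<inter> H = {0}" "X 2 = {x + y | x y. x \<in> ?L \<and> y \<in> H}" "H \<subseteq> X 2"
    by (rule complement_exists[OF X(1)[of 2] kvs.subspace_span L]) blast
  have "{0} = {0 :: 'k vect} \<and> ?L = {0} \<or> X 1 = {0} \<and> H = {0}"
  proof (rule kronecker_split[OF assms(1) kvs.subspace_single_0 X(2) _ _ kvs.subspace_span H(1-3)])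
    show "{0} \<inter> X 1 = {0}" using kvs.subspace_0[OF X(2)[of 1]] by blast
    show "X 1 = {x + y |x y. x \<in> {0} \<and> y \<in> X 1}" by (rule trivial_sum)
    show "f a x \<in> {0}" if a: "a < n" "x \<in> ?L" for a x
    proof -
      obtain c where "x = kscale c y" using a(2) by (auto simp: kvs.span_singleton)
      then show ?thesis using linear_onD(2)[OF X(3)[OF a(1)] assms(3)] assms(4)[OF a(1)] by simp
    qed
    show "f a x \<in> X 1" if "a < n" "x \<in> H" for a x using that X(4) H(4) by blast
  qed
  then have "?L = {0}" using assms(2) by blast
  then show ?thesis using kvs.span_base[of y "{y}"] by simp
qed

text \<open>If one of the two spaces vanishes, no arrow acts, and every splitting of the other space
  is a splitting of modules; so that space is a line.\<close>

lemma kronecker_semisimple_length: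
  fixes X :: "nat \<Rightarrow> 'k::field vect set"
  assumes "indecomposable (kronecker_quiver n) X f" "X 1 = {0} \<or> X 2 = {0}"
  shows "module_length (kronecker_quiver n) X = 1"
proof -
  note X = kronecker_repD[OF indecomposable_rep[OF assms(1)]]
  have f0: "f a 0 = 0" if "a < n" for a using linear_on_0[OF X(3)[OF that] kvs.subspace_0[OF X(2)]] .
  have line: "kvs.dim V = 1" if V: "findim V" "V \<noteq> {0}"
    and sp: "\<And>L H. kvs.subspace L \<Longrightarrow> kvs.subspace H \<Longrightarrow> L \<inter> H = {0} \<Longrightarrow>
      V = {x + y | x y. x \<in> L \<and> y \<in> H} \<Longrightarrow> L = {0} \<or> H = {0}" for V :: "'k vect set"
  proof -
    obtain x where x: "x \<in> V" "x \<noteq> 0" using V findim_0 by blast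
    have L: "kvs.span {x} \<subseteq> V" by (rule kvs.span_minimal) (use x findim_subspace[OF V(1)] in auto)
    obtain H where H: "kvs.subspace H" "kvs.span {x} \<inter> H = {0}" "V = {x' + y | x' y. x' \<in> kvs.span {x} \<and> y \<in> H}"
      by (rule complement_exists[OF V(1) kvs.subspace_span L]) blast
    have "kvs.span {x} \<noteq> {0}" using x(2) kvs.span_base[of x "{x}"] by auto
    then have "H = {0}" using sp[OF kvs.subspace_span H] by blast
    then have "V = kvs.span {x}" using H(3) by simp
    then show ?thesis using kvs.dim_span_eq_card_independent[of "{x}"] x(2) by simp
  qed
  have nz: "X 1 \<noteq> {0} \<or> X 2 \<noteq> {0}"
  proof (rule ccontr)
    assume "\<not> ?thesis"
    then have "X v = {0}" for v using X(5)[of v] by blast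
    then show False using indecomposable_nonzero[OF assms(1)] by (simp add: zero_module_iff)
  qed
  have z: "{0} \<inter> {0} = {0 :: 'k vect}" "{0} = {x + y | x y. x \<in> {0} \<and> y \<in> {0 :: 'k vect}}" by auto
  show ?thesis
  proof (cases "X 1 = {0}")
    case True
    have "L = {0} \<or> H = {0}" if "kvs.subspace L" "kvs.subspace H" "L \<inter> H = {0}"
      "X 2 = {x + y | x y. x \<in> L \<and> y \<in> H}" for L H
    proof -
      have z': "X 1 = {x + y | x y. x \<in> {0} \<and> y \<in> {0 :: 'k vect}}" by (rule trans[OF True z(2)])
      have "L \<subseteq> X 2" "H \<subseteq> X 2"
        unfolding that(4)
        using summands_subset[OF kvs.subspace_0[OF that(1)] kvs.subspace_0[OF that(2)]] .
      then have "\<And>a x. a < n \<Longrightarrow> x \<in> L \<Longrightarrow> f a x \<in> {0}" "\<And>a x. a < n \<Longrightarrow> x \<in> H \<Longrightarrow> f a x \<in> {0}"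
        using X(4) True by blast+
      then have "{0} = {0 :: 'k vect} \<and> L = {0} \<or> {0} = {0 :: 'k vect} \<and> H = {0}"
        by (rule kronecker_split[OF assms(1) kvs.subspace_single_0 kvs.subspace_single_0 z(1) z' that])
      then show ?thesis by blast
    qed
    then have "kvs.dim (X 2) = 1" using line[OF X(1)[of 2]] nz True by blast
    then show ?thesis unfolding kronecker_length True dim_zero by simp
  next
    case False
    then have z': "X 2 = {x + y | x y. x \<in> {0} \<and> y \<in> {0 :: 'k vect}}" 
      using assms(2) by (intro trans[OF _ z(2)]) blast
    have "L = {0} \<or> H = {0}" if LH: "kvs.subspace L" "kvs.subspace H" "L \<inter> H = {0}"
      "X 1 = {x + y | x y. x \<in> L \<and> y \<in> H}" for L H
    proof -
      have "L = {0} \<and> {0} = {0 :: 'k vect} \<or> H = {0} \<and> {0} = {0 :: 'k vect}"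
      proof (rule kronecker_split[OF assms(1) LH kvs.subspace_single_0 kvs.subspace_single_0 z(1) z'])
        show "f a x \<in> L" "f a x \<in> H" if "a < n" "x \<in> {0}" for a x
          using that f0[OF that(1)] kvs.subspace_0[OF LH(1)] kvs.subspace_0[OF LH(2)] by simp_all
      qed
      then show ?thesis by blast
    qed
    then have "kvs.dim (X 1) = 1" using line[OF X(1)[of 1] False] by blast
    moreover have "X 2 = {0}" using assms(2) False by blast
    ultimately show ?thesis unfolding kronecker_length by simp
  qed
qed

text \<open>Indecomposables with the same nonzero top have the same socle part, by
  \<open>kronecker_generated\<close>, and would coincide; with zero top both have length 1. Along a
  chain the top dimension can thus be bounded from below by counting members.\<close>

lemma kronecker_top_increases:
  assumes "indecomposable (kronecker_quiver n) X f" "indecomposable (kronecker_quiver n) Y f" "X < Y"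
  shows "kvs.dim (X 2) < kvs.dim (Y 2)"
proof (rule ccontr)
  assume n: "\<not> kvs.dim (X 2) < kvs.dim (Y 2)"
  note X = indecomposable_rep[OF assms(1)] and Y = indecomposable_rep[OF assms(2)]
  have "X 2 \<subseteq> Y 2" using assms(3) by (auto simp: less_fun_def le_fun_def)
  then have eq: "X 2 = Y 2"
    using findim_dim_eq[OF kronecker_repD(1)[OF Y] kronecker_repD(2)[OF X]] n by simp
  show False
  proof (cases "X 2 = {0}")
    case True
    then have "module_length (kronecker_quiver n) X = module_length (kronecker_quiver n) Y"
      using kronecker_semisimple_length[OF assms(1)] kronecker_semisimple_length[OF assms(2)] eq by simp
    then show False using length_strict_mono[OF _ Y X assms(3)] by simp
  next
    case False
    then have "X 1 = Y 1"
      using kronecker_generated[OF assms(1)] kronecker_generated[OF assms(2)] eq by simp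
    then have "X = Y" using kmod_eqI[OF _ eq X Y] by blast
    then show False using assms(3) by simp
  qed
qed

lemma length_one_indecomposable:
  assumes "finite (verts Q)" "representation Q V f" "module_length Q V = 1"
  shows "indecomposable Q V f"
  unfolding indecomposable_def
proof (intro conjI allI impI)
  show "V \<noteq> zero_module" using assms(3) by auto
  fix A B assume *: "submodule Q V f A \<and> submodule Q V f B \<and> direct_sum Q V A B"
  then have "module_length Q A + module_length Q B = 1" using direct_sum_length(1)[OF assms(2)] assms(3) by metis
  then have "module_length Q A = 0 \<or> module_length Q B = 0" by linarith
  then show "A = zero_module \<or> B = zero_module"
    using length_pos[OF assms(1)] * submodule_rep by (metis less_numeral_extra(3))
qed (use assms in auto)

lemma chain_less:
  assumes "finite (verts Q)" "indec_chain Q V f \<W>" "U \<in> \<W>" "W \<in> \<W>" "module_length Q U < module_length Q W"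
  shows "U < W"
proof -
  have r: "representation Q U f" "representation Q W f" and le: "U \<le> W \<or> W \<le> U"
    using assms(2-4) submodule_rep unfolding indec_chain_def by blast+
  have "\<not> W \<le> U" using length_mono[OF assms(1) r] assms(5) by auto
  then show ?thesis using le by auto
qed

section \<open>The sets \<open>odd_measure m\<close> and the initial segments of sets above
  them\<close>

section \<open>The measures in question\<close>

definition odd_measure :: "nat \<Rightarrow> nat set" where
  "odd_measure m = {1} \<union> {2 * i | i. 1 \<le> i \<and> i \<le> m} \<union> {2 * m + 1}"

lemma odd_measure_iff: "x \<in> odd_measure m \<longleftrightarrow> x = 1 \<or> x = 2 * m + 1 \<or> (even x \<and> 2 \<le> x \<and> x \<le> 2 * m)"
  by (auto simp: odd_measure_def elim!: evenE)

lemma odd_measure_decreasing: "m < m' \<Longrightarrow> 1 \<le> m \<Longrightarrow> gr_less (odd_measure m') (odd_measure m)"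
  unfolding gr_less_iff by (rule exI[of _ "2 * m + 1"]) (auto simp: odd_measure_iff)

lemma odd_measure_inj: "odd_measure m = odd_measure m' \<Longrightarrow> m = m'"
proof -
  assume eq: "odd_measure m = odd_measure m'"
  have "2 * m + 1 \<in> odd_measure m" "2 * m' + 1 \<in> odd_measure m'" by (simp_all add: odd_measure_iff)
  then have "2 * m + 1 \<in> odd_measure m'" "2 * m' + 1 \<in> odd_measure m" using eq by simp_all
  then have "m = 0 \<or> m = m'" "m' = 0 \<or> m' = m" unfolding odd_measure_iff by simp_all
  then show "m = m'" by auto
qed

text \<open>If \<open>J\<close> first differs from \<open>odd_measure m\<close> below 2 m + 1, it
  does so by a new element. All positive even numbers there are already present, so this element is
  an odd 2 j + 1 with 1 \<le> j < m, and \<open>J\<close> begins like \<open>odd_measure j\<close>.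
  In every case the initial segment has gaps of at most two.\<close>

lemma gr_above_odd_measureD:
  assumes "gr_le (odd_measure m) J" "1 \<le> m" "0 \<notin> J"
  obtains j where "1 \<le> j" "j \<le> m" "\<And>i. i \<le> 2 * j + 1 \<Longrightarrow> i \<in> J \<longleftrightarrow> i \<in> odd_measure j"
proof -
  consider "J = odd_measure m" | d where "d \<in> J" "d \<notin> odd_measure m" "\<forall>i<d. i \<in> odd_measure m \<longleftrightarrow> i \<in> J"
    using assms(1) unfolding gr_le_def gr_less_iff by blast
  then show ?thesis
  proof cases
    case 1
    then show ?thesis using that[of m] assms(2) by simp
  next
    case 2
    show ?thesis
    proof (cases "d > 2 * m + 1")
      case True
      then show ?thesis using that[of m] assms(2) 2(3) by simp
    next
      case False
      have "d \<noteq> 0" using 2(1) assms(3) by metis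
      moreover have "d \<noteq> 1" "d \<noteq> 2 * m + 1" using 2(2) by (auto simp: odd_measure_iff)
      ultimately have "2 \<le> d" "d < 2 * m + 1" using False by linarith+
      then have "odd d" "d \<noteq> 1" "d < 2 * m + 1" using 2(2) by (auto simp: odd_measure_iff)
      then obtain j where j: "d = 2 * j + 1" "1 \<le> j" "j < m" by (auto elim!: oddE)
      have "i \<in> J \<longleftrightarrow> i \<in> odd_measure j" if "i \<le> 2 * j + 1" for i
      proof (cases "i = d")
        case True
        then show ?thesis using 2(1) j by (simp add: odd_measure_iff)
      next
        case False
        then have "i < d" using that j by simp
        then have "i \<in> J \<longleftrightarrow> i \<in> odd_measure m" using 2(3) by blast
        then show ?thesis using \<open>i < d\<close> j by (auto simp: odd_measure_iff)
      qed
      then show ?thesis using that[of j] j by simp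
    qed
  qed
qed

lemma gr_above_odd_measureI:
  assumes "1 \<le> j" "j \<le> m" shows "gr_le (odd_measure m) (odd_measure j)"
  using odd_measure_decreasing[of j m] assms by (cases "j = m") (auto simp: gr_le_def)

section \<open>Standard finite-dimensional coordinate spaces\<close>

section \<open>Coordinate spaces\<close>

definition coord_space :: "nat \<Rightarrow> 'k::field vect set" where
  "coord_space k = {x. \<forall>i\<ge>k. x i = 0}"

definition unit_vec :: "nat \<Rightarrow> 'k::field vect" where
  "unit_vec i = (\<lambda>j. if j = i then 1 else 0)"

lemma unit_vec_apply: "unit_vec i j = (if j = i then 1 else 0)"
  by (simp add: unit_vec_def)

lemma unit_vec_nonzero: "unit_vec i \<noteq> (0 :: 'k::field vect)"
  by (metis unit_vec_apply zero_fun_apply zero_neq_one)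

lemma unit_vec_in: "i < k \<Longrightarrow> unit_vec i \<in> coord_space k"
  by (auto simp: coord_space_def unit_vec_apply)

lemma sum_vect_apply: "(\<Sum>i\<in>I. (x i :: 'k::field vect)) j = (\<Sum>i\<in>I. x i j)"
  by (induction I rule: infinite_finite_induct) auto

lemma coord_expansion:
  assumes "x \<in> coord_space k" shows "x = (\<Sum>i<k. kscale (x i) (unit_vec i))"
proof
  fix j
  have "(\<Sum>i<k. kscale (x i) (unit_vec i)) j = (\<Sum>i<k. if i = j then x i else 0)"
    unfolding sum_vect_apply by (intro sum.cong) (auto simp: kscale_apply unit_vec_apply)
  also have "\<dots> = x j" using assms by (simp add: coord_space_def not_less)
  finally show "x j = (\<Sum>i<k. kscale (x i) (unit_vec i)) j" by simp
qed

lemma coord_space_subspace: "kvs.subspace (coord_space k)"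
  by (rule kvs.subspaceI) (auto simp: coord_space_def kscale_apply)

lemma coord_space_span: "(coord_space k :: 'k::field vect set) = kvs.span (unit_vec ` {..<k})"
proof (intro subset_antisym subsetI)
  fix x :: "'k vect" assume "x \<in> coord_space k"
  then have "x = (\<Sum>i<k. kscale (x i) (unit_vec i))" by (rule coord_expansion)
  moreover have "(\<Sum>i<k. kscale (x i) (unit_vec i)) \<in> kvs.span (unit_vec ` {..<k})"
    by (intro kvs.span_sum kvs.span_scale kvs.span_base) auto
  ultimately show "x \<in> kvs.span (unit_vec ` {..<k})" by metis
next
  fix x :: "'k vect" assume "x \<in> kvs.span (unit_vec ` {..<k})"
  moreover have "kvs.span (unit_vec ` {..<k}) \<subseteq> (coord_space k :: 'k vect set)"
    by (rule kvs.span_minimal) (auto simp: unit_vec_in coord_space_subspace)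
  ultimately show "x \<in> coord_space k" by blast
qed

lemma findim_coord_space: "findim (coord_space k)"
  unfolding coord_space_span by (rule findim_span) simp

lemma coord_space_0: "coord_space 0 = {0}"
  by (auto simp: coord_space_def)

lemma coord_space_mono: "i \<le> j \<Longrightarrow> coord_space i \<subseteq> coord_space j"
  by (auto simp: coord_space_def)

lemma dim_coord_space [simp]: "kvs.dim (coord_space k :: 'k::field vect set) = k"
proof (induction k)
  case 0
  show ?case unfolding coord_space_0 by simp
next
  case (Suc k)
  let ?S = "coord_space (Suc k) :: 'k vect set"
  have lin: "linear_on ?S (\<lambda>x. kscale (x k) (unit_vec 0))"
    unfolding linear_on_def by (auto simp: kscale_apply kvs.scale_left_distrib)
  have "{x \<in> ?S. kscale (x k) (unit_vec 0) = 0} = coord_space k"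
  proof -
    have "kscale (x k) (unit_vec 0) = 0 \<longleftrightarrow> x k = 0" for x :: "'k vect"
      using unit_vec_nonzero[of 0, where 'k='k] by (simp del: zero_fun_apply)
    then have "{x \<in> ?S. kscale (x k) (unit_vec 0) = 0} = {x \<in> ?S. x k = 0}" by simp
    also have "\<dots> = coord_space k"
    proof (intro subset_antisym subsetI)
      fix x :: "'k vect" assume x: "x \<in> {x \<in> ?S. x k = 0}"
      have "x i = 0" if "k \<le> i" for i
        using x that by (cases "i = k") (auto simp: coord_space_def)
      then show "x \<in> coord_space k" by (simp add: coord_space_def)
    next
      fix x :: "'k vect" assume "x \<in> coord_space k"
      then show "x \<in> {x \<in> ?S. x k = 0}" by (simp add: coord_space_def)
    qed
    finally show ?thesis .
  qed
  moreover have "(\<lambda>x. kscale (x k) (unit_vec 0)) ` ?S = kvs.span {unit_vec 0}"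
  proof
    show "(\<lambda>x. kscale (x k) (unit_vec 0)) ` ?S \<subseteq> kvs.span {unit_vec 0}"
      by (auto intro: kvs.span_scale kvs.span_base)
    show "kvs.span {unit_vec 0} \<subseteq> (\<lambda>x. kscale (x k) (unit_vec 0)) ` ?S"
    proof
      fix y :: "'k vect" assume "y \<in> kvs.span {unit_vec 0}"
      then obtain c where c: "y = kscale c (unit_vec 0)" by (auto simp: kvs.span_singleton)
      have "kscale c (unit_vec k) \<in> ?S" by (intro kvs.subspace_scale coord_space_subspace unit_vec_in) simp
      moreover have "kscale c (unit_vec k) k = c" by (simp add: kscale_apply unit_vec_apply)
      ultimately show "y \<in> (\<lambda>x. kscale (x k) (unit_vec 0)) ` ?S"
        unfolding c by (metis (mono_tags, lifting) image_eqI)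
    qed
  qed
  moreover have "kvs.dim (kvs.span {unit_vec 0 :: 'k vect}) = 1"
    using kvs.dim_span_eq_card_independent[of "{unit_vec 0 :: 'k vect}"] unit_vec_nonzero[of 0, where 'k='k] by simp
  ultimately show ?case using rank_nullity[OF findim_coord_space lin] Suc by simp
qed


section \<open>Modules realising the measures \<open>odd_measure m\<close>\<close>

section \<open>The indecomposable Kronecker module of dimension vector (m, m + 1)\<close>

text \<open>The preinjective module of the 2-Kronecker quiver, with all further arrows acting by
  zero: the first two arrows drop the last and the first of m + 1 coordinates.\<close>

definition shift_map :: "nat \<Rightarrow> nat \<Rightarrow> 'k::field vect \<Rightarrow> 'k vect" where
  "shift_map m a u = (if a = 0 then (\<lambda>j. if j < m then u j else 0)
     else if a = 1 then (\<lambda>j. if j < m then u (Suc j) else 0) else 0)"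

abbreviation "shift_module m \<equiv> kmod (coord_space m) (coord_space (Suc m))"

lemma shift_map_0_apply: "shift_map m 0 u j = (if j < m then u j else 0)"
  and shift_map_1_apply: "shift_map m 1 u j = (if j < m then u (Suc j) else 0)"
  by (simp_all add: shift_map_def)

lemma shift_map_linear: "linear_on U (shift_map m a)"
  unfolding linear_on_def by (auto simp: shift_map_def kscale_def)

lemma shift_map_in: "shift_map m a u \<in> coord_space m"
  by (auto simp: shift_map_def coord_space_def)

lemma shift_module_rep: "representation (kronecker_quiver n) (shift_module m) (shift_map m)"
  by (rule kronecker_repI) (auto intro: findim_coord_space shift_map_linear shift_map_in)

text \<open>For a submodule with more top than socle, both arrows have a one-dimensional kernel on the top
  \<open>U\<close> and the same image \<open>A\<close>; climbing from the first unit vector, all of them lie in \<open>U\<close>.\<close>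

lemma shift_module_top_heavy:
  fixes W :: "nat \<Rightarrow> 'k::field vect set"
  assumes "2 \<le> n" "submodule (kronecker_quiver n) (shift_module m) (shift_map m) W"
    "kvs.dim (W 1) < kvs.dim (W 2)"
  shows "W = shift_module m"
proof -
  let ?U = "W 2" and ?A = "W 1" and ?f = "shift_map m :: nat \<Rightarrow> 'k vect \<Rightarrow> _"
  note W = kronecker_repD[OF submodule_rep[OF assms(2)]]
  have le: "W v \<subseteq> shift_module m v" for v using submodule_le[OF assms(2)] by (simp add: le_fun_def)
  have U: "?U \<subseteq> coord_space (Suc m)" and A: "?A \<subseteq> coord_space m" using le[of 2] le[of 1] by simp_all
  have key: "unit_vec i \<in> ?U \<and> ?f a ` ?U = ?A"
    if a: "a < n" and k: "\<And>u. u \<in> ?U \<Longrightarrow> ?f a u = 0 \<Longrightarrow> u \<in> kvs.span {unit_vec i}" for a i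
  proof -
    let ?K = "{u \<in> ?U. ?f a u = 0}"
    have sub: "?f a ` ?U \<subseteq> ?A" using W(4)[OF a] by blast
    note fi = findim_image[OF W(1)[of 2] W(3)[OF a]]
    have d: "kvs.dim ?U = kvs.dim ?K + kvs.dim (?f a ` ?U)" using rank_nullity[OF W(1)[of 2] W(3)[OF a]] .
    have d2: "kvs.dim (?f a ` ?U) \<le> kvs.dim ?A" using findim_sub(2)[OF W(1) findim_subspace[OF fi] sub] .
    note sK = subspace_kernel_on[OF W(3)[OF a] W(2)[of 2]]
    have K: "?K \<subseteq> kvs.span {unit_vec i}" using k by blast
    have d1: "kvs.dim (kvs.span {unit_vec i :: 'k vect}) = 1"
      using kvs.dim_span_eq_card_independent[of "{unit_vec i :: 'k vect}"] unit_vec_nonzero[of i, where 'k='k] by simp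
    have "kvs.dim ?K \<le> 1"
      using findim_sub(2)[OF findim_span[of "{unit_vec i}"] sK K] d1 by simp
    then have "kvs.dim ?K = 1" "kvs.dim (?f a ` ?U) = kvs.dim ?A" using d d2 assms(3) by linarith+
    then have "?K = kvs.span {unit_vec i}" "?f a ` ?U = ?A"
      using findim_dim_eq[OF findim_span[of "{unit_vec i}"] sK K] d1
        findim_dim_eq[OF W(1) findim_subspace[OF fi] sub] by simp_all
    then show ?thesis using kvs.span_base[of "unit_vec i" "{unit_vec i}"] by blast
  qed
  have "unit_vec m \<in> ?U \<and> ?f 0 ` ?U = ?A"
  proof (rule key)
    fix u assume u: "u \<in> ?U" "?f 0 u = 0"
    have "u j = kscale (u m) (unit_vec m) j" for j
    proof -
      consider "j < m" | "j = m" | "j > m" by linarith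
      then show ?thesis
      proof cases
        case 1
        then have "u j = ?f 0 u j" by (simp add: shift_map_0_apply)
        then show ?thesis using u(2) 1 by (simp add: kscale_apply unit_vec_apply)
      next
        case 3
        then have "u j = 0" using u(1) U by (auto simp: coord_space_def)
        then show ?thesis using 3 by (simp add: kscale_apply unit_vec_apply)
      qed (simp add: kscale_apply unit_vec_apply)
    qed
    then have "u = kscale (u m) (unit_vec m)" by blast
    then show "u \<in> kvs.span {unit_vec m}" unfolding kvs.span_singleton by blast
  qed (use assms(1) in simp)
  moreover have "unit_vec 0 \<in> ?U \<and> ?f 1 ` ?U = ?A"
  proof (rule key)
    fix u assume u: "u \<in> ?U" "?f 1 u = 0"
    have "u j = kscale (u 0) (unit_vec 0) j" for j
    proof (cases j)
      case (Suc i)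
      have "u (Suc i) = 0"
      proof (cases "i < m")
        case True
        then have "u (Suc i) = ?f 1 u i" by (simp only: shift_map_1_apply if_True)
        then show ?thesis using u(2) by simp
      next
        case False
        then show ?thesis using u(1) U by (auto simp: coord_space_def)
      qed
      then show ?thesis using Suc by (simp add: kscale_apply unit_vec_apply)
    qed (simp add: kscale_apply unit_vec_apply)
    then have "u = kscale (u 0) (unit_vec 0)" by blast
    then show "u \<in> kvs.span {unit_vec 0}" unfolding kvs.span_singleton by blast
  qed (use assms(1) in simp)
  ultimately have e0: "unit_vec 0 \<in> ?U" and im: "?f 0 ` ?U = ?A" "?f 1 ` ?U = ?A" by blast+
  have e: "unit_vec i \<in> ?U" if "i \<le> m" for i
    using that
  proof (induction i)
    case 0
    then show ?case using e0 by simp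
  next
    case (Suc i)
    have "?f 0 (unit_vec i) = unit_vec i"
      using Suc(2) by (auto simp: shift_map_0_apply unit_vec_apply)
    then have "unit_vec i \<in> ?f 1 ` ?U" using im Suc by (metis Suc_leD imageI)
    then obtain u where u: "u \<in> ?U" "?f 1 u = unit_vec i" by (metis imageE)
    \<comment> \<open>A preimage of \<open>unit_vec i\<close> under arrow 1 is determined up to the
      kernel line of \<open>unit_vec 0\<close>; subtracting that component leaves
      \<open>unit_vec (Suc i)\<close>.\<close>
    have "u j - kscale (u 0) (unit_vec 0) j = unit_vec (Suc i) j" for j
    proof (cases j)
      case (Suc l)
      show ?thesis
      proof (cases "l < m")
        case True
        then have "u (Suc l) = ?f 1 u l" by (simp only: shift_map_1_apply if_True)
        then show ?thesis using u(2) Suc by (simp add: kscale_apply unit_vec_apply)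
      next
        case False
        then have "u (Suc l) = 0" using u(1) U by (auto simp: coord_space_def)
        then show ?thesis using Suc Suc.prems False by (simp add: kscale_apply unit_vec_apply)
      qed
    qed (simp add: kscale_apply unit_vec_apply)
    then have "u - kscale (u 0) (unit_vec 0) = unit_vec (Suc i)" by (intro ext) simp
    moreover have "u - kscale (u 0) (unit_vec 0) \<in> ?U"
      using kvs.subspace_diff[OF W(2) u(1) kvs.subspace_scale[OF W(2) e0]] .
    ultimately show ?case by simp
  qed
  have U': "?U = coord_space (Suc m)"
  proof (rule subset_antisym[OF U])
    show "coord_space (Suc m) \<subseteq> ?U"
      unfolding coord_space_span by (rule kvs.span_minimal) (use e W(2) in auto)
  qed
  have A': "?A = coord_space m"
  proof (rule subset_antisym[OF A])
    show "coord_space m \<subseteq> ?A"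
    proof
      fix x :: "'k vect" assume x: "x \<in> coord_space m"
      then have "?f 0 x = x" by (intro ext) (simp add: shift_map_0_apply coord_space_def)
      moreover have "x \<in> ?U" unfolding U' using x coord_space_mono[of m "Suc m"] by auto
      ultimately show "x \<in> ?A" using W(4)[of 0 x] assms(1) by simp
    qed
  qed
  show ?thesis
    by (rule kmod_eqI[OF _ _ submodule_rep[OF assms(2)] shift_module_rep]) (use A' U' in simp_all)
qed

text \<open>The top exceeds the socle by one, so some summand has more top than socle, and
  \<open>shift_module_top_heavy\<close> makes that summand the whole module.\<close>

lemma shift_module_indecomposable:
  assumes "2 \<le> n"
  shows "indecomposable (kronecker_quiver n) (shift_module m) (shift_map m :: nat \<Rightarrow> 'k::field vect \<Rightarrow> _)"
  unfolding indecomposable_def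
proof (intro conjI allI impI)
  let ?Q = "kronecker_quiver n" and ?V = "shift_module m :: nat \<Rightarrow> 'k vect set"
  show V: "representation ?Q ?V (shift_map m)" by (rule shift_module_rep)
  have "kvs.dim (?V 2) = Suc m" by simp
  then show "?V \<noteq> zero_module" by (metis dim_zero nat.distinct(1) zero_module_iff)
  fix A B assume "submodule ?Q ?V (shift_map m) A \<and> submodule ?Q ?V (shift_map m) B \<and> direct_sum ?Q ?V A B"
  then have AB: "submodule ?Q ?V (shift_map m) A" "submodule ?Q ?V (shift_map m) B" "direct_sum ?Q ?V A B"
    by blast+
  have "kvs.dim (A 1) + kvs.dim (B 1) = m" "kvs.dim (A 2) + kvs.dim (B 2) = Suc m"
    using direct_sum_length(2)[OF V AB, of 1] direct_sum_length(2)[OF V AB, of 2] by simp_all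
  then have "kvs.dim (A 1) < kvs.dim (A 2) \<or> kvs.dim (B 1) < kvs.dim (B 2)" by linarith
  then have "A = ?V \<or> B = ?V"
    using shift_module_top_heavy[OF assms AB(1)] shift_module_top_heavy[OF assms AB(2)] by blast
  then show "A = zero_module \<or> B = zero_module"
    using direct_sum_proper[OF V AB] direct_sum_proper[OF V AB(2,1) direct_sum_commute[OF AB(3)]] by blast
qed

lemma shift_submodule:
  assumes "j \<le> m"
  shows "submodule (kronecker_quiver n) (shift_module m) (shift_map m) (kmod (coord_space j) (coord_space j))"
proof (rule submoduleI[OF shift_module_rep])
  show "kvs.subspace (kmod (coord_space j) (coord_space j) v)" for v
    by (simp add: kmod_def coord_space_subspace)
  show "kmod (coord_space j) (coord_space j) v \<subseteq> shift_module m v" for v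
    using assms by (simp add: kmod_def coord_space_mono)
  show "shift_map m a x \<in> kmod (coord_space j) (coord_space j) (head (kronecker_quiver n) a)"
    if "x \<in> kmod (coord_space j) (coord_space j) (tail (kronecker_quiver n) a)" for a x
  proof -
    have "\<forall>i\<ge>j. x i = 0" using that by (simp add: coord_space_def)
    then have "shift_map m a x i = 0" if "j \<le> i" for i using that by (simp add: shift_map_def)
    then show ?thesis by (simp add: coord_space_def)
  qed
qed

text \<open>Arrow 1 acts on coordinates as a nilpotent Jordan block. Applying it lowers the last
  nonzero coordinate until a nonzero multiple of \<open>unit_vec 0\<close> is left.\<close>

lemma shift_invariant_unit_vec:
  assumes "kvs.subspace S" "\<And>x. x \<in> S \<Longrightarrow> shift_map m 1 x \<in> S" "x \<in> S" "x \<noteq> 0" "x \<in> coord_space (Suc d)" "d \<le> m"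
  shows "unit_vec 0 \<in> S"
  using assms(3-6)
proof (induction d arbitrary: x)
  case 0
  have "x = kscale (x 0) (unit_vec 0)"
    by (rule trans[OF coord_expansion[OF 0(3)]]) simp
  then have "x 0 \<noteq> 0" using 0(2) by (metis kvs.scale_zero_left)
  then have "unit_vec 0 = kscale (inverse (x 0)) x"
    using arg_cong[OF \<open>x = _\<close>, of "kscale (inverse (x 0))"] by simp
  then show ?case using kvs.subspace_scale[OF assms(1) 0(1)] by simp
next
  case (Suc d)
  show ?case
  proof (cases "x (Suc d) = 0")
    case True
    have "x \<in> coord_space (Suc d)"
      unfolding coord_space_def
    proof (intro CollectI allI impI)
      fix i assume "Suc d \<le> i"
      then show "x i = 0" using True Suc.prems(3) by (cases "i = Suc d") (auto simp: coord_space_def)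
    qed
    then show ?thesis using Suc by simp
  next
    case False
    have "shift_map m 1 x d = x (Suc d)" using Suc.prems(4) by (simp add: shift_map_def)
    then have "shift_map m 1 x \<noteq> 0" using False by (metis zero_fun_apply)
    moreover have "shift_map m 1 x \<in> coord_space (Suc d)"
      using Suc.prems(3) by (simp add: shift_map_def coord_space_def)
    ultimately show ?thesis using Suc.prems(4) by (intro Suc.IH[OF assms(2)[OF Suc.prems(1)]]) (assumption | simp)+
  qed
qed

text \<open>On this submodule arrow 0 is the identity, which forces the two spaces of a summand to
  coincide by dimension count. Summands are then subspaces invariant under a single Jordan block,
  and two nonzero ones share \<open>unit_vec 0\<close>.\<close>

lemma shift_submodule_indecomposable:
  assumes "2 \<le> n" "1 \<le> j" "j \<le> m"
  shows "indecomposable (kronecker_quiver n) (kmod (coord_space j) (coord_space j)) (shift_map m :: nat \<Rightarrow> 'k::field vect \<Rightarrow> _)"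
  unfolding indecomposable_def
proof (intro conjI allI impI)
  let ?Q = "kronecker_quiver n" and ?V = "kmod (coord_space j) (coord_space j) :: nat \<Rightarrow> 'k vect set"
  let ?f = "shift_map m :: nat \<Rightarrow> 'k vect \<Rightarrow> _"
  show V: "representation ?Q ?V ?f" using submodule_rep[OF shift_submodule[OF assms(3)]] .
  have "kvs.dim (?V 2) \<noteq> 0" using assms by simp
  then show "?V \<noteq> zero_module" by (metis dim_zero zero_module_iff)
  fix A B assume "submodule ?Q ?V ?f A \<and> submodule ?Q ?V ?f B \<and> direct_sum ?Q ?V A B"
  then have AB: "submodule ?Q ?V ?f A" "submodule ?Q ?V ?f B" "direct_sum ?Q ?V A B"
    by blast+
  have incl: "C 2 \<subseteq> C 1 \<and> kvs.dim (C 2) \<le> kvs.dim (C 1)" if C: "submodule ?Q ?V ?f C" for C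
  proof -
    note r = kronecker_repD[OF submodule_rep[OF C]]
    have "C 2 \<subseteq> C 1"
    proof
      fix x assume x: "x \<in> C 2"
      then have "x \<in> coord_space j" using submodule_le[OF C] by (auto simp: le_fun_def dest!: spec[of _ 2])
      then have "?f 0 x = x" using assms(3) by (intro ext) (simp add: shift_map_0_apply coord_space_def)
      then show "x \<in> C 1" using r(4)[of 0 x] x assms(1) by simp
    qed
    then show ?thesis using findim_sub(2)[OF r(1) r(2)] by blast
  qed
  have d: "kvs.dim (A 1) + kvs.dim (B 1) = j" "kvs.dim (A 2) + kvs.dim (B 2) = j"
    using direct_sum_length(2)[OF V AB, of 1] direct_sum_length(2)[OF V AB, of 2] by simp_all
  have eq: "C 2 = C 1" if C: "submodule ?Q ?V ?f C" and "kvs.dim (C 1) \<le> kvs.dim (C 2)" for C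
    using findim_dim_eq[OF kronecker_repD(1)[OF submodule_rep[OF C]] kronecker_repD(2)[OF submodule_rep[OF C]]]
      incl[OF C] that(2) by blast
  have A: "A 2 = A 1" and B: "B 2 = B 1"
    using eq[OF AB(1)] eq[OF AB(2)] incl[OF AB(1)] incl[OF AB(2)] d by linarith+
  have e0: "unit_vec 0 \<in> C 1" if C: "submodule ?Q ?V ?f C" "C 2 = C 1" "C \<noteq> zero_module" for C
  proof -
    note r = kronecker_repD[OF submodule_rep[OF C(1)]]
    have "C 1 \<noteq> {0}"
    proof
      assume *: "C 1 = {0}"
      have "C v = {0}" for v using r(5)[of v] * C(2) by (cases "v = 1"; cases "v = 2") auto
      then show False using C(3) by (simp add: zero_module_iff)
    qed
    then obtain x where x: "x \<in> C 1" "x \<noteq> 0" using kvs.subspace_0[OF r(2)[of 1]] by blast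
    have "x \<in> coord_space j" using x(1) submodule_le[OF C(1)] by (auto simp: le_fun_def dest!: spec[of _ 1])
    then have xj: "x \<in> coord_space (Suc (j - 1))" using assms(2) by simp
    have inv: "shift_map m 1 y \<in> C 1" if "y \<in> C 1" for y using r(4)[of 1 y] that C(2) assms(1) by simp
    show ?thesis
      by (rule shift_invariant_unit_vec[OF r(2) inv x xj]) (use assms in simp_all)
  qed
  show "A = zero_module \<or> B = zero_module"
  proof (rule ccontr)
    assume "\<not> ?thesis"
    then have "unit_vec 0 \<in> A 1 \<inter> B 1" using e0[OF AB(1) A] e0[OF AB(2) B] by blast
    then show False using direct_sum_all(2)[OF V AB] unit_vec_nonzero[of 0, where 'k='k] by blast
  qed
qed

text \<open>The submodules of dimension vectors (1, 0), (1, 1), ..., (m, m), (m, m + 1) form a chain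
  with the required lengths. A larger measure would first gain an odd length 2 j + 1 with j < m;
  counting tops shows that such a member has more top than socle, so it is the whole module, which
  is too long.\<close>

lemma gr_measure_shift_module:
  assumes "2 \<le> n" "1 \<le> m"
  shows "gr_measure (kronecker_quiver n) (shift_module m) (shift_map m :: nat \<Rightarrow> 'k::field vect \<Rightarrow> _) = odd_measure m"
proof (rule gr_le_antisym)
  let ?Q = "kronecker_quiver n" and ?V = "shift_module m :: nat \<Rightarrow> 'k vect set"
  let ?f = "shift_map m :: nat \<Rightarrow> 'k vect \<Rightarrow> _"
  let ?l = "module_length ?Q :: (nat \<Rightarrow> 'k vect set) \<Rightarrow> nat"
  have V: "representation ?Q ?V ?f" by (rule shift_module_rep)
  have fin: "finite (verts ?Q)" by simp
  have lV: "?l ?V = 2 * m + 1" by (simp add: kronecker_length)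
  let ?S = "kmod (coord_space 1) {0} :: nat \<Rightarrow> 'k vect set"
  let ?X = "\<lambda>j. kmod (coord_space j) (coord_space j) :: nat \<Rightarrow> 'k vect set"
  have S: "submodule ?Q ?V ?f ?S"
  proof (rule submoduleI[OF V])
    show "kvs.subspace (?S v)" for v by (simp add: kmod_def coord_space_subspace)
    show "?S v \<subseteq> ?V v" for v
      using assms by (simp add: kmod_def coord_space_mono findim_0[OF findim_coord_space])
    show "?f a x \<in> ?S (head ?Q a)" if "x \<in> ?S (tail ?Q a)" for a x
    proof -
      have "\<forall>i. x i = 0" using that by simp
      then have "shift_map m a x i = 0" for i by (simp add: shift_map_def)
      then show ?thesis by (simp add: coord_space_def)
    qed
  qed
  have lS: "?l ?S = 1" unfolding kronecker_length kmod_simps(1,3) by simp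
  have SX: "?S \<le> ?X j" if "1 \<le> j" for j
    using that by (simp add: le_fun_def kmod_def coord_space_mono findim_0[OF findim_coord_space])
  have XX: "?X i \<le> ?X j" if "i \<le> j" for i j
    using that by (simp add: le_fun_def kmod_def coord_space_mono)
  let ?W = "{?S} \<union> ?X ` {1..m} \<union> {?V}"
  have "indec_chain ?Q ?V ?f ?W"
    unfolding indec_chain_def
  proof (intro conjI ballI)
    show "finite ?W" by simp
    fix W assume W: "W \<in> ?W"
    show sub: "submodule ?Q ?V ?f W" using W S shift_submodule submodule_refl[OF V] by auto
    show "indecomposable ?Q W ?f"
      using W length_one_indecomposable[OF fin submodule_rep[OF S] lS] shift_submodule_indecomposable[OF assms(1)]
        shift_module_indecomposable[OF assms(1)] by auto
    fix W' assume W': "W' \<in> ?W"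
    have "submodule ?Q ?V ?f W'" using W' S shift_submodule submodule_refl[OF V] by auto
    then have "W \<le> ?V" "W' \<le> ?V" using sub submodule_le by blast+
    then consider "W = ?V \<or> W' = ?V" | "W = ?S \<or> W' = ?S" "W \<in> {?S} \<union> ?X ` {1..m}" "W' \<in> {?S} \<union> ?X ` {1..m}"
      | i j where "W = ?X i" "W' = ?X j"
      using W W' by blast
    then show "W \<le> W' \<or> W' \<le> W"
    proof cases
      case 1
      then show ?thesis using \<open>W \<le> ?V\<close> \<open>W' \<le> ?V\<close> by blast
    next
      case 2
      have "?S \<le> U" if "U \<in> {?S} \<union> ?X ` {1..m}" for U using that SX by auto
      then show ?thesis using 2 by blast
    next
      case 3
      then show ?thesis using XX[of i j] XX[of j i] by (cases "i \<le> j") auto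
    qed
  qed
  then have "?l ` ?W \<in> chain_length_sets ?Q ?V ?f" by (rule chain_length_setsI)
  moreover have "?l ` ?W = odd_measure m"
  proof -
    have "?l (?X j) = 2 * j" for j by (simp add: kronecker_length)
    then have "?l ` ?W = {1} \<union> (\<lambda>j. 2 * j) ` {1..m} \<union> {2 * m + 1}"
      unfolding image_Un image_image using lS lV by simp
    also have "\<dots> = odd_measure m" unfolding odd_measure_def by auto
    finally show ?thesis .
  qed
  ultimately show "gr_le (odd_measure m) (gr_measure ?Q ?V ?f)"
    using gr_measure_max(2)[OF fin V] by metis
  show "gr_le (gr_measure ?Q ?V ?f) (odd_measure m)"
    unfolding gr_le_iff_not_less
  proof
    assume "gr_less (odd_measure m) (gr_measure ?Q ?V ?f)"
    then obtain d where d: "d \<in> gr_measure ?Q ?V ?f" "d \<notin> odd_measure m"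
        "\<forall>i<d. i \<in> odd_measure m \<longleftrightarrow> i \<in> gr_measure ?Q ?V ?f"
      by (auto simp: gr_less_iff)
    obtain \<W> where W: "indec_chain ?Q ?V ?f \<W>" "gr_measure ?Q ?V ?f = ?l ` \<W>"
      using gr_measure_max(1)[OF fin V] unfolding chain_length_sets_iff by blast
    have r: "submodule ?Q ?V ?f U" "indecomposable ?Q U ?f" if "U \<in> \<W>" for U
      using W(1) that unfolding indec_chain_def by blast+
    obtain Z where Z: "Z \<in> \<W>" "?l Z = d" using d(1) W(2) by auto
    have "0 < d" using length_pos[OF fin indecomposable_rep[OF r(2)[OF Z(1)]] indecomposable_nonzero[OF r(2)[OF Z(1)]]] Z(2)
      by simp
    moreover have "d \<le> 2 * m + 1"
      using length_mono[OF fin V submodule_rep[OF r(1)[OF Z(1)]] submodule_le[OF r(1)[OF Z(1)]]] lV Z(2) by simp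
    moreover have "d \<noteq> 1" "d \<noteq> 2 * m + 1" using d(2) by (auto simp: odd_measure_iff)
    ultimately have "2 \<le> d" "d < 2 * m + 1" by linarith+
    then have "odd d" using d(2) by (auto simp: odd_measure_iff)
    then obtain j where j: "d = 2 * j + 1" by (auto elim!: oddE)
    have inW: "\<exists>U\<in>\<W>. ?l U = i" if "i \<in> odd_measure m" "i < d" for i
    proof -
      have "i \<in> ?l ` \<W>" using d(3) that W(2) by simp
      then show ?thesis by auto
    qed
    \<comment> \<open>Each step of the chain 1, 2, 4, ... enlarges the top by at least one. The
      member of length 1 starts the count, so length 2 already has top at least 1.\<close>
    have top: "i \<le> kvs.dim (U 2)" if "1 \<le> i" "i \<le> j" "U \<in> \<W>" "?l U = 2 * i" for i U
      using that
    proof (induction i arbitrary: U rule: nat_induct_at_least)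
      case base
      obtain U' where U': "U' \<in> \<W>" "?l U' = 1" using inW[of 1] \<open>2 \<le> d\<close> by (auto simp: odd_measure_iff)
      then have "U' < U" using chain_less[OF fin W(1) U'(1) base(2)] base(3) by simp
      then show ?case using kronecker_top_increases[OF r(2)[OF U'(1)] r(2)[OF base(2)]] by simp
    next
      case (Suc i)
      have "2 * i \<in> odd_measure m" using Suc(1,3) j \<open>d < 2 * m + 1\<close> by (simp add: odd_measure_iff)
      then obtain U' where U': "U' \<in> \<W>" "?l U' = 2 * i" using inW[of "2 * i"] Suc(3) j by auto
      then have "U' < U" using chain_less[OF fin W(1) U'(1) Suc(4)] Suc(5) by simp
      then have "kvs.dim (U' 2) < kvs.dim (U 2)"
        using kronecker_top_increases[OF r(2)[OF U'(1)] r(2)[OF Suc(4)]] by simp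
      then show ?case using Suc(2)[OF _ U'] Suc(3) by simp
    qed
    have "1 \<le> j" using j \<open>2 \<le> d\<close> by simp
    have "2 * j \<in> odd_measure m" using \<open>1 \<le> j\<close> j \<open>d < 2 * m + 1\<close> by (simp add: odd_measure_iff)
    then obtain U where U: "U \<in> \<W>" "?l U = 2 * j" using inW[of "2 * j"] j by auto
    have "U < Z" using chain_less[OF fin W(1) U(1) Z(1)] U(2) Z(2) j by simp
    then have "j < kvs.dim (Z 2)"
      using kronecker_top_increases[OF r(2)[OF U(1)] r(2)[OF Z(1)]] top[OF \<open>1 \<le> j\<close> _ U] by simp
    then have "kvs.dim (Z 1) < kvs.dim (Z 2)" using Z(2) j by (simp add: kronecker_length)
    then have "Z = ?V" using shift_module_top_heavy[OF assms(1) r(1)[OF Z(1)]] by simp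
    then show False using Z(2) lV \<open>d < 2 * m + 1\<close> by simp
  qed
qed

section \<open>Linear dependence, underdetermined systems, eigenvectors over an algebraically closed
  field\<close>

section \<open>Linear systems and eigenvectors\<close>

lemma dependent_family:
  fixes v :: "'i \<Rightarrow> 'k::field vect"
  assumes "finite I" "findim V" "\<And>i. i \<in> I \<Longrightarrow> v i \<in> V" "kvs.dim V < card I"
  shows "\<exists>c. (\<exists>i\<in>I. c i \<noteq> 0) \<and> (\<Sum>i\<in>I. kscale (c i) (v i)) = 0"
proof (cases "inj_on v I")
  case True
  have "kvs.dependent (v ` I)"
  proof (rule ccontr)
    assume "\<not> kvs.dependent (v ` I)"
    then have "card (v ` I) \<le> kvs.dim V" using assms(3) by (intro subspace_span_card(2)[OF assms(2)]) auto
    then show False using card_image[OF True] assms(4) by simp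
  qed
  then obtain u where u: "\<exists>x\<in>v ` I. u x \<noteq> 0" "(\<Sum>x\<in>v ` I. kscale (u x) x) = 0"
    unfolding kvs.dependent_finite[OF finite_imageI[OF assms(1)]] by blast
  have "(\<Sum>i\<in>I. kscale (u (v i)) (v i)) = 0"
    using u(2) unfolding sum.reindex[OF True] comp_def .
  then show ?thesis using u(1) by (intro exI[of _ "\<lambda>i. u (v i)"]) blast
next
  case False
  \<comment> \<open>A repeated vector gives a relation of the family that the set of its values does
    not show.\<close>
  then obtain i j where ij: "i \<in> I" "j \<in> I" "i \<noteq> j" "v i = v j" by (auto simp: inj_on_def)
  let ?c = "\<lambda>k. if k = i then 1 else if k = j then -1 else 0 :: 'k"
  have "(\<Sum>k\<in>I. kscale (?c k) (v k)) = (\<Sum>k\<in>{i, j}. kscale (?c k) (v k))"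
    using ij assms(1) by (intro sum.mono_neutral_right) auto
  also have "\<dots> = 0" using ij by simp
  finally show ?thesis using ij(1) by (intro exI[of _ ?c]) auto
qed

lemma homogeneous_system:
  fixes A :: "'i \<Rightarrow> 'j \<Rightarrow> 'k::field"
  assumes "finite I" "finite J" "card J < card I"
  obtains c where "\<exists>i\<in>I. c i \<noteq> 0" "\<And>j. j \<in> J \<Longrightarrow> (\<Sum>i\<in>I. c i * A i j) = 0"
proof -
  obtain h where h: "bij_betw h {0..<card J} J" using ex_bij_betw_nat_finite[OF assms(2)] by blast
  let ?v = "\<lambda>i k. if k < card J then A i (h k) else 0"
  have "kvs.dim (coord_space (card J) :: 'k vect set) < card I" using assms(3) by simp
  moreover have "?v i \<in> coord_space (card J)" for i by (simp add: coord_space_def)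
  ultimately have "\<exists>c. (\<exists>i\<in>I. c i \<noteq> 0) \<and> (\<Sum>i\<in>I. kscale (c i) (?v i)) = 0"
    by (intro dependent_family[OF assms(1) findim_coord_space])
  then obtain c where c: "\<exists>i\<in>I. c i \<noteq> 0" "(\<Sum>i\<in>I. kscale (c i) (?v i)) = 0" by blast
  have "(\<Sum>i\<in>I. c i * A i j) = 0" if "j \<in> J" for j
  proof -
    have "j \<in> h ` {0..<card J}" using that bij_betw_imp_surj_on[OF h] by simp
    then obtain k where k: "k < card J" "j = h k" by auto
    have "(\<Sum>i\<in>I. c i * A i j) = (\<Sum>i\<in>I. kscale (c i) (?v i)) k"
      unfolding sum_vect_apply using k by (simp add: kscale_apply)
    then show ?thesis using c(2) by simp
  qed
  then show ?thesis using that c(1) by blast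
qed

definition poly_act :: "('k::field vect \<Rightarrow> 'k vect) \<Rightarrow> 'k poly \<Rightarrow> 'k vect \<Rightarrow> 'k vect" where
  "poly_act T p x = (\<Sum>i\<le>degree p. kscale (coeff p i) ((T ^^ i) x))"

lemma poly_act_eq: "degree p \<le> k \<Longrightarrow> poly_act T p x = (\<Sum>i\<le>k. kscale (coeff p i) ((T ^^ i) x))"
  unfolding poly_act_def by (rule sum.mono_neutral_left) (auto simp: coeff_eq_0)

lemma funpow_in: "T ` X \<subseteq> X \<Longrightarrow> x \<in> X \<Longrightarrow> (T ^^ i) x \<in> X"
  by (induction i) auto

lemma poly_act_in:
  assumes "kvs.subspace X" "T ` X \<subseteq> X" "x \<in> X" shows "poly_act T p x \<in> X"
  unfolding poly_act_def
  by (intro kvs.subspace_sum[OF assms(1)] kvs.subspace_scale[OF assms(1)] funpow_in[OF assms(2,3)])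

lemma poly_act_linear_factor:
  assumes "kvs.subspace X" "linear_on X T" "T ` X \<subseteq> X" "x \<in> X"
  shows "poly_act T ([:- l, 1:] * p) x = T (poly_act T p x) - kscale l (poly_act T p x)"
proof -
  let ?y = "\<lambda>i. (T ^^ i) x"
  define k where "k = degree p"
  have y: "?y i \<in> X" for i using funpow_in[OF assms(3,4)] .
  have deg: "degree ([:- l, 1:] * p) \<le> Suc k" "degree p \<le> Suc k"
    using degree_mult_le[of "[:- l, 1:]" p] by (simp_all add: k_def)
  have co: "coeff ([:- l, 1:] * p) i = coeff (pCons 0 p) i - l * coeff p i" for i
    by (simp add: algebra_simps)
  have "poly_act T ([:- l, 1:] * p) x
      = (\<Sum>i\<le>Suc k. kscale (coeff (pCons 0 p) i) (?y i) - kscale l (kscale (coeff p i) (?y i)))"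
    unfolding poly_act_eq[OF deg(1)] co by (simp only: kvs.scale_left_diff_distrib kvs.scale_scale)
  also have "\<dots> = (\<Sum>i\<le>Suc k. kscale (coeff (pCons 0 p) i) (?y i)) - kscale l (poly_act T p x)"
    unfolding sum_subtractf kvs.scale_sum_right[symmetric] poly_act_eq[OF deg(2)] ..
  also have "(\<Sum>i\<le>Suc k. kscale (coeff (pCons 0 p) i) (?y i)) = (\<Sum>i\<le>k. T (kscale (coeff p i) (?y i)))"
    unfolding sum.atMost_Suc_shift using linear_onD(2)[OF assms(2) y] by simp
  also have "\<dots> = T (poly_act T p x)"
    unfolding poly_act_def k_def
    by (rule linear_on_sum[OF assms(2,1), symmetric]) (intro kvs.subspace_scale[OF assms(1)] y)
  finally show ?thesis .
qed

text \<open>The iterates of a vector x under \<open>T\<close> are dependent, so p(T) x = 0 for some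
  nonzero polynomial p. Linear factors are removed from p one at a time; the last value before the
  result becomes zero is an eigenvector.\<close>

lemma eigenvector_exists:
  fixes T :: "'k::alg_closed_field vect \<Rightarrow> 'k vect"
  assumes "findim X" "X \<noteq> {0}" "linear_on X T" "T ` X \<subseteq> X"
  shows "\<exists>x\<in>X. x \<noteq> 0 \<and> (\<exists>l. T x = kscale l x)"
proof -
  note sX = findim_subspace[OF assms(1)]
  have root: ?thesis if "p \<noteq> 0" "x \<in> X" "x \<noteq> 0" "poly_act T p x = 0" for p x
    using that
  proof (induction "degree p" arbitrary: p rule: less_induct)
    case less
    show ?case
    proof (cases "degree p = 0")
      case True
      then have "poly_act T p x = kscale (coeff p 0) x" by (simp add: poly_act_def)
      then have "coeff p 0 = 0" using less.prems by simp
      then show ?thesis using True less.prems(1) by (metis leading_coeff_0_iff)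
    next
      case False
      then obtain l where "poly p l = 0" using alg_closed_imp_poly_has_root[of p] by blast
      then obtain r where r: "p = [:- l, 1:] * r" by (meson dvdE poly_eq_0_iff_dvd)
      then have r0: "r \<noteq> 0" using less.prems(1) by auto
      then have "degree p = Suc (degree r)" unfolding r by (subst degree_mult_eq) auto
      show ?thesis
      proof (cases "poly_act T r x = 0")
        case True
        then show ?thesis using less.hyps[OF _ r0 less.prems(2,3)] \<open>degree p = _\<close> by simp
      next
        case False
        have "T (poly_act T r x) - kscale l (poly_act T r x) = 0"
          using poly_act_linear_factor[OF sX assms(3,4) less.prems(2)] less.prems(4) unfolding r by metis
        then have "T (poly_act T r x) = kscale l (poly_act T r x)" by simp
        then show ?thesis using poly_act_in[OF sX assms(4) less.prems(2)] False by blast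
      qed
    qed
  qed
  obtain x where x: "x \<in> X" "x \<noteq> 0" using assms(2) findim_0[OF assms(1)] by blast
  have "kvs.dim X < card {..kvs.dim X}" by simp
  then obtain c where c: "\<exists>i\<in>{..kvs.dim X}. c i \<noteq> 0" "(\<Sum>i\<le>kvs.dim X. kscale (c i) ((T ^^ i) x)) = 0"
    using dependent_family[OF finite_atMost assms(1), of "kvs.dim X" "\<lambda>i. (T ^^ i) x"]
      funpow_in[OF assms(4) x(1)] by blast
  let ?p = "\<Sum>i\<le>kvs.dim X. monom (c i) i"
  have co: "coeff ?p i = (if i \<le> kvs.dim X then c i else 0)" for i
    by (simp add: coeff_sum)
  have "degree ?p \<le> kvs.dim X" by (rule degree_le) (simp add: co)
  then have "poly_act T ?p x = 0" unfolding poly_act_eq[OF \<open>degree ?p \<le> _\<close>] co using c(2) by simp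
  moreover have "?p \<noteq> 0" using c(1) co by (metis atMost_iff coeff_0)
  ultimately show ?thesis using root x by blast
qed


section \<open>External direct sums inside the ambient space\<close>

section \<open>Interleaving coordinates\<close>

definition even_part :: "'k vect \<Rightarrow> 'k::field vect" where "even_part z = (\<lambda>i. z (2 * i))"
definition odd_part :: "'k vect \<Rightarrow> 'k::field vect" where "odd_part z = (\<lambda>i. z (2 * i + 1))"
definition interleave :: "'k vect \<Rightarrow> 'k vect \<Rightarrow> 'k::field vect" where
  "interleave x y = (\<lambda>i. if even i then x (i div 2) else y (i div 2))"

lemma parts_interleave [simp]: "even_part (interleave x y) = x" "odd_part (interleave x y) = y"
  by (auto simp: even_part_def odd_part_def interleave_def)

lemma interleave_parts: "interleave (even_part z) (odd_part z) = z"
  by (rule ext) (auto simp: even_part_def odd_part_def interleave_def elim!: evenE oddE)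

lemma even_part_linear: "linear_on U even_part" and odd_part_linear: "linear_on U odd_part"
  by (auto simp: linear_on_def even_part_def odd_part_def kscale_def)

lemma interleave_add: "interleave (x + x') (y + y') = interleave x y + interleave x' y'"
  by (auto simp: interleave_def)

lemma interleave_scale: "interleave (kscale c x) (kscale c y) = kscale c (interleave x y)"
  by (auto simp: interleave_def kscale_def)

lemma interleave_0: "interleave 0 0 = (0 :: 'k::field vect)"
  by (auto simp: interleave_def)

lemma parts_0 [simp]: "even_part (0 :: 'k::field vect) = 0" "odd_part (0 :: 'k vect) = 0"
  by (auto simp: even_part_def odd_part_def)

lemma parts_add: "even_part (x + y) = even_part x + even_part y" "odd_part (x + y) = odd_part x + odd_part y"
  and parts_scale: "even_part (kscale c x) = kscale c (even_part x)" "odd_part (kscale c x) = kscale c (odd_part x)"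
  by (auto simp: even_part_def odd_part_def kscale_def)

lemma interleave_linear: "linear_on U (\<lambda>x. interleave x 0)" "linear_on U (\<lambda>y. interleave 0 y)"
  by (auto simp: linear_on_def interleave_def kscale_def)

text \<open>The external direct sum of \<open>A\<close> and \<open>B\<close>: the even coordinates
  carry the first summand, the odd ones the second.\<close>

definition join :: "'k::field vect set \<Rightarrow> 'k vect set \<Rightarrow> 'k vect set" where
  "join A B = {z. even_part z \<in> A \<and> odd_part z \<in> B}"

lemma findim_join:
  assumes "findim A" "findim B" shows "findim (join A B)"
proof -
  obtain C where C: "finite C" "(\<lambda>x. interleave x 0) ` A = kvs.span C"
    using findim_image[OF assms(1) interleave_linear(1)] by (auto simp: findim_def)
  obtain D where D: "finite D" "(\<lambda>y. interleave 0 y) ` B = kvs.span D"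
    using findim_image[OF assms(2) interleave_linear(2)] by (auto simp: findim_def)
  have "join A B = {x + y | x y. x \<in> (\<lambda>x. interleave x 0) ` A \<and> y \<in> (\<lambda>y. interleave 0 y) ` B}"
  proof (intro subset_antisym subsetI)
    fix z assume z: "z \<in> join A B"
    have "z = interleave (even_part z) 0 + interleave 0 (odd_part z)"
      using interleave_add[of "even_part z" 0 0 "odd_part z"] by (simp add: interleave_parts)
    then show "z \<in> {x + y | x y. x \<in> (\<lambda>x. interleave x 0) ` A \<and> y \<in> (\<lambda>y. interleave 0 y) ` B}"
      using z unfolding join_def by blast
  next
    fix z assume "z \<in> {x + y | x y. x \<in> (\<lambda>x. interleave x 0) ` A \<and> y \<in> (\<lambda>y. interleave 0 y) ` B}"
    then obtain x y where "x \<in> A" "y \<in> B" "z = interleave x 0 + interleave 0 y" by blast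
    then show "z \<in> join A B" by (simp add: join_def parts_add)
  qed
  then have "join A B = kvs.span (C \<union> D)" unfolding kvs.span_Un C(2) D(2) .
  then show ?thesis using C(1) D(1) findim_span[of "C \<union> D"] by simp
qed


section \<open>Extensions of \<open>M\<close> by a sparse module of dimension vector (q + 1, 2
  q)\<close>

section \<open>Extensions without new small submodules\<close>

text \<open>Reading \<open>u\<close> as a pair \<open>(w\<^sub>1, w\<^sub>2)\<close> of polynomials in \<open>t\<close> of degree less than \<open>q\<close>, the first three
  arrows send \<open>u\<close> to \<open>t w\<^sub>1\<close>, \<open>w\<^sub>1 + t w\<^sub>2\<close> and \<open>w\<^sub>2\<close>. The images parametrise the relations
  \<open>c\<^sub>0 - t c\<^sub>1 + t\<^sup>2 c\<^sub>2 = 0\<close>, which is why the images of a nonzero \<open>u\<close> are not all proportional.\<close>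

definition syzygy_map :: "nat \<Rightarrow> nat \<Rightarrow> 'k::field vect \<Rightarrow> 'k vect" where
  "syzygy_map q a u = (\<lambda>j.
     if a = 0 then (if 1 \<le> j \<and> j \<le> q then u (j - 1) else 0)
     else if a = 1 then (if j < q then u j else 0) + (if 1 \<le> j \<and> j \<le> q then u (q + j - 1) else 0)
     else if a = 2 then (if j < q then u (q + j) else 0)
     else 0)"

lemma syzygy_map_linear: "linear_on U (syzygy_map q a)"
  by (auto simp: linear_on_def syzygy_map_def kscale_def algebra_simps)

lemma syzygy_map_0 [simp]: "syzygy_map q a 0 = (0 :: 'k::field vect)"
  by (auto simp: syzygy_map_def)

lemma syzygy_map_in: "syzygy_map q a u \<in> coord_space (Suc q)"
  by (auto simp: syzygy_map_def coord_space_def)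

text \<open>If the images were l0 w, l1 w, l2 w, the relation would read (l0 - l1 t + l2 t^2) w = 0
  for polynomials; hence all images vanish and u = 0. The proof carries this out on lowest
  coefficients.\<close>

lemma syzygy_map_not_proportional:
  assumes "u \<in> coord_space (2 * q)" "\<And>a. a < 3 \<Longrightarrow> \<exists>l. syzygy_map q a u = kscale l w"
  shows "u = 0"
proof (rule ccontr)
  assume "u \<noteq> 0"
  obtain l0 where l0: "syzygy_map q 0 u = kscale l0 w" using assms(2)[of 0] by auto
  obtain l1 where l1: "syzygy_map q 1 u = kscale l1 w" using assms(2)[of 1] by auto
  obtain l2 where l2: "syzygy_map q 2 u = kscale l2 w" using assms(2)[of 2] by auto
  have l: "syzygy_map q 0 u j = l0 * w j" "syzygy_map q 1 u j = l1 * w j"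
      "syzygy_map q 2 u j = l2 * w j" for j
    unfolding l0 l1 l2 by (simp_all add: kscale_apply)
  show False
  proof (cases "\<exists>j<q. u j \<noteq> 0")
    \<comment> \<open>Here the first polynomial is nonzero, with lowest degree d. Arrow 0 multiplies
      it by t, so \<open>w\<close> starts above degree d. But arrow 1 has coefficient
      \<open>u d\<close> in degree d, because the coefficient d - 1 of the second polynomial
      vanishes by arrow 2.\<close>
    case True
    define d where "d = (LEAST j. j < q \<and> u j \<noteq> 0)"
    have d: "d < q" "u d \<noteq> 0" using LeastI_ex[OF True] by (auto simp: d_def)
    have small: "u j = 0" if "j < d" for j using not_less_Least[of j "\<lambda>j. j < q \<and> u j \<noteq> 0"] that d by (auto simp: d_def)
    have "syzygy_map q 0 u (Suc d) = u d" using d by (simp add: syzygy_map_def)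
    then have "l0 \<noteq> 0" using l(1)[of "Suc d"] d(2) by auto
    have w: "w j = 0" if "j \<le> d" for j
    proof -
      have "u (j - 1) = 0" if "1 \<le> j" using small[of "j - 1"] that \<open>j \<le> d\<close> by simp
      then have "syzygy_map q 0 u j = 0" by (simp add: syzygy_map_def)
      then show ?thesis using l(1)[of j] \<open>l0 \<noteq> 0\<close> by simp
    qed
    have "u (q + d - 1) = 0" if "1 \<le> d"
    proof -
      have "syzygy_map q 2 u (d - 1) = u (q + (d - 1))" using d(1) that by (simp add: syzygy_map_def)
      then show ?thesis using l(3)[of "d - 1"] w[of "d - 1"] that by simp
    qed
    then have "syzygy_map q 1 u d = u d" using d(1) by (simp add: syzygy_map_def)
    then show False using l(2)[of d] w[of d] d(2) by simp
  next
    \<comment> \<open>The first polynomial is zero. Arrow 1 now gives t times the second one, so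
      \<open>w\<close> starts above its lowest degree, while arrow 2 returns that polynomial
      unchanged.\<close>
    case False
    have ex: "\<exists>j<q. u (q + j) \<noteq> 0"
    proof (rule ccontr)
      assume n: "\<not> (\<exists>j<q. u (q + j) \<noteq> 0)"
      have "u j = 0" for j
      proof -
        consider "j < q" | "q \<le> j" "j < 2 * q" | "2 * q \<le> j" by linarith
        then show ?thesis
        proof cases
          case 2
          then have "u (q + (j - q)) = 0" using n by (metis add_less_cancel_left le_add_diff_inverse mult_2)
          then show ?thesis using 2 by simp
        qed (use False assms(1) in \<open>auto simp: coord_space_def\<close>)
      qed
      then have "u = 0" by (intro ext) simp
      then show False using \<open>u \<noteq> 0\<close> by simp
    qed
    define d where "d = (LEAST j. j < q \<and> u (q + j) \<noteq> 0)"
    have d: "d < q" "u (q + d) \<noteq> 0" using LeastI_ex[OF ex] by (auto simp: d_def)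
    have small: "u (q + j) = 0" if "j < d" for j
      using not_less_Least[of j "\<lambda>j. j < q \<and> u (q + j) \<noteq> 0"] that d by (auto simp: d_def)
    have "syzygy_map q 1 u (Suc d) = u (q + d)" using d False by (simp add: syzygy_map_def)
    then have "l1 \<noteq> 0" using l(2)[of "Suc d"] d(2) by auto
    have "syzygy_map q 1 u d = 0"
    proof (cases d)
      case 0
      then show ?thesis using False d(1) by (simp add: syzygy_map_def)
    next
      case (Suc i)
      then show ?thesis using False d(1) small[of i] by (simp add: syzygy_map_def)
    qed
    then have "w d = 0" using l(2)[of d] \<open>l1 \<noteq> 0\<close> by simp
    moreover have "syzygy_map q 2 u d = u (q + d)" using d(1) by (simp add: syzygy_map_def)
    ultimately show False using l(3)[of d] d(2) by simp
  qed
qed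

definition ext_module :: "nat \<Rightarrow> (nat \<Rightarrow> 'k::field vect set) \<Rightarrow> nat \<Rightarrow> 'k vect set" where
  "ext_module q M = kmod (join (M 1) (coord_space (Suc q))) (join (M 2) (coord_space (2 * q)))"

text \<open>The extension belonging to an elementary cocycle: arrow \<open>a0\<close> sends the
  basis vector \<open>l0\<close> of the quotient top additionally to \<open>b\<close>, and all other
  entries between quotient and \<open>M\<close> are zero.\<close>

definition ext_map :: "nat \<Rightarrow> (nat \<Rightarrow> 'k::field vect \<Rightarrow> 'k vect) \<Rightarrow> nat \<Rightarrow> nat \<Rightarrow> 'k vect \<Rightarrow>
    nat \<Rightarrow> 'k vect \<Rightarrow> 'k vect" where
  "ext_map q f l0 a0 b a z =
     interleave (f a (even_part z) + (if a = a0 then kscale (odd_part z l0) b else 0)) (syzygy_map q a (odd_part z))"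

lemma ext_module_in: "z \<in> ext_module q M 1 \<longleftrightarrow> even_part z \<in> M 1 \<and> odd_part z \<in> coord_space (Suc q)"
  "z \<in> ext_module q M 2 \<longleftrightarrow> even_part z \<in> M 2 \<and> odd_part z \<in> coord_space (2 * q)"
  by (simp_all add: ext_module_def join_def del: One_nat_def)

lemma odd_part_ext_map: "odd_part (ext_map q f l0 a0 b a z) = syzygy_map q a (odd_part z)"
  by (simp add: ext_map_def)

lemma ext_module_rep:
  assumes "representation (kronecker_quiver n) M f" "b \<in> M 1"
  shows "representation (kronecker_quiver n) (ext_module q M) (ext_map q f l0 a0 b)"
  unfolding ext_module_def
proof (rule kronecker_repI)
  note M = kronecker_repD[OF assms(1)]
  show "findim (join (M 1) (coord_space (Suc q)))" "findim (join (M 2) (coord_space (2 * q)))"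
    by (intro findim_join M(1) findim_coord_space)+
  fix a assume a: "a < n"
  show "linear_on (join (M 2) (coord_space (2 * q))) (ext_map q f l0 a0 b a)"
    unfolding linear_on_def
  proof (intro conjI ballI allI)
    fix x y assume xy: "x \<in> join (M 2) (coord_space (2 * q))" "y \<in> join (M 2) (coord_space (2 * q))"
    have "f a (even_part x + even_part y) = f a (even_part x) + f a (even_part y)"
      using xy linear_onD(1)[OF M(3)[OF a]] by (simp add: join_def)
    then show "ext_map q f l0 a0 b a (x + y) = ext_map q f l0 a0 b a x + ext_map q f l0 a0 b a y"
      unfolding ext_map_def parts_add interleave_add[symmetric]
        linear_onD(1)[OF syzygy_map_linear[of UNIV] UNIV_I UNIV_I]
      by (simp add: kvs.scale_left_distrib algebra_simps)
  next
    fix c x assume x: "x \<in> join (M 2) (coord_space (2 * q))"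
    have "f a (kscale c (even_part x)) = kscale c (f a (even_part x))"
      using x linear_onD(2)[OF M(3)[OF a]] by (simp add: join_def)
    then show "ext_map q f l0 a0 b a (kscale c x) = kscale c (ext_map q f l0 a0 b a x)"
      unfolding ext_map_def parts_scale interleave_scale[symmetric]
        linear_onD(2)[OF syzygy_map_linear[of UNIV] UNIV_I]
      by (simp add: kvs.scale_right_distrib kscale_apply)
  qed
  fix z assume z: "z \<in> join (M 2) (coord_space (2 * q))"
  have "f a (even_part z) + (if a = a0 then kscale (odd_part z l0) b else 0) \<in> M 1"
    using M(4)[OF a, of "even_part z"] z kvs.subspace_scale[OF M(2) assms(2)] kvs.subspace_0[OF M(2)[of 1]]
    by (intro kvs.subspace_add M(2)) (simp_all add: join_def del: One_nat_def)
  then show "ext_map q f l0 a0 b a z \<in> join (M 1) (coord_space (Suc q))"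
    by (simp add: join_def ext_map_def syzygy_map_in)
qed

lemma ext_embedding:
  assumes "representation (kronecker_quiver n) M f"
  shows "hom (kronecker_quiver n) M f (ext_module q M) (ext_map q f l0 a0 b) (\<lambda>v x. interleave x 0)"
    and "injective M (\<lambda>v x. interleave x 0)"
proof -
  note M = kronecker_repD[OF assms]
  show "hom (kronecker_quiver n) M f (ext_module q M) (ext_map q f l0 a0 b) (\<lambda>v x. interleave x 0)"
  proof (rule homI)
    fix v x assume x: "x \<in> M v"
    consider "v = 1" | "v = 2" | "v \<noteq> 1" "v \<noteq> 2" by blast
    then show "interleave x 0 \<in> ext_module q M v"
    proof cases
      case 3
      then have "x = 0" using x M(5) by blast
      then show ?thesis using 3 by (simp add: ext_module_def interleave_0)
    next
      case 1
      then show ?thesis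
        using x kvs.subspace_0[OF coord_space_subspace] ext_module_in(1)[of "interleave x 0" q M] by simp
    next
      case 2
      then show ?thesis
        using x kvs.subspace_0[OF coord_space_subspace] ext_module_in(2)[of "interleave x 0" q M] by simp
    qed
  next
    fix a x
    show "interleave (f a x) 0 = ext_map q f l0 a0 b a (interleave x 0)"
      by (simp add: ext_map_def)
  qed (rule interleave_linear)
  show "injective M (\<lambda>v x. interleave x 0)"
    unfolding injective_def
  proof (intro allI ballI impI)
    fix v x assume "x \<in> M v" "interleave x 0 = 0"
    then have "even_part (interleave x 0) = even_part 0" by simp
    then show "x = 0" by simp
  qed
qed

text \<open>\<open>Y\<close> lies inside \<open>M\<close>. A top vector of \<open>Z\<close> outside
  \<open>M\<close> has nonzero image in the quotient, and there it generates at least one dimension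
  of top and two of socle, so \<open>Z\<close> would exceed \<open>Y\<close> by at least
  three.\<close>

lemma ext_step:
  assumes "3 \<le> n" "representation (kronecker_quiver n) (ext_module q M) (ext_map q f l0 a0 b)"
    and Z: "submodule (kronecker_quiver n) (ext_module q M) (ext_map q f l0 a0 b) Z"
    and Y: "representation (kronecker_quiver n) Y g" "Y \<le> Z"
      "\<And>v y. y \<in> Y v \<Longrightarrow> odd_part y = 0"
    and len: "module_length (kronecker_quiver n) Z \<le> module_length (kronecker_quiver n) Y + 2"
    and z: "z \<in> Z 2"
  shows "odd_part z = 0"
proof (rule ccontr)
  assume nz: "odd_part z \<noteq> 0"
  note Zr = kronecker_repD[OF submodule_rep[OF Z]]
  have le: "Z v \<subseteq> ext_module q M v" for v using submodule_le[OF Z] by (simp add: le_fun_def)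
  have fi: "findim (odd_part ` Z v)" for v using findim_image[OF Zr(1) odd_part_linear] .
  have dims: "kvs.dim (Y v) + kvs.dim (odd_part ` Z v) \<le> kvs.dim (Z v)" for v
  proof -
    let ?K = "{x \<in> Z v. odd_part x = 0}"
    have sK: "kvs.subspace ?K" using subspace_kernel_on[OF odd_part_linear Zr(2)] .
    have "Y v \<subseteq> ?K" using Y(2,3) by (auto simp: le_fun_def)
    then have "kvs.dim (Y v) \<le> kvs.dim ?K"
      using findim_sub(2)[OF findim_sub(1)[OF Zr(1) sK] kronecker_repD(2)[OF Y(1)]] by blast
    then show ?thesis using rank_nullity[OF Zr(1) odd_part_linear, of v] by simp
  qed
  have "odd_part ` Z 2 \<noteq> {0}" using nz z by blast
  then have "kvs.dim (odd_part ` Z 2) \<ge> 1" using dim_zero_iff[OF fi[of 2]] by simp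
  moreover have "kvs.dim (odd_part ` Z 1) \<ge> 2"
  proof (rule ccontr)
    assume "\<not> kvs.dim (odd_part ` Z 1) \<ge> 2"
    then obtain w where w: "odd_part ` Z 1 \<subseteq> kvs.span {w}"
      using dim_le_1_span[OF fi[of 1]] by (metis One_nat_def Suc_1 not_less_eq_eq)
    have "\<exists>l. syzygy_map q a (odd_part z) = kscale l w" if "a < 3" for a
    proof -
      have "ext_map q f l0 a0 b a z \<in> Z 1" using Zr(4)[OF _ z] that assms(1) by simp
      then have "syzygy_map q a (odd_part z) \<in> kvs.span {w}"
        using w odd_part_ext_map by (metis image_subset_iff)
      then show ?thesis by (auto simp: kvs.span_singleton)
    qed
    moreover have "odd_part z \<in> coord_space (2 * q)" using le[of 2] z ext_module_in(2) by blast
    ultimately show False using syzygy_map_not_proportional nz by blast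
  qed
  ultimately have "module_length (kronecker_quiver n) Z \<ge> module_length (kronecker_quiver n) Y + 3"
    using dims[of 1] dims[of 2] unfolding kronecker_length by linarith
  then show False using len by simp
qed

text \<open>Apart from length 1 an indecomposable has its socle part generated by its top, and the
  arrows keep \<open>M\<close> invariant. Length 1 is excluded because a simple submodule may sit
  anywhere in the socle of the extension.\<close>

lemma ext_indecomposable_in_base:
  assumes "indecomposable (kronecker_quiver n) Z (ext_map q f l0 a0 b)"
    "module_length (kronecker_quiver n) Z \<noteq> 1" "\<And>z. z \<in> Z 2 \<Longrightarrow> odd_part z = 0" "z \<in> Z v"
  shows "odd_part z = 0"
proof -
  note Z = kronecker_repD[OF indecomposable_rep[OF assms(1)]]
  have "Z 2 \<noteq> {0}" using kronecker_semisimple_length[OF assms(1)] assms(2) by blast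
  then have gen: "Z 1 = kvs.span (\<Union>a<n. ext_map q f l0 a0 b a ` Z 2)" using kronecker_generated[OF assms(1)] by blast
  have s: "kvs.subspace {z. odd_part z = 0}"
    using subspace_kernel_on[OF odd_part_linear kvs.subspace_UNIV] by simp
  have Z1: "Z 1 \<subseteq> {z. odd_part z = 0}"
    unfolding gen
  proof (rule kvs.span_minimal[OF _ s], rule subsetI)
    fix y assume "y \<in> (\<Union>a<n. ext_map q f l0 a0 b a ` Z 2)"
    then obtain a x where "x \<in> Z 2" "y = ext_map q f l0 a0 b a x" by blast
    then show "y \<in> {z. odd_part z = 0}" using assms(3)[of x] by (simp add: odd_part_ext_map)
  qed
  consider "v = 1" | "v = 2" | "v \<noteq> 1" "v \<noteq> 2" by blast
  then show ?thesis
  proof cases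
    case 3
    then have "z = 0" using Z(5) assms(4) by blast
    then show ?thesis by simp
  qed (use assms(3,4) Z1 in blast)+
qed

text \<open>A chain realising a measure at or above \<open>odd_measure m\<close> begins with lengths
  1, 2, 4, ..., 2 j, 2 j + 1. Steps of at most two cannot leave \<open>M\<close>, so this part of
  the chain already exists in \<open>M\<close>.\<close>

lemma ext_no_new_measure:
  assumes "3 \<le> n" "representation (kronecker_quiver n) M f" "b \<in> M 1" "1 \<le> m"
    and Z: "submodule (kronecker_quiver n) (ext_module q M) (ext_map q f l0 a0 b) Z"
      "indecomposable (kronecker_quiver n) Z (ext_map q f l0 a0 b)"
    and above: "gr_le (odd_measure m) (gr_measure (kronecker_quiver n) Z (ext_map q f l0 a0 b))"
  shows "gr_le (odd_measure m) (gr_measure (kronecker_quiver n) M f)"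
proof -
  let ?Q = "kronecker_quiver n" and ?g = "ext_map q f l0 a0 b" and ?N = "ext_module q M"
  let ?l = "module_length ?Q"
  have fin: "finite (verts ?Q)" by simp
  note M = kronecker_repD[OF assms(2)]
  have N: "representation ?Q ?N ?g" by (rule ext_module_rep[OF assms(2,3)])
  have emb: "hom ?Q M f ?N ?g (\<lambda>v x. interleave x 0)" by (rule ext_embedding(1)[OF assms(2)])
  obtain \<W> where W: "indec_chain ?Q Z ?g \<W>" "gr_measure ?Q Z ?g = ?l ` \<W>"
    using gr_measure_max(1)[OF fin submodule_rep[OF Z(1)]] unfolding chain_length_sets_iff by blast
  have r: "submodule ?Q ?N ?g U" "indecomposable ?Q U ?g" if "U \<in> \<W>" for U
    using W(1) that submodule_trans[OF Z(1)] unfolding indec_chain_def by blast+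
  have "0 < ?l U" if "U \<in> \<W>" for U
    using length_pos[OF fin indecomposable_rep[OF r(2)[OF that]] indecomposable_nonzero[OF r(2)[OF that]]] .
  then have n0: "0 \<notin> ?l ` \<W>" by fastforce
  then obtain j where j: "1 \<le> j" "j \<le> m" "\<And>i. i \<le> 2 * j + 1 \<Longrightarrow> i \<in> ?l ` \<W> \<longleftrightarrow> i \<in> odd_measure j"
    using gr_above_odd_measureD[OF above[unfolded W(2)] assms(4) n0] by blast
  define base where "base U \<longleftrightarrow> (\<forall>v. \<forall>z\<in>U v. odd_part z = 0)" for U :: "nat \<Rightarrow> 'a vect set"
  have step: "base U" if U: "U \<in> \<W>" "?l U \<noteq> 1" and Y: "representation ?Q Y ?g" "Y \<le> U" "base Y" "?l U \<le> ?l Y + 2"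
    for U Y
  proof -
    have "odd_part z = 0" if "z \<in> U 2" for z
      using ext_step[OF assms(1) N r(1)[OF U(1)] Y(1,2) _ Y(4) that] Y(3) unfolding base_def by blast
    then show ?thesis
      using ext_indecomposable_in_base[OF r(2)[OF U(1)] U(2)] unfolding base_def by blast
  qed
  have even_step: "base U" if "1 \<le> i" "i \<le> j" "U \<in> \<W>" "?l U = 2 * i" for i U
    using that
  proof (induction i arbitrary: U rule: nat_induct_at_least)
    \<comment> \<open>The induction starts from the zero module: a member of length 2 is itself too
      short to leave \<open>M\<close>.\<close>
    case base
    show ?case
    proof (rule step[OF base(2), of zero_module])
      show "representation ?Q zero_module ?g" "zero_module \<le> U"
        using zero_module_submodule[OF indecomposable_rep[OF r(2)[OF base(2)]]] submodule_rep submodule_le by blast+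
    qed (use base in \<open>simp_all add: base_def zero_module_def\<close>)
  next
    case (Suc i)
    have "2 * i \<in> ?l ` \<W>" using j(3)[of "2 * i"] Suc(1,3) by (simp add: odd_measure_iff)
    then obtain Y where Y: "Y \<in> \<W>" "?l Y = 2 * i" by auto
    have "Y < U" using chain_less[OF fin W(1) Y(1) Suc(4)] Y(2) Suc(5) by simp
    then show ?case
      using step[OF Suc(4) _ indecomposable_rep[OF r(2)[OF Y(1)]]] Suc(2)[OF _ Y] Suc(1,3,5) Y(2) by simp
  qed
  \<comment> \<open>Longer members may leave \<open>M\<close>. They are cut off, since the lengths
    up to 2 j + 1 already give \<open>odd_measure j\<close>.\<close>
  let ?W = "{U \<in> \<W>. ?l U \<le> 2 * j + 1}"
  have all: "base U" if U: "U \<in> ?W" for U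
  proof -
    have "?l U \<in> odd_measure j" using j(3)[of "?l U"] U by blast
    then consider "?l U = 1" | "?l U = 2 * j + 1" | i where "?l U = 2 * i" "1 \<le> i" "i \<le> j"
      unfolding odd_measure_iff by (auto elim!: evenE)
    then show ?thesis
    proof cases
      \<comment> \<open>The simple member escapes the argument on generation by the top, but it is
        contained in the member of length 2.\<close>
      case 1
      have "2 \<in> ?l ` \<W>" using j(3)[of 2] j(1) by (simp add: odd_measure_iff)
      then obtain Y where Y: "Y \<in> \<W>" "?l Y = 2 * 1" by auto
      have "U < Y" using chain_less[OF fin W(1) _ Y(1)] U 1 Y(2) by simp
      then show ?thesis
        using even_step[OF _ j(1) Y] unfolding base_def less_fun_def le_fun_def by blast
    next
      case 2
      have "2 * j \<in> ?l ` \<W>" using j(3)[of "2 * j"] j(1) by (simp add: odd_measure_iff)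
      then obtain Y where Y: "Y \<in> \<W>" "?l Y = 2 * j" by auto
      have "Y < U" using chain_less[OF fin W(1) Y(1)] U 2 Y(2) by simp
      then show ?thesis
        using step[OF _ _ indecomposable_rep[OF r(2)[OF Y(1)]]] even_step[OF j(1) _ Y] U 2 Y(2) j(1) by simp
    next
      case 3
      then show ?thesis using even_step[of i U] U by blast
    qed
  qed
  let ?J = "img (\<lambda>v x. interleave x 0) M"
  note J = img_submodule[OF assms(2) N emb]
  have in_J: "U \<le> ?J" if "U \<in> \<W>" "base U" for U
  proof (rule le_funI, rule subsetI)
    fix v z assume z: "z \<in> U v"
    have "z = interleave (even_part z) 0"
    proof -
      have "odd_part z = 0" using that(2) z unfolding base_def by blast
      then show ?thesis using interleave_parts[of z] by simp
    qed
    moreover have "even_part z \<in> M v"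
    proof -
      have zN: "z \<in> ?N v" using submodule_le[OF r(1)[OF that(1)]] z by (auto simp: le_fun_def)
      consider "v = 1" | "v = 2" | "v \<noteq> 1" "v \<noteq> 2" by blast
      then show ?thesis
      proof cases
        case 3
        then show ?thesis using zN M(5) by (simp add: ext_module_def)
      qed (use zN ext_module_in in blast)+
    qed
    ultimately show "z \<in> ?J v" unfolding img_def by blast
  qed
  have chain: "indec_chain ?Q ?J ?g ?W"
    unfolding indec_chain_def
  proof (intro conjI ballI)
    show "finite ?W" using W(1) unfolding indec_chain_def by simp
    fix U assume U: "U \<in> ?W"
    then have "U \<in> \<W>" by blast
    then show "submodule ?Q ?J ?g U" "indecomposable ?Q U ?g"
      using submodule_between[OF r(1) in_J[OF _ all[OF U]]] r(2) by blast+
    fix U' assume "U' \<in> ?W"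
    then show "U \<le> U' \<or> U' \<le> U" using W(1) \<open>U \<in> \<W>\<close> unfolding indec_chain_def by blast
  qed
  have "?l ` ?W = odd_measure j"
  proof (intro set_eqI iffI)
    fix i assume "i \<in> ?l ` ?W"
    then have "i \<in> ?l ` \<W>" "i \<le> 2 * j + 1" by auto
    then show "i \<in> odd_measure j" using j(3) by blast
  next
    fix i assume i: "i \<in> odd_measure j"
    then have "i \<le> 2 * j + 1" using j(1) by (auto simp: odd_measure_iff)
    then show "i \<in> ?l ` ?W" using i j(3)[of i] by auto
  qed
  then have 1: "odd_measure j \<in> chain_length_sets ?Q ?J ?g" using chain_length_setsI[OF chain] by simp
  have inv: "hom ?Q ?J ?g M f (\<lambda>v. even_part)"
  proof (rule homI)
    fix a x assume "x \<in> ?J (tail ?Q a)"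
    then have "odd_part x = 0" by (auto simp: img_def)
    then show "even_part (?g a x) = f a (even_part x)" by (simp add: ext_map_def)
  qed (auto simp: img_def even_part_linear)
  have inj: "injective ?J (\<lambda>v. even_part)"
    unfolding injective_def img_def by (auto simp: interleave_0)
  have "odd_measure j \<in> chain_length_sets ?Q M f"
    using chain_length_sets_img[OF submodule_rep[OF J] assms(2) inv inj 1]
      chain_length_sets_mono[OF img_submodule[OF submodule_rep[OF J] assms(2) inv]] by blast
  then have "gr_le (odd_measure j) (gr_measure ?Q M f)" using gr_measure_max(2)[OF fin assms(2)] by blast
  then show ?thesis using gr_above_odd_measureI[OF j(1,2)] gr_le_trans by blast
qed

lemma functional_zero_on_span:
  fixes \<psi> :: "'k::field vect \<Rightarrow> 'k"
  assumes "\<And>x y. x \<in> kvs.span B \<Longrightarrow> y \<in> kvs.span B \<Longrightarrow> \<psi> (x + y) = \<psi> x + \<psi> y"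
    "\<And>c x. x \<in> kvs.span B \<Longrightarrow> \<psi> (kscale c x) = c * \<psi> x" "\<And>x. x \<in> B \<Longrightarrow> \<psi> x = 0" "x \<in> kvs.span B"
  shows "\<psi> x = 0"
proof -
  have "x \<in> kvs.span B \<and> \<psi> x = 0"
    using assms(4)
  proof (induction rule: kvs.span_induct_alt)
    case base
    show ?case using assms(2)[OF kvs.span_zero, of 0] kvs.span_zero by (metis kvs.scale_zero_left mult_zero_left)
  next
    case (step c x y)
    have x: "x \<in> kvs.span B" using kvs.span_base[OF step(1)] .
    have cx: "kscale c x \<in> kvs.span B" using kvs.span_scale[OF x] .
    have y: "y \<in> kvs.span B" "\<psi> y = 0" using step(2) by blast+
    have "\<psi> (kscale c x + y) = 0"
      unfolding assms(1)[OF cx y(1)] assms(2)[OF x] assms(3)[OF step(1)] y(2) by simp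
    then show ?case using kvs.span_add[OF cx y(1)] by blast
  qed
  then show ?thesis ..
qed

text \<open>A retraction would express the class of the extension through \<open>2 q m\<^sub>2 + (q + 1) m\<^sub>1\<close> parameters;
  if there are fewer of these than the \<open>2 q n m\<^sub>1\<close> dimensions of cocycles, some functional on
  cocycles vanishes on all split classes.\<close>

lemma ext_nonsplit:
  fixes M :: "nat \<Rightarrow> 'k::field vect set"
  assumes M: "representation (kronecker_quiver n) M f"
    and dims: "2 * q * kvs.dim (M 2) + Suc q * kvs.dim (M 1) < 2 * q * n * kvs.dim (M 1)"
  obtains l0 a0 b where "b \<in> M 1"
    "\<And>r. hom (kronecker_quiver n) (ext_module q M) (ext_map q f l0 a0 b) M f r \<Longrightarrow>
      \<not> (\<forall>v. \<forall>x\<in>M v. r v (interleave x 0) = x)"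
proof -
  let ?Q = "kronecker_quiver n"
  note Md = kronecker_repD[OF M]
  obtain B1 where B1: "finite B1" "kvs.independent B1" "kvs.span B1 = M 1" "card B1 = kvs.dim (M 1)"
    using findim_basis[OF Md(1)] .
  obtain B2 where B2: "finite B2" "kvs.independent B2" "kvs.span B2 = M 2" "card B2 = kvs.dim (M 2)"
    using findim_basis[OF Md(1)] .
  let ?rep = "kvs.representation B1"
  let ?s = "\<lambda>l a j. syzygy_map q a (unit_vec l :: 'k vect) j"
  \<comment> \<open>Indices of the elementary cocycles: basis vector of the quotient top, arrow,
    basis vector of \<open>M 1\<close>. The index set \<open>?J\<close> below lists a basis of the
    maps that produce trivial cocycles, from quotient top to \<open>M 2\<close> and from quotient
    socle to \<open>M 1\<close>.\<close>
  let ?I = "{..<2 * q} \<times> {..<n} \<times> B1"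
  let ?J = "({..<2 * q} \<times> B2) <+> ({..<Suc q} \<times> B1)"
  \<comment> \<open>Coordinate \<open>i\<close> of the trivial cocycle produced by the elementary
    map \<open>j\<close>. A solution \<open>c\<close> of the system is a nonzero functional on
    cocycles that kills all trivial ones.\<close>
  let ?A = "\<lambda>i j. case i of (l, a, \<beta>) \<Rightarrow> (case j of
      Inl (l', \<gamma>) \<Rightarrow> if l = l' then ?rep (f a \<gamma>) \<beta> else 0
    | Inr (k, \<beta>') \<Rightarrow> if \<beta> = \<beta>' then ?s l a k else 0)"
  have fin: "finite ?I" "finite ?J" using B1(1) B2(1) by auto
  have cJ: "card ?J = 2 * q * kvs.dim (M 2) + Suc q * kvs.dim (M 1)"
    using B1 B2 by (simp add: card_Plus card_cartesian_product)
  have cI: "card ?I = 2 * q * n * kvs.dim (M 1)"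
    using B1 by (simp add: card_cartesian_product)
  have "card ?J < card ?I" unfolding cI cJ by (rule dims)
  then obtain c where c: "\<exists>i\<in>?I. c i \<noteq> 0" "\<And>j. j \<in> ?J \<Longrightarrow> (\<Sum>i\<in>?I. c i * ?A i j) = 0"
    by (rule homogeneous_system[OF fin, where A = ?A]) blast
  define \<Phi> where "\<Phi> l a x = (\<Sum>\<beta>\<in>B1. c (l, a, \<beta>) * ?rep x \<beta>)" for l a x
  have \<Phi>_add: "\<Phi> l a (x + y) = \<Phi> l a x + \<Phi> l a y" if "x \<in> M 1" "y \<in> M 1" for l a x y
    unfolding \<Phi>_def using that B1(3) kvs.representation_add[OF B1(2)]
    by (simp add: sum.distrib algebra_simps)
  have \<Phi>_scale: "\<Phi> l a (kscale d x) = d * \<Phi> l a x" if "x \<in> M 1" for l a d x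
    unfolding \<Phi>_def using that B1(3) kvs.representation_scale[OF B1(2)]
    by (simp add: sum_distrib_left algebra_simps)
  have \<Phi>_0: "\<Phi> l a 0 = 0" for l a using \<Phi>_scale[of 0 l a 0] kvs.subspace_0[OF Md(2)] by simp
  have \<Phi>_sum: "\<Phi> l a (\<Sum>k<K. x k) = (\<Sum>k<K. \<Phi> l a (x k))" if "\<And>k. k < K \<Longrightarrow> x k \<in> M 1" for l a x and K :: nat
    using that
  proof (induction K)
    case (Suc K)
    have "(\<Sum>k<K. x k) \<in> M 1" by (rule kvs.subspace_sum[OF Md(2)]) (use Suc in simp)
    then have "\<Phi> l a ((\<Sum>k<K. x k) + x K) = \<Phi> l a (\<Sum>k<K. x k) + \<Phi> l a (x K)"
      using Suc.prems by (intro \<Phi>_add) simp_all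
    also have "\<Phi> l a (\<Sum>k<K. x k) = (\<Sum>k<K. \<Phi> l a (x k))" using Suc by simp
    finally show ?case unfolding sum.lessThan_Suc .
  qed (simp add: \<Phi>_0)
  have \<Phi>_basis: "\<Phi> l a \<beta> = c (l, a, \<beta>)" if "\<beta> \<in> B1" for l a \<beta>
  proof -
    have "\<Phi> l a \<beta> = (\<Sum>\<beta>'\<in>B1. if \<beta> = \<beta>' then c (l, a, \<beta>') else 0)"
      unfolding \<Phi>_def kvs.representation_basis[OF B1(2) that] by (intro sum.cong) auto
    then show ?thesis using that B1(1) by simp
  qed
  have sumI: "(\<Sum>i\<in>?I. g i) = (\<Sum>l<2 * q. \<Sum>a<n. \<Sum>\<beta>\<in>B1. g (l, a, \<beta>))"
    for g :: "nat \<times> nat \<times> 'k vect \<Rightarrow> 'k"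
    by (simp add: sum.cartesian_product split_def)
  have E1: "(\<Sum>a<n. \<Phi> l a (f a y)) = 0" if l: "l < 2 * q" and y: "y \<in> M 2" for l y
  proof (rule functional_zero_on_span[where B = B2 and \<psi> = "\<lambda>y. \<Sum>a<n. \<Phi> l a (f a y)"])
    show "y \<in> kvs.span B2" using y B2(3) by simp
    fix x assume "x \<in> B2"
    then have "Inl (l, x) \<in> ?J" using l by auto
    then have "0 = (\<Sum>i\<in>?I. c i * ?A i (Inl (l, x)))" by (rule c(2)[symmetric])
    also have "\<dots> = (\<Sum>l'<2 * q. if l' = l then (\<Sum>a<n. \<Phi> l a (f a x)) else 0)"
      unfolding sumI \<Phi>_def by (intro sum.cong) auto
    also have "\<dots> = (\<Sum>a<n. \<Phi> l a (f a x))" using l by simp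
    finally show "(\<Sum>a<n. \<Phi> l a (f a x)) = 0" by simp
  next
    fix x y assume "x \<in> kvs.span B2" "y \<in> kvs.span B2"
    then have "f a (x + y) = f a x + f a y \<and> f a x \<in> M 1 \<and> f a y \<in> M 1" if "a < n" for a
      using B2(3) linear_onD(1)[OF Md(3)[OF that]] Md(4)[OF that] by simp
    then have "\<Phi> l a (f a (x + y)) = \<Phi> l a (f a x) + \<Phi> l a (f a y)" if "a < n" for a
      using \<Phi>_add that by simp
    then show "(\<Sum>a<n. \<Phi> l a (f a (x + y))) = (\<Sum>a<n. \<Phi> l a (f a x)) + (\<Sum>a<n. \<Phi> l a (f a y))"
      by (simp add: sum.distrib)
  next
    fix d x assume "x \<in> kvs.span B2"
    then have "f a (kscale d x) = kscale d (f a x) \<and> f a x \<in> M 1" if "a < n" for a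
      using B2(3) linear_onD(2)[OF Md(3)[OF that]] Md(4)[OF that] by simp
    then have "\<Phi> l a (f a (kscale d x)) = d * \<Phi> l a (f a x)" if "a < n" for a
      using \<Phi>_scale that by simp
    then show "(\<Sum>a<n. \<Phi> l a (f a (kscale d x))) = d * (\<Sum>a<n. \<Phi> l a (f a x))"
      by (simp add: sum_distrib_left)
  qed
  have E2: "(\<Sum>l<2 * q. \<Sum>a<n. ?s l a k * \<Phi> l a x) = 0" if k: "k < Suc q" and x: "x \<in> M 1" for k x
  proof (rule functional_zero_on_span[where B = B1 and \<psi> = "\<lambda>x. \<Sum>l<2 * q. \<Sum>a<n. ?s l a k * \<Phi> l a x"])
    show "x \<in> kvs.span B1" using x B1(3) by simp
    fix \<beta> assume \<beta>: "\<beta> \<in> B1"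
    then have "Inr (k, \<beta>) \<in> ?J" using k by auto
    then have "0 = (\<Sum>i\<in>?I. c i * ?A i (Inr (k, \<beta>)))" by (rule c(2)[symmetric])
    also have "\<dots> = (\<Sum>l<2 * q. \<Sum>a<n. \<Sum>\<beta>'\<in>B1. if \<beta>' = \<beta> then ?s l a k * c (l, a, \<beta>') else 0)"
      unfolding sumI by (intro sum.cong) auto
    also have "\<dots> = (\<Sum>l<2 * q. \<Sum>a<n. ?s l a k * \<Phi> l a \<beta>)" using \<beta> B1(1) \<Phi>_basis by simp
    finally show "(\<Sum>l<2 * q. \<Sum>a<n. ?s l a k * \<Phi> l a \<beta>) = 0" by simp
  next
    fix x y assume "x \<in> kvs.span B1" "y \<in> kvs.span B1"
    then have "\<Phi> l a (x + y) = \<Phi> l a x + \<Phi> l a y" for l a using B1(3) \<Phi>_add by simp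
    then show "(\<Sum>l<2 * q. \<Sum>a<n. ?s l a k * \<Phi> l a (x + y))
        = (\<Sum>l<2 * q. \<Sum>a<n. ?s l a k * \<Phi> l a x) + (\<Sum>l<2 * q. \<Sum>a<n. ?s l a k * \<Phi> l a y)"
      by (simp add: sum.distrib distrib_left)
  next
    fix d x assume "x \<in> kvs.span B1"
    then have "\<Phi> l a (kscale d x) = d * \<Phi> l a x" for l a using B1(3) \<Phi>_scale by simp
    then show "(\<Sum>l<2 * q. \<Sum>a<n. ?s l a k * \<Phi> l a (kscale d x)) = d * (\<Sum>l<2 * q. \<Sum>a<n. ?s l a k * \<Phi> l a x)"
      by (simp add: sum_distrib_left mult.left_commute)
  qed
  \<comment> \<open>A nonzero functional is nonzero on some elementary cocycle, which is why one
    extra entry in \<open>ext_map\<close> is enough.\<close>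
  obtain i where i: "i \<in> ?I" "c i \<noteq> 0" using c(1) by blast
  obtain l0 a0 b where "i = (l0, a0, b)" by (rule prod_cases3)
  then have i0: "l0 < 2 * q" "a0 < n" "b \<in> B1" "c (l0, a0, b) \<noteq> 0" using i by simp_all
  have bM: "b \<in> M 1" using i0(3) B1(3) kvs.span_base by blast
  show ?thesis
  proof (rule that[OF bM], rule notI)
    fix r
    assume r: "hom ?Q (ext_module q M) (ext_map q f l0 a0 b) M f r"
      and rid: "\<forall>v. \<forall>x\<in>M v. r v (interleave x 0) = x"
    let ?N = "ext_module q M" and ?g = "ext_map q f l0 a0 b"
    have zN: "interleave 0 (unit_vec l) \<in> ?N 2" if "l < 2 * q" for l
      using that kvs.subspace_0[OF Md(2)] unit_vec_in by (simp add: ext_module_in)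
    have yN: "interleave x y \<in> ?N 1" if "x \<in> M 1" "y \<in> coord_space (Suc q)" for x y
      unfolding ext_module_in using that by simp
    define h where "h l = r 2 (interleave 0 (unit_vec l))" for l
    define e where "e k = r 1 (interleave 0 (unit_vec k))" for k
    have h: "h l \<in> M 2" if "l < 2 * q" for l unfolding h_def using hom_in[OF r zN[OF that]] .
    have e: "e k \<in> M 1" if "k < Suc q" for k
      unfolding e_def using hom_in[OF r yN[OF kvs.subspace_0[OF Md(2)] unit_vec_in[OF that]]] .
    \<comment> \<open>Compatibility of the retraction with the arrows exhibits the elementary
      cocycle as a difference of trivial ones: \<open>h\<close> is the component on the quotient top
      and \<open>e\<close> the one on its socle. Applying the functional leaves its nonzero value on
      one side and zero on the other.\<close>
    have eq: "f a (h l) = (if a = a0 \<and> l = l0 then b else 0) + (\<Sum>k<Suc q. kscale (?s l a k) (e k))"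
      if l: "l < 2 * q" and a: "a < n" for l a
    proof -
      let ?b = "if a = a0 \<and> l = l0 then b else 0" and ?y = "syzygy_map q a (unit_vec l :: 'k vect)"
      have b: "?b \<in> M 1" using bM kvs.subspace_0[OF Md(2)] by simp
      have y: "?y \<in> coord_space (Suc q)" by (rule syzygy_map_in)
      have f0: "f a 0 = 0" using linear_on_0[OF Md(3)[OF a] kvs.subspace_0[OF Md(2)]] .
      have g: "?g a (interleave 0 (unit_vec l)) = interleave ?b 0 + interleave 0 ?y"
        unfolding interleave_add[symmetric] ext_map_def parts_interleave f0
        by (auto simp: unit_vec_apply)
      have lin: "linear_on (coord_space (Suc q)) (\<lambda>y. r 1 (interleave 0 y))"
        by (rule linear_on_comp[OF interleave_linear(2) _ hom_linear[OF r]])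
          (use yN[OF kvs.subspace_0[OF Md(2)]] in blast)
      have "f a (h l) = r 1 (?g a (interleave 0 (unit_vec l)))"
        unfolding h_def using hom_arrow[OF r, of a "interleave 0 (unit_vec l)"] a zN[OF l] by simp
      also have "\<dots> = r 1 (interleave ?b 0) + r 1 (interleave 0 ?y)"
        unfolding g
        by (rule linear_onD(1)[OF hom_linear[OF r] yN[OF b kvs.subspace_0[OF coord_space_subspace]]
              yN[OF kvs.subspace_0[OF Md(2)] y]])
      also have "r 1 (interleave ?b 0) = ?b" using rid b by blast
      also have "r 1 (interleave 0 ?y) = r 1 (interleave 0 (\<Sum>k<Suc q. kscale (?y k) (unit_vec k)))"
        using coord_expansion[OF y] by simp
      also have "\<dots> = (\<Sum>k<Suc q. r 1 (interleave 0 (kscale (?y k) (unit_vec k))))"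
        by (rule linear_on_sum[OF lin coord_space_subspace])
          (auto intro!: kvs.subspace_scale[OF coord_space_subspace] unit_vec_in)
      also have "\<dots> = (\<Sum>k<Suc q. kscale (?y k) (e k))"
        unfolding e_def by (intro sum.cong refl linear_onD(2)[OF lin] unit_vec_in) simp
      finally show ?thesis .
    qed
    have "\<Phi> l a (f a (h l)) = (if a = a0 \<and> l = l0 then \<Phi> l0 a0 b else 0) + (\<Sum>k<Suc q. ?s l a k * \<Phi> l a (e k))"
      if l: "l < 2 * q" and a: "a < n" for l a
    proof -
      have s: "kscale (?s l a k) (e k) \<in> M 1" if "k < Suc q" for k
        using kvs.subspace_scale[OF Md(2) e[OF that]] .
      have "(if a = a0 \<and> l = l0 then b else 0) \<in> M 1" using bM kvs.subspace_0[OF Md(2)] by simp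
      moreover have "(\<Sum>k<Suc q. kscale (?s l a k) (e k)) \<in> M 1"
        by (rule kvs.subspace_sum[OF Md(2)]) (use s in blast)
      ultimately have "\<Phi> l a (f a (h l)) = \<Phi> l a (if a = a0 \<and> l = l0 then b else 0)
          + \<Phi> l a (\<Sum>k<Suc q. kscale (?s l a k) (e k))"
        unfolding eq[OF l a] by (rule \<Phi>_add)
      moreover have "\<Phi> l a (\<Sum>k<Suc q. kscale (?s l a k) (e k)) = (\<Sum>k<Suc q. ?s l a k * \<Phi> l a (e k))"
      proof -
        have "\<Phi> l a (\<Sum>k<Suc q. kscale (?s l a k) (e k)) = (\<Sum>k<Suc q. \<Phi> l a (kscale (?s l a k) (e k)))"
          by (rule \<Phi>_sum[where x = "\<lambda>k. kscale (?s l a k) (e k)"]) (rule s)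
        also have "\<dots> = (\<Sum>k<Suc q. ?s l a k * \<Phi> l a (e k))"
          by (intro sum.cong refl \<Phi>_scale e) simp
        finally show ?thesis .
      qed
      ultimately show ?thesis using \<Phi>_0 by simp
    qed
    then have "(\<Sum>l<2 * q. \<Sum>a<n. \<Phi> l a (f a (h l))) = (\<Sum>l<2 * q. \<Sum>a<n.
        (if a = a0 \<and> l = l0 then \<Phi> l0 a0 b else 0) + (\<Sum>k<Suc q. ?s l a k * \<Phi> l a (e k)))"
      by (intro sum.cong refl) simp
    also have "\<dots> = (\<Sum>l<2 * q. \<Sum>a<n. if a = a0 \<and> l = l0 then \<Phi> l0 a0 b else 0)
        + (\<Sum>l<2 * q. \<Sum>a<n. \<Sum>k<Suc q. ?s l a k * \<Phi> l a (e k))"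
      by (simp only: sum.distrib)
    also have "(\<Sum>l<2 * q. \<Sum>a<n. if a = a0 \<and> l = l0 then \<Phi> l0 a0 b else 0) = \<Phi> l0 a0 b"
    proof -
      have "(\<Sum>a<n. if a = a0 \<and> l = l0 then \<Phi> l0 a0 b else 0) = (if l = l0 then \<Phi> l0 a0 b else 0)" for l
        using i0(2) by (cases "l = l0") simp_all
      then show ?thesis using i0(1) by simp
    qed
    also have "(\<Sum>l<2 * q. \<Sum>a<n. \<Sum>k<Suc q. ?s l a k * \<Phi> l a (e k))
        = (\<Sum>k<Suc q. \<Sum>l<2 * q. \<Sum>a<n. ?s l a k * \<Phi> l a (e k))"
    proof -
      have "(\<Sum>l<2 * q. \<Sum>a<n. \<Sum>k<Suc q. ?s l a k * \<Phi> l a (e k))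
          = (\<Sum>l<2 * q. \<Sum>k<Suc q. \<Sum>a<n. ?s l a k * \<Phi> l a (e k))"
        by (intro sum.cong refl sum.swap)
      also have "\<dots> = (\<Sum>k<Suc q. \<Sum>l<2 * q. \<Sum>a<n. ?s l a k * \<Phi> l a (e k))"
        by (rule sum.swap)
      finally show ?thesis .
    qed
    also have "\<dots> = 0" by (intro sum.neutral ballI E2 e) simp_all
    finally have "(\<Sum>l<2 * q. \<Sum>a<n. \<Phi> l a (f a (h l))) = \<Phi> l0 a0 b" by simp
    moreover have "(\<Sum>l<2 * q. \<Sum>a<n. \<Phi> l a (f a (h l))) = 0"
      by (intro sum.neutral ballI E1 h) simp_all
    ultimately show False using \<Phi>_basis[OF i0(3)] i0(4) by simp
  qed
qed


section \<open>A submodule of dimension vector (1, 2) when m2 is at least (n - 1/2) m1\<close>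

section \<open>Modules with a large top\<close>

text \<open>Each of the \<open>k\<close> conditions costs at most the codimension of
  \<open>S a\<close> in \<open>M 1\<close>; the inequality is arranged to avoid subtraction.\<close>

lemma dim_constrained_top:
  assumes M: "representation (kronecker_quiver n) M f"
    and S: "\<And>a. a < k \<Longrightarrow> kvs.subspace (S a)" "\<And>a. a < k \<Longrightarrow> S a \<subseteq> M 1" and "k \<le> n"
  shows "kvs.subspace {y \<in> M 2. \<forall>a<k. f a y \<in> S a}" (is "?A k")
    and "kvs.dim (M 2) + (\<Sum>a<k. kvs.dim (S a)) \<le> kvs.dim {y \<in> M 2. \<forall>a<k. f a y \<in> S a} + k * kvs.dim (M 1)"
      (is "?B k")
proof -
  note Md = kronecker_repD[OF M]
  have "?A k \<and> ?B k"
    using assms(2-4)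
  proof (induction k)
    case 0
    then show ?case using Md(2)[of 2] by simp
  next
    case (Suc k)
    let ?P = "{y \<in> M 2. \<forall>a<k. f a y \<in> S a}"
    have IH: "kvs.subspace ?P" "kvs.dim (M 2) + (\<Sum>a<k. kvs.dim (S a)) \<le> kvs.dim ?P + k * kvs.dim (M 1)"
      using Suc.IH Suc.prems by simp_all
    have k: "k < n" using Suc.prems by simp
    have fP: "findim ?P" by (rule findim_sub(1)[OF Md(1)[of 2] IH(1)]) blast
    have lP: "linear_on ?P (f k)" by (rule linear_on_subset[OF Md(3)[OF k]]) blast
    have split: "{y \<in> M 2. \<forall>a<Suc k. f a y \<in> S a} = {y \<in> ?P. f k y \<in> S k}"
      by (auto simp: less_Suc_eq)
    have "kvs.dim ?P + kvs.dim (S k) \<le> kvs.dim {y \<in> ?P. f k y \<in> S k} + kvs.dim (M 1)"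
      by (rule dim_preimage_ge[OF fP lP Md(1)]) (use Md(4)[OF k] Suc.prems in auto)
    moreover have "kvs.subspace {y \<in> ?P. f k y \<in> S k}"
      by (rule subspace_preimage_on[OF lP IH(1)]) (use Suc.prems in simp)
    ultimately show ?case unfolding split using IH(2) by simp
  qed
  then show "?A k" "?B k" by blast+
qed

text \<open>Two independent top vectors over the same socle line \<open>x\<close>: \<open>y'\<close>
  reaches it through arrow 2 alone, \<open>y\<close> through arrows 0 and 1 alone. The first holds
  for all \<open>x\<close> in a space \<open>X\<close>, and within \<open>X\<close> an eigenvector
  argument supplies the second.\<close>

lemma line_with_two_preimages:
  fixes M :: "nat \<Rightarrow> 'k::alg_closed_field vect set"
  assumes n: "3 \<le> n" and M: "representation (kronecker_quiver n) M f" and "M 1 \<noteq> {0}"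
    and ker: "\<And>y. y \<in> M 2 \<Longrightarrow> (\<And>a. a < n \<Longrightarrow> f a y = 0) \<Longrightarrow> y = 0"
    and dims: "2 * n * kvs.dim (M 1) \<le> kvs.dim (M 1) + 2 * kvs.dim (M 2)"
  obtains x y y' where "x \<in> M 1" "x \<noteq> 0" "y \<in> M 2" "y' \<in> M 2" "y \<noteq> 0" "y' \<notin> kvs.span {y}"
    "\<forall>a<n. f a y \<in> kvs.span {x} \<and> f a y' \<in> kvs.span {x}"
proof -
  note Md = kronecker_repD[OF M]
  let ?m1 = "kvs.dim (M 1)" and ?m2 = "kvs.dim (M 2)"
  have m1: "0 < ?m1" using dim_zero_iff[OF Md(1)] assms(3) by blast
  have zero: "kvs.subspace {0 :: 'k vect}" "{0} \<subseteq> M 1" using kvs.subspace_0[OF Md(2)] by auto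
  \<comment> \<open>With these constraints \<open>P\<close> is the common kernel of all arrows
    except arrow 2, on which arrow 2 must be injective.\<close>
  define S where "S a = (if a = 2 then M 1 else {0})" for a :: nat
  define P where "P = {y \<in> M 2. \<forall>a<n. f a y \<in> S a}"
  have S: "kvs.subspace (S a)" "S a \<subseteq> M 1" for a using zero Md(2) by (auto simp: S_def)
  have "(\<Sum>a<n. kvs.dim (S a)) = (\<Sum>a<n. if a = 2 then ?m1 else 0)"
    unfolding S_def by (intro sum.cong) auto
  then have sumS: "(\<Sum>a<n. kvs.dim (S a)) = ?m1" using n by simp
  have sP: "kvs.subspace P" and dP: "?m2 + ?m1 \<le> kvs.dim P + n * ?m1"
    using dim_constrained_top[where S = S, OF M S(1) S(2) order_refl] unfolding P_def sumS by simp_all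
  have PM: "P \<subseteq> M 2" unfolding P_def by blast
  have fP: "findim P" using findim_sub(1)[OF Md(1) sP PM] .
  have lP: "linear_on P (f 2)" using linear_on_subset[OF Md(3) PM] n by simp
  have P0: "f a y = 0" if "y \<in> P" "a < n" "a \<noteq> 2" for a y using that by (auto simp: P_def S_def)
  have injP: "inj_on (f 2) P"
    unfolding inj_on_kernel[OF lP sP]
  proof (intro ballI impI)
    fix y assume y: "y \<in> P" "f 2 y = 0"
    show "y = 0" by (rule ker) (use y PM P0[OF y(1)] in \<open>blast, metis\<close>)
  qed
  define X where "X = f 2 ` P"
  have fX: "findim X" unfolding X_def by (rule findim_image[OF fP lP])
  have XM: "X \<subseteq> M 1" unfolding X_def using Md(4)[of 2] PM n by auto
  have dX: "kvs.dim X = kvs.dim P" unfolding X_def by (rule dim_image_inj[OF fP lP injP])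
  \<comment> \<open>Now \<open>Y\<close> collects the vectors that only arrows 0 and 1 can move, and
    only into \<open>X\<close>.\<close>
  define R where "R a = (if a = 0 \<or> a = 1 then X else {0})" for a :: nat
  define Y where "Y = {y \<in> M 2. \<forall>a<n. f a y \<in> R a}"
  have R: "kvs.subspace (R a)" "R a \<subseteq> M 1" for a using zero XM findim_subspace[OF fX] by (auto simp: R_def)
  have "(\<Sum>a<n. kvs.dim (R a)) = (\<Sum>a<n. (if a = 0 then kvs.dim X else 0) + (if a = 1 then kvs.dim X else 0))"
    unfolding R_def by (intro sum.cong) auto
  then have sumR: "(\<Sum>a<n. kvs.dim (R a)) = 2 * kvs.dim X" using n by (simp add: sum.distrib)
  have sY: "kvs.subspace Y" and dY: "?m2 + 2 * kvs.dim X \<le> kvs.dim Y + n * ?m1"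
    using dim_constrained_top[where S = R, OF M R(1) R(2) order_refl] unfolding Y_def sumR by simp_all
  have YM: "Y \<subseteq> M 2" unfolding Y_def by blast
  have fY: "findim Y" using findim_sub(1)[OF Md(1) sY YM] .
  have lY: "linear_on Y (f a)" if "a < n" for a using linear_on_subset[OF Md(3)[OF that] YM] .
  have Y0: "f a y = 0" if "y \<in> Y" "a < n" "a \<noteq> 0" "a \<noteq> 1" for a y using that by (auto simp: Y_def R_def)
  have YX: "f 0 y \<in> X" "f 1 y \<in> X" if "y \<in> Y" for y
  proof -
    have "f a y \<in> R a" if "a < n" for a using \<open>y \<in> Y\<close> that unfolding Y_def by blast
    from this[of 0] this[of 1] show "f 0 y \<in> X" "f 1 y \<in> X" using n by (simp_all add: R_def)
  qed
  \<comment> \<open>With m2 \<ge> (n - 1/2) m1 the first count gives dim X \<ge> m1 / 2. The second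
    gives dim Y \<ge> dim X + (m2 + dim X - n m1), and the bracket is nonnegative by that
    bound.\<close>
  have pos: "0 < kvs.dim X" and YgeX: "kvs.dim X \<le> kvs.dim Y"
    using dP dY dX dims m1 by (simp_all add: algebra_simps)
  \<comment> \<open>Arrows 0 and 1 form a pencil from \<open>Y\<close> to \<open>X\<close>. Either
    arrow 0 kills some nonzero \<open>y\<close>, whose image under arrow 1 spans the line, or arrow
    0 is bijective and an eigenvector of arrow 1 after its inverse does.\<close>
  have "\<exists>x\<in>X. \<exists>y\<in>Y. x \<noteq> 0 \<and> y \<noteq> 0 \<and> f 0 y \<in> kvs.span {x} \<and> f 1 y \<in> kvs.span {x}"
  proof (cases "inj_on (f 0) Y")
    case False
    then obtain y where y: "y \<in> Y" "f 0 y = 0" "y \<noteq> 0"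
      using inj_on_kernel[OF lY sY] n by auto
    have "f 1 y \<noteq> 0"
    proof
      assume "f 1 y = 0"
      then have "f a y = 0" if "a < n" for a
        using Y0[OF y(1) that] y(2) by (cases "a = 0"; cases "a = 1") simp_all
      then show False using ker y YM by blast
    qed
    then show ?thesis using y YX(2)[OF y(1)] kvs.span_zero kvs.span_base[of "f 1 y" "{f 1 y}"] by (metis insertI1)
  next
    case True
    have l0: "linear_on Y (f 0)" and l1: "linear_on Y (f 1)" using lY n by simp_all
    have sub: "f 0 ` Y \<subseteq> X" using YX by blast
    have im: "f 0 ` Y = X"
      using findim_dim_eq[OF fX findim_subspace[OF findim_image[OF fY l0]] sub] dim_image_inj[OF fY l0 True] YgeX
      by simp
    define T where "T x = f 1 (inv_into Y (f 0) x)" for x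
    have T: "T (f 0 y) = f 1 y" if "y \<in> Y" for y unfolding T_def using inv_into_f_f[OF True that] by simp
    have lT: "linear_on X T"
      unfolding linear_on_def
    proof (intro conjI ballI allI)
      fix u v assume "u \<in> X" "v \<in> X"
      then obtain y z where yz: "y \<in> Y" "z \<in> Y" "u = f 0 y" "v = f 0 z" unfolding im[symmetric] by blast
      have "u + v = f 0 (y + z)" using linear_onD(1)[OF l0] yz by simp
      then show "T (u + v) = T u + T v"
        using T kvs.subspace_add[OF sY yz(1,2)] linear_onD(1)[OF l1 yz(1,2)] yz by simp
    next
      fix d u assume "u \<in> X"
      then obtain y where y: "y \<in> Y" "u = f 0 y" unfolding im[symmetric] by blast
      have "kscale d u = f 0 (kscale d y)" using linear_onD(2)[OF l0] y by simp
      then show "T (kscale d u) = kscale d (T u)"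
        using T kvs.subspace_scale[OF sY y(1)] linear_onD(2)[OF l1 y(1)] y by simp
    qed
    have TX: "T ` X \<subseteq> X" unfolding im[symmetric] using T YX im by auto
    have "X \<noteq> {0}" using pos by auto
    then obtain x d where x: "x \<in> X" "x \<noteq> 0" "T x = kscale d x" using eigenvector_exists[OF fX _ lT TX] by blast
    obtain y where y: "y \<in> Y" "x = f 0 y" using x(1) unfolding im[symmetric] by blast
    have "y \<noteq> 0" using x(2) y(2) linear_on_0[OF l0 kvs.subspace_0[OF sY]] by metis
    moreover have "f 0 y \<in> kvs.span {x}" "f 1 y \<in> kvs.span {x}"
      using T[OF y(1)] x(3) y(2) kvs.span_base[of x "{x}"] kvs.span_scale[of x "{x}" d] by simp_all
    ultimately show ?thesis using x y(1) by blast
  qed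
  then obtain x y where xy: "x \<in> X" "y \<in> Y" "x \<noteq> 0" "y \<noteq> 0" "f 0 y \<in> kvs.span {x}" "f 1 y \<in> kvs.span {x}"
    by blast
  obtain y' where y': "y' \<in> P" "x = f 2 y'" using xy(1) unfolding X_def by blast
  \<comment> \<open>Arrow 2 kills \<open>y\<close> but sends \<open>y'\<close> to the nonzero vector
    \<open>x\<close>.\<close>
  have "y' \<notin> kvs.span {y}"
  proof
    assume "y' \<in> kvs.span {y}"
    then obtain d where "y' = kscale d y" by (auto simp: kvs.span_singleton)
    then have "f 2 y' = kscale d (f 2 y)" using linear_onD(2)[OF Md(3)[of 2]] xy(2) YM n by auto
    also have "f 2 y = 0" using Y0[OF xy(2), of 2] n by simp
    finally show False using y'(2) xy(3) by (metis kvs.scale_zero_right)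
  qed
  moreover have "f a y \<in> kvs.span {x}" if "a < n" for a
    using Y0[OF xy(2) that] xy(5,6) kvs.span_zero by metis
  moreover have "f a y' \<in> kvs.span {x}" if "a < n" for a
    using P0[OF y'(1) that] y'(2) kvs.span_zero kvs.span_base[of x "{x}"] by (metis insertI1)
  ultimately show ?thesis using that[of x y y'] xy y' XM YM PM by blast
qed

text \<open>One of two summands misses the one-dimensional space \<open>Z 1\<close>. Its top is then
  killed by all arrows and vanishes.\<close>

lemma cyclic_socle_indecomposable:
  assumes Z: "representation (kronecker_quiver n) Z f" "kvs.dim (Z 1) = 1"
    and ker: "\<And>y. y \<in> Z 2 \<Longrightarrow> (\<And>a. a < n \<Longrightarrow> f a y = 0) \<Longrightarrow> y = 0"
  shows "indecomposable (kronecker_quiver n) Z f"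
  unfolding indecomposable_def
proof (intro conjI allI impI)
  let ?Q = "kronecker_quiver n"
  show "representation ?Q Z f" by (rule Z)
  show "Z \<noteq> zero_module" using Z(2) by (metis dim_zero zero_module_iff zero_neq_one)
  fix A B assume "submodule ?Q Z f A \<and> submodule ?Q Z f B \<and> direct_sum ?Q Z A B"
  then have AB: "submodule ?Q Z f A" "submodule ?Q Z f B" "direct_sum ?Q Z A B" by blast+
  have zero: "C = zero_module" if C: "submodule ?Q Z f C" "kvs.dim (C 1) = 0" for C
  proof -
    note Cd = kronecker_repD[OF submodule_rep[OF C(1)]]
    have C1: "C 1 = {0}" using dim_zero_iff[OF Cd(1)] C(2) by blast
    have "C 2 \<subseteq> {0}"
    proof
      fix y assume y: "y \<in> C 2"
      then have "y \<in> Z 2" using submodule_le[OF C(1)] by (auto simp: le_fun_def)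
      moreover have "f a y = 0" if "a < n" for a using Cd(4)[OF that y] C1 by blast
      ultimately show "y \<in> {0}" using ker by blast
    qed
    then have "C 2 = {0}" using kvs.subspace_0[OF Cd(2)[of 2]] by blast
    then have "C v = {0}" for v using C1 Cd(5)[of v] by blast
    then show ?thesis by (simp add: zero_module_iff)
  qed
  have "kvs.dim (A 1) + kvs.dim (B 1) = 1" using direct_sum_length(2)[OF Z(1) AB, of 1] Z(2) by simp
  then have "kvs.dim (A 1) = 0 \<or> kvs.dim (B 1) = 0" by linarith
  then show "A = zero_module \<or> B = zero_module" using zero[OF AB(1)] zero[OF AB(2)] by blast
qed

text \<open>Over the line of \<open>x\<close>, the tops 0, the line of \<open>y\<close>, and the
  plane of \<open>y\<close> and \<open>y'\<close> give an indecomposable chain of lengths 1, 2, 3,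
  and this set is \<open>odd_measure 1\<close>, the largest of the family with positive
  index.\<close>

lemma large_top_measure:
  fixes M :: "nat \<Rightarrow> 'k::alg_closed_field vect set"
  assumes n: "3 \<le> n" and M: "indecomposable (kronecker_quiver n) M f" and M1: "M 1 \<noteq> {0}"
    and dims: "2 * n * kvs.dim (M 1) \<le> kvs.dim (M 1) + 2 * kvs.dim (M 2)" and "1 \<le> m"
  shows "gr_le (odd_measure m) (gr_measure (kronecker_quiver n) M f)"
proof -
  let ?Q = "kronecker_quiver n"
  let ?l = "module_length ?Q :: (nat \<Rightarrow> 'k vect set) \<Rightarrow> nat"
  note Mr = indecomposable_rep[OF M]
  note Md = kronecker_repD[OF Mr]
  have ker: "y = 0" if "y \<in> M 2" "\<And>a. a < n \<Longrightarrow> f a y = 0" for y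
    using kronecker_no_kernel[OF M M1 that] .
  obtain x y y' where x: "x \<in> M 1" "x \<noteq> 0" and y: "y \<in> M 2" "y' \<in> M 2" "y \<noteq> 0" "y' \<notin> kvs.span {y}"
      and im: "\<forall>a<n. f a y \<in> kvs.span {x} \<and> f a y' \<in> kvs.span {x}"
    by (rule line_with_two_preimages[OF n Mr M1 ker dims]) blast
  have sub: "submodule ?Q M f (kmod (kvs.span {x}) (kvs.span D))" if D: "D \<subseteq> {y, y'}" for D
  proof (rule submoduleI[OF Mr])
    have DM: "kvs.span D \<subseteq> M 2" by (rule kvs.span_minimal) (use D y Md(2) in auto)
    have xM: "kvs.span {x} \<subseteq> M 1" by (rule kvs.span_minimal) (use x Md(2) in auto)
    show "kvs.subspace (kmod (kvs.span {x}) (kvs.span D) v)" for v by (simp add: kmod_def)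
    show "kmod (kvs.span {x}) (kvs.span D) v \<subseteq> M v" for v
      using DM xM rep_0[OF Mr, of v] by (auto simp: kmod_def)
    fix a z assume a: "a \<in> arcs ?Q" and z: "z \<in> kmod (kvs.span {x}) (kvs.span D) (tail ?Q a)"
    have an: "a < n" using a by simp
    have "kvs.span D \<subseteq> {z \<in> M 2. f a z \<in> kvs.span {x}}"
    proof (rule kvs.span_minimal)
      show "D \<subseteq> {z \<in> M 2. f a z \<in> kvs.span {x}}" using D y im an by auto
      show "kvs.subspace {z \<in> M 2. f a z \<in> kvs.span {x}}"
        by (rule subspace_preimage_on[OF Md(3)[OF an] Md(2) kvs.subspace_span])
    qed
    then show "f a z \<in> kmod (kvs.span {x}) (kvs.span D) (head ?Q a)" using z by auto
  qed
  let ?K = "\<lambda>D. kmod (kvs.span {x}) (kvs.span D) :: nat \<Rightarrow> 'k vect set"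
  have dx: "kvs.dim (kvs.span {x}) = 1" using kvs.dim_span_eq_card_independent[of "{x}"] x(2) by simp
  have ind: "indecomposable ?Q (?K D) f" if D: "D \<subseteq> {y, y'}" for D
  proof (rule cyclic_socle_indecomposable)
    show "representation ?Q (?K D) f" using submodule_rep[OF sub[OF D]] .
    show "kvs.dim (?K D 1) = 1" using dx by simp
    fix z assume z: "z \<in> ?K D 2" "\<And>a. a < n \<Longrightarrow> f a z = 0"
    have "z \<in> M 2" using z(1) submodule_le[OF sub[OF D]] unfolding le_fun_def by blast
    then show "z = 0" using ker z(2) by blast
  qed
  have len: "?l (?K D) = 1 + card D" if "kvs.independent D" for D
    using kvs.dim_span_eq_card_independent[OF that] dx by (simp add: kronecker_length)
  have iy: "kvs.independent {y}" using y(3) by simp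
  have iyy: "kvs.independent {y, y'}"
    using kvs.independent_insertI[OF y(4) iy] by (simp add: insert_commute)
  have ne: "y \<noteq> y'" using y(4) kvs.span_base[of y "{y}"] by auto
  have mono: "?K D \<le> ?K E" if "D \<subseteq> E" for D E
    using kvs.span_mono[OF that] by (simp add: le_fun_def kmod_def)
  let ?W = "?K ` {{}, {y}, {y, y'}}"
  have "indec_chain ?Q M f ?W"
    unfolding indec_chain_def
  proof (intro conjI ballI)
    fix U U' assume "U \<in> ?W" "U' \<in> ?W"
    then obtain D E where DE: "U = ?K D" "U' = ?K E" "D \<in> {{}, {y}, {y, y'}}" "E \<in> {{}, {y}, {y, y'}}" by blast
    then have "D \<subseteq> E \<or> E \<subseteq> D" by auto
    then show "U \<le> U' \<or> U' \<le> U" using DE mono by blast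
  next
    fix U assume "U \<in> ?W"
    then obtain D where D: "U = ?K D" "D \<subseteq> {y, y'}" by blast
    then show "submodule ?Q M f U" "indecomposable ?Q U f" using sub ind by blast+
  qed simp
  then have "?l ` ?W \<in> chain_length_sets ?Q M f" by (rule chain_length_setsI)
  moreover have "?l ` ?W = odd_measure 1"
  proof -
    have "?l (?K {}) = 1" "?l (?K {y}) = 2" "?l (?K {y, y'}) = 3"
      using len[OF kvs.independent_empty] len[OF iy] len[OF iyy] ne by simp_all
    then have "?l ` ?W = {1, 2, 3}" by (simp only: image_insert image_empty)
    also have "\<dots> = odd_measure 1" by (auto simp: odd_measure_iff elim!: evenE)
    finally show ?thesis .
  qed
  ultimately have "gr_le (odd_measure 1) (gr_measure ?Q M f)"
    using gr_measure_max(2)[OF _ Mr] by simp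
  then show ?thesis using gr_above_odd_measureI[of 1 m] assms(5) gr_le_trans by blast
qed


section \<open>Excluding every candidate for a direct predecessor\<close>

section \<open>No direct predecessors\<close>

lemma odd_measure_is_measure:
  assumes "2 \<le> n" "1 \<le> m"
  shows "odd_measure m \<in> gr_measures (kronecker_quiver n) TYPE('k::field)"
proof -
  have "indecomposable (kronecker_quiver n) (shift_module m) (shift_map m :: nat \<Rightarrow> 'k vect \<Rightarrow> _)"
    by (rule shift_module_indecomposable[OF assms(1)])
  moreover have "gr_measure (kronecker_quiver n) (shift_module m) (shift_map m :: nat \<Rightarrow> 'k vect \<Rightarrow> _) = odd_measure m"
    by (rule gr_measure_shift_module[OF assms])
  ultimately show ?thesis unfolding gr_measures_def by blast
qed

lemma odd_measure_no_predecessor: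
  assumes n: "3 \<le> n" and m: "1 \<le> m"
  shows "\<not> direct_predecessor (kronecker_quiver n) TYPE('k::alg_closed_field) I (odd_measure m)"
proof
  let ?Q = "kronecker_quiver n"
  have fin: "finite (verts ?Q)" by simp
  assume dp: "direct_predecessor ?Q TYPE('k) I (odd_measure m)"
  then have lt: "gr_less I (odd_measure m)"
    and gap: "\<And>I'. I' \<in> gr_measures ?Q TYPE('k) \<Longrightarrow> gr_less I I' \<Longrightarrow> \<not> gr_less I' (odd_measure m)"
    unfolding direct_predecessor_def by blast+
  obtain M :: "nat \<Rightarrow> 'k vect set" and f where M: "indecomposable ?Q M f" "I = gr_measure ?Q M f"
    using dp unfolding direct_predecessor_def gr_measures_def by blast
  note Mr = indecomposable_rep[OF M(1)]
  let ?m1 = "kvs.dim (M 1)" and ?m2 = "kvs.dim (M 2)"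
  show False
  proof (cases "M 1 = {0}")
    \<comment> \<open>\<open>M\<close> is simple with no socle part, and a measure inside {0, 1}
      lies below \<open>odd_measure (Suc m)\<close>, which in turn lies below
      \<open>odd_measure m\<close>.\<close>
    case True
    then have "module_length ?Q M = 1" using kronecker_semisimple_length[OF M(1)] by blast
    then have I: "I \<subseteq> {..1}" using gr_measure_bound[OF fin Mr] M(2) by simp
    have "gr_less I (odd_measure (Suc m))"
    proof (rule ccontr)
      assume "\<not> gr_less I (odd_measure (Suc m))"
      then have "gr_le (odd_measure (Suc m)) I" by (simp add: gr_le_iff_not_less)
      then consider "I = odd_measure (Suc m)"
        | d where "d \<in> I" "d \<notin> odd_measure (Suc m)" "\<forall>i<d. i \<in> odd_measure (Suc m) \<longleftrightarrow> i \<in> I"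
        unfolding gr_le_def gr_less_iff by blast
      then show False
      proof cases
        case 1
        have "2 \<in> odd_measure (Suc m)" by (simp add: odd_measure_iff)
        then show False using I 1 by auto
      next
        case 2
        then have "d = 0" using I by (auto simp: odd_measure_iff le_Suc_eq)
        moreover have "0 \<notin> gr_measure ?Q M f"
        proof
          assume "0 \<in> gr_measure ?Q M f"
          then obtain \<W> where "indec_chain ?Q M f \<W>" "0 \<in> module_length ?Q ` \<W>"
            using gr_measure_max(1)[OF fin Mr] unfolding chain_length_sets_iff by blast
          then obtain U where "indecomposable ?Q U f" "module_length ?Q U = 0"
            unfolding indec_chain_def by auto
          then show False using length_pos[OF fin indecomposable_rep indecomposable_nonzero] by fastforce
        qed
        ultimately show False using 2(1) M(2) by simp
      qed
    qed
    then show False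
      using gap[OF odd_measure_is_measure[of n "Suc m"]] n odd_measure_decreasing[of m "Suc m"] m by simp
  next
    case False
    show False
    proof (cases "2 * n * ?m1 \<le> ?m1 + 2 * ?m2")
      case True
      then show False
        using large_top_measure[OF n M(1) False True m] lt M(2) by (simp add: gr_le_iff_not_less)
    next
      case large: False
      \<comment> \<open>The failed inequality has an integral slack of at least 1, which
        multiplication by q raises to q. This must exceed the one surplus copy of m1 in (q + 1) m1,
        hence q = m1 + 1.\<close>
      define q where "q = Suc ?m1"
      have "2 * q * ?m2 + Suc q * ?m1 < 2 * q * n * ?m1"
      proof -
        have "q * (?m1 + 2 * ?m2 + 1) \<le> q * (2 * n * ?m1)" using large by (intro mult_le_mono2) simp
        moreover have "q * (?m1 + 2 * ?m2 + 1) = q * ?m1 + 2 * q * ?m2 + q" by (simp add: algebra_simps)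
        moreover have "q * (2 * n * ?m1) = 2 * q * n * ?m1" by simp
        moreover have "Suc q * ?m1 < q * ?m1 + q" unfolding q_def by simp
        ultimately show ?thesis by linarith
      qed
      then obtain l0 a0 b where b: "b \<in> M 1"
        and nonsplit: "\<And>r. hom ?Q (ext_module q M) (ext_map q f l0 a0 b) M f r \<Longrightarrow>
          \<not> (\<forall>v. \<forall>x\<in>M v. r v (interleave x 0) = x)"
        using ext_nonsplit[OF Mr] by metis
      let ?N = "ext_module q M" and ?g = "ext_map q f l0 a0 b"
      \<comment> \<open>Measures of submodules of the extension stay below
        \<open>odd_measure m\<close>; as nothing lies strictly between, they are at most the measure
        of \<open>M\<close>.\<close>
      have "dominated ?Q M f ?N ?g"
        unfolding dominated_def
      proof (intro allI impI)
        fix Z assume Z: "submodule ?Q ?N ?g Z" "indecomposable ?Q Z ?g"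
        have "\<not> gr_le (odd_measure m) (gr_measure ?Q Z ?g)"
          using ext_no_new_measure[OF n Mr b m Z] lt M(2) by (auto simp: gr_le_iff_not_less)
        then have "gr_less (gr_measure ?Q Z ?g) (odd_measure m)" by (simp add: gr_le_iff_not_less)
        moreover have "gr_measure ?Q Z ?g \<in> gr_measures ?Q TYPE('k)"
          using Z(2) unfolding gr_measures_def by blast
        ultimately show "gr_le (gr_measure ?Q Z ?g) (gr_measure ?Q M f)"
          using gap M(2) unfolding gr_le_iff_not_less by blast
      qed
      then obtain r where "hom ?Q ?N ?g M f r" "\<And>v x. x \<in> M v \<Longrightarrow> r v (interleave x 0) = x"
        using main_property[OF fin M(1) ext_module_rep[OF Mr b] ext_embedding[OF Mr]] by metis
      then show False using nonsplit by blast
    qed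
  qed
qed

theorem mainTheorem1:
  fixes n :: nat
  assumes "n \<ge> 3"
  shows "(\<forall>m\<ge>1.
           let \<mu> = {1} \<union> {2 * i | i. 1 \<le> i \<and> i \<le> m} \<union> {2 * m + 1} in
             \<mu> \<in> gr_measures (kronecker_quiver n) TYPE('k::alg_closed_field) \<and>
             \<not> (\<exists>I. direct_predecessor (kronecker_quiver n) TYPE('k) I \<mu>)) \<and>
         ndp (kronecker_quiver n) TYPE('k) = \<infinity>"
  (is "(\<forall>m\<ge>1. ?P m) \<and> _")
proof
  have all: "odd_measure m \<in> gr_measures (kronecker_quiver n) TYPE('k) \<and>
      \<not> (\<exists>I. direct_predecessor (kronecker_quiver n) TYPE('k) I (odd_measure m))" if "1 \<le> m" for m
  proof
    show "odd_measure m \<in> gr_measures (kronecker_quiver n) TYPE('k)"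
      by (rule odd_measure_is_measure) (use assms that in simp_all)
    show "\<not> (\<exists>I. direct_predecessor (kronecker_quiver n) TYPE('k) I (odd_measure m))"
      using odd_measure_no_predecessor[OF assms that] by blast
  qed
  then show "\<forall>m\<ge>1. ?P m" unfolding Let_def odd_measure_def[symmetric] by blast
  have "odd_measure ` {1..} \<subseteq> no_direct_predecessor (kronecker_quiver n) TYPE('k)"
    unfolding no_direct_predecessor_def using all by auto
  moreover have "infinite (odd_measure ` {1..})"
    using finite_imageD[of odd_measure "{1..}"] odd_measure_inj infinite_Ici[of "1 :: nat"]
    by (auto simp: inj_on_def)
  ultimately have "infinite (no_direct_predecessor (kronecker_quiver n) TYPE('k))"
    using finite_subset by blast
  then show "ndp (kronecker_quiver n) TYPE('k) = \<infinity>" by (simp add: ndp_def)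
qed

end
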